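(* Let $p>0$ be a prime number and let $d\geqslant 3$ be an integer. Let $P\subseteq \operatorname{GL}_2(\mathbb{F}_p)$ be the cyclic group generated by $\begin{bmatrix}1&1\\0&1\end{bmatrix}$, acting in the usual way on the rank two vector space $V=\mathbb{F}_p^2$. Let $G=P\times\dots\times P$ ($d$ copies) act componentwise on $V^{\oplus d}$, and hence on the polynomial ring $T=\mathbb{F}_p[V^{\oplus d}]$ in $2d$ indeterminates, and let $H$ be the diagonal copy of $P$ in $G$. Then the invariant ring $S=T^H$ is not Cohen-Macaulay; moreover, $S$ does not satisfy the Serre condition $(S_3)$, and $S$ has depth $d+2$. In particular, the Cohen-Macaulay defect $\dim S-\operatorname{depth} S$ of $S$ equals $2d-(d+2)=d-2$.
   Context: For a finite rank vector space $W$ over $\mathbb{F}_p$, $\mathbb{F}_p[W]$ denotes the polynomial ring over $\mathbb{F}_p$ on $W$ (the symmetric algebra on the dual space $W^*$), with the induced linear action of any group acting linearly on $W$. The diagonal copy of $P$ in $G=P\times\dots\times P$ is $\{(g,\dots,g)\mid g\in P\}$. The ring $S$ is $\mathbb{N}$-graded with degree zero component $\mathbb{F}_p$, and $\operatorname{depth} S$ denotes its depth with respect to its homogeneous maximal ideal. The Cohen-Macaulay defect of $S$ is $\dim S-\operatorname{depth} S$. *)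

theory Defs
  imports
    "HOL-Analysis.Analysis"
    "HOL-Algebra.Algebra"
    "HOL-Library.Poly_Mapping"
    "HOL-Library.Extended_Nat"
    "Berlekamp_Zassenhaus.Finite_Field"
begin

section \<open>Commutative algebra\<close>

definition prime_chain :: "('a, 'b) ring_scheme \<Rightarrow> 'a set list \<Rightarrow> bool" where
  "prime_chain R qs \<longleftrightarrow> (\<forall>q\<in>set qs. primeideal q R) \<and> sorted_wrt (\<subset>) qs"

definition krull_dim :: "('a, 'b) ring_scheme \<Rightarrow> enat" where
  "krull_dim R = Sup {enat n | n. \<exists>qs. prime_chain R qs \<and> length qs = Suc n}"

text \<open>The second conjunct says that \<open>xs ! i\<close> is a nonzerodivisor on
  \<open>R/(xs ! 0, \<dots>, xs ! (i - 1))\<close>.\<close>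

definition regular_sequence :: "('a, 'b) ring_scheme \<Rightarrow> 'a list \<Rightarrow> bool" where
  "regular_sequence R xs \<longleftrightarrow>
     set xs \<subseteq> carrier R \<and>
     (\<forall>i<length xs. \<forall>a\<in>carrier R.
        xs ! i \<otimes>\<^bsub>R\<^esub> a \<in> Idl\<^bsub>R\<^esub> (set (take i xs)) \<longrightarrow> a \<in> Idl\<^bsub>R\<^esub> (set (take i xs))) \<and>
     Idl\<^bsub>R\<^esub> (set xs) \<noteq> carrier R"

definition depth :: "('a, 'b) ring_scheme \<Rightarrow> 'a set \<Rightarrow> enat" where
  "depth R I = Sup {enat (length xs) | xs. regular_sequence R xs \<and> set xs \<subseteq> I}"

text \<open>The fraction \<open>a/s\<close> of the localization of \<open>R\<close> at the prime ideal \<open>q\<close> is the set of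
  all pairs \<open>(b, t)\<close> with \<open>t \<notin> q\<close> and \<open>u (a t - b s) = 0\<close> for some \<open>u \<notin> q\<close>. Sum and product
  of two classes are the unions over all representatives.\<close>

definition fraction :: "('a, 'b) ring_scheme \<Rightarrow> 'a set \<Rightarrow> 'a \<Rightarrow> 'a \<Rightarrow> ('a \<times> 'a) set" where
  "fraction R q a s = {(b, t). b \<in> carrier R \<and> t \<in> carrier R - q \<and>
     (\<exists>u\<in>carrier R - q. u \<otimes>\<^bsub>R\<^esub> (a \<otimes>\<^bsub>R\<^esub> t) = u \<otimes>\<^bsub>R\<^esub> (b \<otimes>\<^bsub>R\<^esub> s))}"

definition localization :: "('a, 'b) ring_scheme \<Rightarrow> 'a set \<Rightarrow> ('a \<times> 'a) set ring" where
  "localization R q =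
     \<lparr>carrier = {fraction R q a s | a s. a \<in> carrier R \<and> s \<in> carrier R - q},
      monoid.mult = (\<lambda>A B. \<Union>{fraction R q (a \<otimes>\<^bsub>R\<^esub> b) (s \<otimes>\<^bsub>R\<^esub> t) | a s b t.
                                (a, s) \<in> A \<and> (b, t) \<in> B}),
      one = fraction R q \<one>\<^bsub>R\<^esub> \<one>\<^bsub>R\<^esub>,
      ring.zero = fraction R q \<zero>\<^bsub>R\<^esub> \<one>\<^bsub>R\<^esub>,
      add = (\<lambda>A B. \<Union>{fraction R q (a \<otimes>\<^bsub>R\<^esub> t \<oplus>\<^bsub>R\<^esub> b \<otimes>\<^bsub>R\<^esub> s) (s \<otimes>\<^bsub>R\<^esub> t) | a s b t.
                         (a, s) \<in> A \<and> (b, t) \<in> B})\<rparr>"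

definition localization_max_ideal :: "('a, 'b) ring_scheme \<Rightarrow> 'a set \<Rightarrow> ('a \<times> 'a) set set" where
  "localization_max_ideal R q = {fraction R q a s | a s. a \<in> q \<and> s \<in> carrier R - q}"

definition local_depth :: "('a, 'b) ring_scheme \<Rightarrow> 'a set \<Rightarrow> enat" where
  "local_depth R q = depth (localization R q) (localization_max_ideal R q)"

text \<open>For noetherian commutative rings; noetherianness itself is not part of the definitions.\<close>

definition cohen_macaulay :: "('a, 'b) ring_scheme \<Rightarrow> bool" where
  "cohen_macaulay R \<longleftrightarrow>
     (\<forall>q. primeideal q R \<longrightarrow> local_depth R q = krull_dim (localization R q))"

definition serre_condition :: "nat \<Rightarrow> ('a, 'b) ring_scheme \<Rightarrow> bool" where
  "serre_condition k R \<longleftrightarrow>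
     (\<forall>q. primeideal q R \<longrightarrow> min (enat k) (krull_dim (localization R q)) \<le> local_depth R q)"

definition cm_defect :: "('a, 'b) ring_scheme \<Rightarrow> 'a set \<Rightarrow> enat" where
  "cm_defect R I = krull_dim R - depth R I"


section \<open>The polynomial ring on \<open>V\<^sup>d\<close>\<close>

text \<open>The space \<open>V\<^sup>d\<close> with \<open>V = k\<^sup>2\<close> is \<open>'k ^ 2 ^ 'd\<close>, where \<open>d = CARD('d)\<close>. The variable
  \<open>(i, j)\<close> of the polynomial ring stands for the coordinate function \<open>w \<mapsto> w $ i $ j\<close>.\<close>

type_synonym ('d, 'k) poly_ring = "(('d \<times> 2) \<Rightarrow>\<^sub>0 nat) \<Rightarrow>\<^sub>0 'k"

definition poly_const :: "'k::field \<Rightarrow> ('d, 'k) poly_ring" where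
  "poly_const c = Poly_Mapping.single 0 c"

definition poly_var :: "'d \<times> 2 \<Rightarrow> ('d, 'k::field) poly_ring" where
  "poly_var v = Poly_Mapping.single (Poly_Mapping.single v 1) 1"

definition poly_subst ::
  "('d \<times> 2 \<Rightarrow> ('d, 'k) poly_ring) \<Rightarrow> ('d, 'k::field) poly_ring \<Rightarrow> ('d, 'k) poly_ring" where
  "poly_subst \<sigma> f =
     (\<Sum>m\<in>Poly_Mapping.keys f. poly_const (Poly_Mapping.lookup f m) *
        (\<Prod>v\<in>Poly_Mapping.keys m. \<sigma> v ^ Poly_Mapping.lookup m v))"

text \<open>A linear functional as an element of degree one, expanded in the dual basis.\<close>

definition linear_form :: "('k::field ^ 2 ^ 'd::finite \<Rightarrow> 'k) \<Rightarrow> ('d, 'k) poly_ring" where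
  "linear_form l = (\<Sum>i\<in>UNIV. \<Sum>j\<in>UNIV. poly_const (l (axis i (axis j 1))) * poly_var (i, j))"

definition pullback ::
  "('k::field ^ 2 ^ 'd::finite \<Rightarrow> 'k ^ 2 ^ 'd) \<Rightarrow> ('d, 'k) poly_ring \<Rightarrow> ('d, 'k) poly_ring" where
  "pullback \<phi> = poly_subst (\<lambda>(i, j). linear_form (\<lambda>w. \<phi> w $ i $ j))"


section \<open>The groups and their action\<close>

definition GL2 :: "('k::field ^ 2 ^ 2) monoid" where
  "GL2 = \<lparr>carrier = {A. invertible A}, monoid.mult = (**), one = mat 1\<rparr>"

definition unipotent_gen :: "'k::field ^ 2 ^ 2" where
  "unipotent_gen = vector [vector [1, 1], vector [0, 1]]"

definition P_group :: "('k::field ^ 2 ^ 2) monoid" where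
  "P_group = GL2\<lparr>carrier := generate GL2 {unipotent_gen}\<rparr>"

definition G_group :: "('d \<Rightarrow> 'k::field ^ 2 ^ 2) monoid" where
  "G_group = product_group UNIV (\<lambda>_. P_group)"

definition diagonal_P :: "('d \<Rightarrow> 'k::field ^ 2 ^ 2) set" where
  "diagonal_P = {(\<lambda>_. g) | g. g \<in> carrier P_group}"

definition act_space :: "('d \<Rightarrow> 'k ^ 2 ^ 2) \<Rightarrow> 'k::field ^ 2 ^ 'd::finite \<Rightarrow> 'k ^ 2 ^ 'd" where
  "act_space g w = (\<chi> i. g i *v (w $ i))"

text \<open>The induced action on polynomials is \<open>(g f)(w) = f (g\<^sup>-\<^sup>1 w)\<close>.\<close>

definition act_poly ::
  "('d::finite \<Rightarrow> 'k ^ 2 ^ 2) \<Rightarrow> ('d, 'k::field) poly_ring \<Rightarrow> ('d, 'k) poly_ring" where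
  "act_poly g = pullback (act_space (inv\<^bsub>G_group\<^esub> g))"

definition invariant_ring :: "('d::finite \<Rightarrow> 'k::field ^ 2 ^ 2) set \<Rightarrow> ('d, 'k) poly_ring ring" where
  "invariant_ring H =
     \<lparr>carrier = {f. \<forall>h\<in>H. act_poly h f = f},
      monoid.mult = (*), one = 1, ring.zero = 0, add = (+)\<rparr>"

definition total_degree :: "('v \<Rightarrow>\<^sub>0 nat) \<Rightarrow> nat" where
  "total_degree m = (\<Sum>v\<in>Poly_Mapping.keys m. Poly_Mapping.lookup m v)"

text \<open>The homogeneous maximal ideal of a graded subring: the elements all of whose
  homogeneous components have positive degree.\<close>

definition irrelevant_ideal :: "('d, 'k::zero) poly_ring ring \<Rightarrow> ('d, 'k) poly_ring set" where
  "irrelevant_ideal R = {f \<in> carrier R. \<forall>m\<in>Poly_Mapping.keys f. 0 < total_degree m}"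

end

(*
  Write x_i, y_i for the coordinate functions, sigma for the generator x_i |-> x_i + y_i and
  T for the polynomial ring, so that S is the ring of sigma-invariants.

  The 2x2 minors x_i y_j - x_j y_i lie in S and form a cocycle of degree 2 in the Koszul complex of
  y_1, ..., y_d over S. Over T it is the boundary of (x_1, ..., x_d), but if s times it is a boundary
  over S, then s = (sigma - 1) t for some t in T, and hence s lies in the ideal q generated by
  the y_i. Koszul cohomology vanishes in degrees below n as soon as there is a regular
  sequence of length n whose elements have powers in the ideal of the Koszul generators. Over the
  localization of S at q, a prime of height at least 3, this bounds the depth by 2. Dividing out
  first the regular sequence of norms N_i = x_i^p - x_i y_i^(p-1), it bounds the depth of S by d + 2.
  Conversely N_1, ..., N_d, y_1, y_2 is a regular sequence, because division with remainder by
  the N_i commutes with sigma. The powers needed above come from expanding the norm of an element.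

  For the dimension, a chain of n + 1 primes produces at least 2^(m^n) elements of degree O(m),
  whereas over a finite field there are only exp(O(m^(2d))) polynomials of degree O(m).
*)

theory Submission
  imports Defs
begin


section \<open>Evaluating polynomials\<close>

text \<open>An upper bound for the depth must cover every regular sequence, of which nothing is
  known, and no generators of S are available. Koszul cohomology copes with both: the Koszul
  generators matter only up to radical, so the y_i suffice in the localization and the N_i together
  with the y_i suffice globally, while the unknown sequence enters through its length alone. The
  price is that coefficients in T have to be traded for invariant ones, which costs a p-th power.

  The prime q is the contraction to S of the ideal of T generated by the y_i; that ideal defines the
  fixed points of P, where sigma - 1 vanishes. This is why the class of the minors is not killed by
  any element outside q. The bound d >= 3 enters through the height of q.

  Each norm that is divided out shortens the range of vanishing by one degree. A sequence of length
  d + 3 would still leave vanishing in degree 2, which the minors contradict; hence d + 2.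

  The count of polynomials bounds chains of primes of S directly, in place of the integrality of T
  over S and going-up.\<close>

lemma poly_mapping_sum_single:
  fixes f :: "'m \<Rightarrow>\<^sub>0 'c::comm_monoid_add"
  shows "(\<Sum>m\<in>Poly_Mapping.keys f. Poly_Mapping.single m (Poly_Mapping.lookup f m)) = f"
proof (rule poly_mapping_eqI)
  fix k
  show "Poly_Mapping.lookup (\<Sum>m\<in>Poly_Mapping.keys f. Poly_Mapping.single m (Poly_Mapping.lookup f m)) k
      = Poly_Mapping.lookup f k"
    by (cases "k \<in> Poly_Mapping.keys f")
      (auto simp: lookup_sum lookup_single when_def in_keys_iff sum.delta)
qed

lemma poly_mapping_induct [case_names single add]:
  fixes f :: "'m \<Rightarrow>\<^sub>0 'c::comm_monoid_add"
  assumes "\<And>m c. P (Poly_Mapping.single m c)" and "\<And>f g. P f \<Longrightarrow> P g \<Longrightarrow> P (f + g)"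
  shows "P f"
proof -
  have "P (\<Sum>m\<in>A. Poly_Mapping.single m (Poly_Mapping.lookup f m))" if "finite A" for A
    using that
  proof (induction A rule: finite_induct)
    case empty
    \<comment> \<open>The zero polynomial is a monomial with coefficient 0, so it falls under the
      first hypothesis.\<close>
    show ?case using assms(1)[of undefined 0] by simp
  qed (simp add: assms)
  from this[of "Poly_Mapping.keys f"] show ?thesis
    by (simp add: poly_mapping_sum_single)
qed

text \<open>The product runs over all variables instead of the support, so that multiplicativity can
  be read off exponent by exponent.\<close>

definition eval_monom :: "('v::finite \<Rightarrow> 'r::comm_ring_1) \<Rightarrow> ('v \<Rightarrow>\<^sub>0 nat) \<Rightarrow> 'r" where
  "eval_monom \<rho> m = (\<Prod>v\<in>UNIV. \<rho> v ^ Poly_Mapping.lookup m v)"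

lemma eval_monom_keys:
  "eval_monom \<rho> m = (\<Prod>v\<in>Poly_Mapping.keys m. \<rho> v ^ Poly_Mapping.lookup m v)"
  unfolding eval_monom_def
  by (rule prod.mono_neutral_right) (auto simp: in_keys_iff)

lemma eval_monom_0 [simp]: "eval_monom \<rho> 0 = 1"
  by (simp add: eval_monom_def)

lemma eval_monom_add: "eval_monom \<rho> (m + n) = eval_monom \<rho> m * eval_monom \<rho> n"
  by (simp add: eval_monom_def lookup_add power_add prod.distrib)

lemma eval_monom_single [simp]: "eval_monom \<rho> (Poly_Mapping.single v n) = \<rho> v ^ n"
proof -
  have "eval_monom \<rho> (Poly_Mapping.single v n) = (\<Prod>u\<in>UNIV. if u = v then \<rho> v ^ n else 1)"
    unfolding eval_monom_def by (intro prod.cong) (auto simp: lookup_single when_def)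
  then show ?thesis by simp
qed

lemma eval_monom_cong:
  "(\<And>v. v \<in> Poly_Mapping.keys m \<Longrightarrow> \<rho> v = \<rho>' v) \<Longrightarrow> eval_monom \<rho> m = eval_monom \<rho>' m"
  by (simp add: eval_monom_keys)

definition poly_eval ::
  "('k::comm_ring_1 \<Rightarrow> 'r::comm_ring_1) \<Rightarrow> ('v::finite \<Rightarrow> 'r) \<Rightarrow> (('v \<Rightarrow>\<^sub>0 nat) \<Rightarrow>\<^sub>0 'k) \<Rightarrow> 'r" where
  "poly_eval \<iota> \<rho> f = (\<Sum>m\<in>Poly_Mapping.keys f. \<iota> (Poly_Mapping.lookup f m) * eval_monom \<rho> m)"

text \<open>The instances are two embeddings of the coefficients as constants: into the polynomials
  with renamed variables and into T itself.\<close>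

locale coeff_hom =
  fixes \<iota> :: "'k::comm_ring_1 \<Rightarrow> 'r::comm_ring_1"
  assumes hom_add: "\<iota> (a + b) = \<iota> a + \<iota> b" and hom_mult: "\<iota> (a * b) = \<iota> a * \<iota> b" and hom_one: "\<iota> 1 = 1"
begin

lemma hom_zero: "\<iota> 0 = 0"
  using hom_add[of 0 0] by simp

lemma poly_eval_superset:
  assumes "finite A" "Poly_Mapping.keys f \<subseteq> A"
  shows "poly_eval \<iota> \<rho> f = (\<Sum>m\<in>A. \<iota> (Poly_Mapping.lookup f m) * eval_monom \<rho> m)"
  unfolding poly_eval_def using assms
  by (intro sum.mono_neutral_left) (auto simp: in_keys_iff hom_zero)

lemma poly_eval_single: "poly_eval \<iota> \<rho> (Poly_Mapping.single m c) = \<iota> c * eval_monom \<rho> m"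
  by (subst poly_eval_superset[of "{m}"]) auto

lemma poly_eval_add: "poly_eval \<iota> \<rho> (f + g) = poly_eval \<iota> \<rho> f + poly_eval \<iota> \<rho> g"
proof -
  let ?A = "Poly_Mapping.keys f \<union> Poly_Mapping.keys g"
  have "poly_eval \<iota> \<rho> (f + g) = (\<Sum>m\<in>?A. \<iota> (Poly_Mapping.lookup (f + g) m) * eval_monom \<rho> m)"
    by (rule poly_eval_superset) (use Poly_Mapping.keys_add[of f g] in auto)
  also have "\<dots> = (\<Sum>m\<in>?A. \<iota> (Poly_Mapping.lookup f m) * eval_monom \<rho> m)
               + (\<Sum>m\<in>?A. \<iota> (Poly_Mapping.lookup g m) * eval_monom \<rho> m)"
    by (simp add: lookup_add hom_add distrib_right sum.distrib)
  also have "\<dots> = poly_eval \<iota> \<rho> f + poly_eval \<iota> \<rho> g"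
    by (simp add: poly_eval_superset[of ?A f] poly_eval_superset[of ?A g])
  finally show ?thesis .
qed

lemma poly_eval_mult: "poly_eval \<iota> \<rho> (f * g) = poly_eval \<iota> \<rho> f * poly_eval \<iota> \<rho> g"
proof (induction f rule: poly_mapping_induct)
  case (single m c)
  show ?case
  proof (induction g rule: poly_mapping_induct)
    case (single n d)
    show ?case by (simp add: mult_single poly_eval_single eval_monom_add hom_mult)
  qed (simp add: poly_eval_add distrib_left)
qed (simp add: poly_eval_add distrib_right)

lemma poly_eval_one: "poly_eval \<iota> \<rho> 1 = 1"
  using poly_eval_single[of \<rho> 0 1] by (simp add: hom_one)

lemma poly_eval_zero: "poly_eval \<iota> \<rho> 0 = 0"
  by (simp add: poly_eval_def)

end

lemma single_power:
  "(Poly_Mapping.single m (c :: 'k::comm_ring_1)) ^ n = Poly_Mapping.single (\<Sum>_<n. m) (c ^ n)"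
  for m :: "'m::comm_monoid_add"
  by (induction n) (simp_all add: mult_single add.commute)

lemma prod_single_one:
  "finite A \<Longrightarrow> (\<Prod>v\<in>A. Poly_Mapping.single (g v) (1 :: 'k::comm_ring_1)) = Poly_Mapping.single (\<Sum>v\<in>A. g v) 1"
  for g :: "'v \<Rightarrow> 'm::comm_monoid_add"
  by (induction A rule: finite_induct) (simp_all add: mult_single)

lemma sum_const_single: "(\<Sum>_<n. Poly_Mapping.single v (1::nat)) = Poly_Mapping.single v n"
  by (induction n) (simp_all flip: single_add)

lemma eval_monom_vars:
  "eval_monom (\<lambda>v. Poly_Mapping.single (Poly_Mapping.single (h v) 1) (1 :: 'k::comm_ring_1)) m
     = Poly_Mapping.single (\<Sum>v\<in>UNIV. Poly_Mapping.single (h v) (Poly_Mapping.lookup m v)) 1"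
  by (simp add: eval_monom_def single_power sum_const_single prod_single_one del: One_nat_def)

text \<open>The library only makes polynomials an integral domain when the indeterminates are
  linearly ordered, so they are first renamed to natural numbers.\<close>

lemma poly_no_zero_divisors:
  fixes f g :: "('v::finite \<Rightarrow>\<^sub>0 nat) \<Rightarrow>\<^sub>0 'k::idom"
  assumes "f * g = 0"
  shows "f = 0 \<or> g = 0"
proof -
  obtain h :: "'v \<Rightarrow> nat" where h: "inj h"
    using finite_imp_inj_to_nat_seg[of "UNIV :: 'v set"] by auto
  define \<phi> :: "('v \<Rightarrow>\<^sub>0 nat) \<Rightarrow> nat \<Rightarrow>\<^sub>0 nat"
    where "\<phi> m = (\<Sum>v\<in>UNIV. Poly_Mapping.single (h v) (Poly_Mapping.lookup m v))" for m
  have lookup_\<phi>: "Poly_Mapping.lookup (\<phi> m) (h v) = Poly_Mapping.lookup m v" for m v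
    using h by (auto simp: \<phi>_def lookup_sum lookup_single when_def inj_eq)
  have inj_\<phi>: "m = n" if "\<phi> m = \<phi> n" for m n
    using that lookup_\<phi> by (metis poly_mapping_eqI)
  interpret coeff_hom "Poly_Mapping.single 0 :: 'k \<Rightarrow> (nat \<Rightarrow>\<^sub>0 nat) \<Rightarrow>\<^sub>0 'k"
    by unfold_locales (simp_all add: single_add mult_single)
  define E :: "(('v \<Rightarrow>\<^sub>0 nat) \<Rightarrow>\<^sub>0 'k) \<Rightarrow> (nat \<Rightarrow>\<^sub>0 nat) \<Rightarrow>\<^sub>0 'k"
    where "E = poly_eval (Poly_Mapping.single 0) (\<lambda>v. Poly_Mapping.single (Poly_Mapping.single (h v) 1) 1)"
  have E: "E f = (\<Sum>m\<in>Poly_Mapping.keys f. Poly_Mapping.single (\<phi> m) (Poly_Mapping.lookup f m))" for f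
    by (simp add: E_def poly_eval_def eval_monom_vars[of h] mult_single flip: \<phi>_def del: One_nat_def)
  have "Poly_Mapping.lookup (E f) (\<phi> m) = Poly_Mapping.lookup f m" for f m
  proof -
    have "Poly_Mapping.lookup (E f) (\<phi> m)
        = (\<Sum>m'\<in>Poly_Mapping.keys f. if m' = m then Poly_Mapping.lookup f m else 0)"
      unfolding E lookup_sum
      by (intro sum.cong) (auto simp: lookup_single when_def dest: inj_\<phi>)
    then show ?thesis by (auto simp: in_keys_iff)
  qed
  then have inj_E: "f = 0" if "E f = 0" for f
    using that by (metis lookup_zero poly_mapping_eqI)
  have "E f * E g = 0"
    using assms poly_eval_mult poly_eval_zero by (metis E_def)
  then show ?thesis using inj_E by auto
qed


section \<open>Regular sequences and Koszul cohomology\<close>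

text \<open>The Koszul complex of \<open>f\<close> with all functions on \<open>n\<close>-tuples of indices as its cochains of degree \<open>n\<close>,
  not only the alternating ones. The cochains of degree \<open>- 1\<close> are zero, since the sum over the
  positions of the empty list is empty.\<close>

primrec koszul_diff :: "('a, 'b) ring_scheme \<Rightarrow> ('i \<Rightarrow> 'a) \<Rightarrow> 'i list \<Rightarrow> ('i list \<Rightarrow> 'a) \<Rightarrow> 'a" where
  "koszul_diff R f [] w = \<zero>\<^bsub>R\<^esub>"
| "koszul_diff R f (j # l) w = f j \<otimes>\<^bsub>R\<^esub> w l \<ominus>\<^bsub>R\<^esub> koszul_diff R f l (\<lambda>l'. w (j # l'))"

text \<open>Vanishing of the n-th Koszul cohomology of \<open>R/I\<close>, phrased with
  representatives in \<open>R\<close>, so that neither quotient rings nor modules occur. A single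
  function holds cochains of all degrees, and the length of the list selects the degree. For
  \<open>n = 0\<close> the differential at \<open>[]\<close> is zero, and the condition says that no
  nonzero element of \<open>R/I\<close> is killed by all \<open>f j\<close>.\<close>

definition koszul_exact :: "('a, 'b) ring_scheme \<Rightarrow> ('i \<Rightarrow> 'a) \<Rightarrow> 'a set \<Rightarrow> nat \<Rightarrow> bool" where
  "koszul_exact R f I n \<longleftrightarrow>
     (\<forall>z. range z \<subseteq> carrier R \<and> (\<forall>l. length l = Suc n \<longrightarrow> koszul_diff R f l z \<in> I) \<longrightarrow>
        (\<exists>w. range w \<subseteq> carrier R \<and> (\<forall>l. length l = n \<longrightarrow> z l \<ominus>\<^bsub>R\<^esub> koszul_diff R f l w \<in> I)))"

context cring
begin

lemma minus_in_ideal: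
  assumes "ideal I R" "a \<in> I" "b \<in> I" shows "a \<ominus> b \<in> I"
  using assms by (simp add: a_minus_def ideal.axioms(1) additive_subgroup.a_closed
      additive_subgroup.a_inv_closed)

lemma add_in_ideal:
  assumes "ideal I R" "a \<in> I" "b \<in> I" shows "a \<oplus> b \<in> I"
  using assms by (simp add: ideal.axioms(1) additive_subgroup.a_closed)

text \<open>Membership in the larger ideal becomes a congruence modulo the smaller one; every step
  along a regular sequence below has this form.\<close>

lemma genideal_insert:
  assumes "A \<subseteq> carrier R" "x \<in> carrier R"
  shows "Idl (insert x A) = {a \<oplus> c \<otimes> x | a c. a \<in> Idl A \<and> c \<in> carrier R}"
proof (rule antisym)
  have A: "ideal (Idl A) R" using assms genideal_ideal by auto
  have eq: "{a \<oplus> c \<otimes> x | a c. a \<in> Idl A \<and> c \<in> carrier R} = Idl A <+>\<^bsub>R\<^esub> PIdl x"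
    unfolding set_add_def' cgenideal_def by blast
  have I: "ideal (Idl A <+>\<^bsub>R\<^esub> PIdl x) R"
    using add_ideals[OF A] cgenideal_ideal assms by auto
  show "Idl (insert x A) \<subseteq> {a \<oplus> c \<otimes> x | a c. a \<in> Idl A \<and> c \<in> carrier R}"
  proof (subst eq, rule genideal_minimal[OF I], safe)
    have "x = \<zero> \<oplus> \<one> \<otimes> x" using assms by simp
    then show "x \<in> Idl A <+>\<^bsub>R\<^esub> PIdl x"
      using additive_subgroup.zero_closed[OF ideal.axioms(1)[OF A]] unfolding eq[symmetric] by blast
  next
    fix a assume a: "a \<in> A"
    have "a = a \<oplus> \<zero> \<otimes> x" using assms a by auto
    then show "a \<in> Idl A <+>\<^bsub>R\<^esub> PIdl x"
      using genideal_self[OF assms(1)] a unfolding eq[symmetric] by blast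
  qed
  have J: "ideal (Idl (insert x A)) R" using assms genideal_ideal by auto
  have "Idl A \<subseteq> Idl (insert x A)" by (rule subset_Idl_subset) (use assms in auto)
  moreover have "x \<in> Idl (insert x A)" using genideal_self[of "insert x A"] assms by auto
  ultimately show "{a \<oplus> c \<otimes> x | a c. a \<in> Idl A \<and> c \<in> carrier R} \<subseteq> Idl (insert x A)"
    using add_in_ideal[OF J] ideal.I_l_closed[OF J] by auto
qed

end

section \<open>The Koszul complex of a family of elements\<close>

locale koszul = cring R for R :: "('a, 'b) ring_scheme" (structure) +
  fixes f :: "'i \<Rightarrow> 'a"
  assumes f_closed [simp]: "f i \<in> carrier R"
begin

abbreviation diff ("\<partial>") where "diff \<equiv> koszul_diff R f"

lemma diff_closed [simp]: "range w \<subseteq> carrier R \<Longrightarrow> \<partial> l w \<in> carrier R"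
proof (induction l arbitrary: w)
  case (Cons j l)
  have "range (\<lambda>l'. w (j # l')) \<subseteq> carrier R" using Cons.prems by auto
  moreover have "w l \<in> carrier R" using Cons.prems by auto
  ultimately show ?case using Cons.IH by simp
qed simp

lemma range_diff: "range w \<subseteq> carrier R \<Longrightarrow> range (\<lambda>l. \<partial> l w) \<subseteq> carrier R"
  by auto

lemma diff_minus:
  "range v \<subseteq> carrier R \<Longrightarrow> range w \<subseteq> carrier R \<Longrightarrow> \<partial> l (\<lambda>l. v l \<ominus> w l) = \<partial> l v \<ominus> \<partial> l w"
proof (induction l arbitrary: v w)
  case (Cons j l)
  have r: "range (\<lambda>l'. v (j # l')) \<subseteq> carrier R" "range (\<lambda>l'. w (j # l')) \<subseteq> carrier R"
    using Cons.prems by auto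
  have *: "v l \<in> carrier R" "w l \<in> carrier R" using Cons.prems by auto
  have "a \<otimes> (b \<ominus> c) \<ominus> (d \<ominus> e) = (a \<otimes> b \<ominus> d) \<ominus> (a \<otimes> c \<ominus> e)"
    if "a \<in> carrier R" "b \<in> carrier R" "c \<in> carrier R" "d \<in> carrier R" "e \<in> carrier R" for a b c d e
    using that by algebra
  from this[OF f_closed * diff_closed[OF r(1)] diff_closed[OF r(2)]]
  show ?case by (simp add: Cons.IH[OF r])
qed (simp add: a_minus_def)

lemma diff_smult:
  "range w \<subseteq> carrier R \<Longrightarrow> x \<in> carrier R \<Longrightarrow> \<partial> l (\<lambda>l. x \<otimes> w l) = x \<otimes> \<partial> l w"
proof (induction l arbitrary: w)
  case (Cons j l)
  have r: "range (\<lambda>l'. w (j # l')) \<subseteq> carrier R" using Cons.prems by auto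
  have *: "w l \<in> carrier R" using Cons.prems by auto
  have "a \<otimes> (x \<otimes> b) \<ominus> x \<otimes> c = x \<otimes> (a \<otimes> b \<ominus> c)"
    if "a \<in> carrier R" "b \<in> carrier R" "c \<in> carrier R" for a b c
    using that Cons.prems(2) by algebra
  from this[OF f_closed * diff_closed[OF r]]
  show ?case by (simp add: Cons.IH[OF r Cons.prems(2)])
qed simp

text \<open>Splitting off the first index \<open>j\<close> yields \<open>f j\<close> times the
  differential of \<open>w\<close> twice, with opposite signs, and the double differential of
  \<open>w\<close> with first index fixed to \<open>j\<close>. The latter is why the induction keeps
  \<open>w\<close> arbitrary.\<close>

lemma diff_diff: "range w \<subseteq> carrier R \<Longrightarrow> \<partial> l (\<lambda>l. \<partial> l w) = \<zero>"
proof (induction l arbitrary: w)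
  case (Cons j l)
  define h where "h l' = w (j # l')" for l'
  have r: "range h \<subseteq> carrier R" using Cons.prems by (auto simp: h_def)
  have r2: "range (\<lambda>l'. f j \<otimes> w l') \<subseteq> carrier R" using Cons.prems by auto
  have "\<partial> l (\<lambda>l'. \<partial> (j # l') w) = \<partial> l (\<lambda>l'. f j \<otimes> w l' \<ominus> \<partial> l' h)"
    by (simp add: h_def[abs_def])
  also have "\<dots> = \<partial> l (\<lambda>l'. f j \<otimes> w l') \<ominus> \<partial> l (\<lambda>l'. \<partial> l' h)"
    by (rule diff_minus[OF r2 range_diff[OF r]])
  also have "\<dots> = f j \<otimes> \<partial> l w \<ominus> \<zero>"
    using Cons.IH[OF r] by (simp add: diff_smult Cons.prems)
  finally show ?case using diff_closed[OF Cons.prems(1)] by (simp add: a_minus_def r_neg)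
qed simp

lemma diff_in_ideal:
  assumes I: "ideal I R"
  shows "range w \<subseteq> carrier R \<Longrightarrow> (\<And>l'. Suc (length l') = length l \<Longrightarrow> w l' \<in> I) \<Longrightarrow> \<partial> l w \<in> I"
proof (induction l arbitrary: w)
  case Nil
  show ?case using I by (simp add: additive_subgroup.zero_closed ideal.axioms(1))
next
  case (Cons j l)
  have "\<partial> l (\<lambda>l'. w (j # l')) \<in> I" using Cons.prems by (intro Cons.IH) auto
  moreover have "f j \<otimes> w l \<in> I" using Cons.prems I by (simp add: ideal.I_l_closed)
  ultimately show ?case using minus_in_ideal[OF I] by simp
qed

lemma diff_cong_ideal:
  assumes I: "ideal I R" and r: "range v \<subseteq> carrier R" "range w \<subseteq> carrier R"
    and "\<And>l'. Suc (length l') = length l \<Longrightarrow> v l' \<ominus> w l' \<in> I"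
  shows "\<partial> l v \<ominus> \<partial> l w \<in> I"
  unfolding diff_minus[OF r, symmetric] using assms
  by (intro diff_in_ideal[OF I]) auto

text \<open>Prepending \<open>j\<close> is a homotopy between multiplication by \<open>f j\<close> and zero, so the ideal generated
  by the \<open>f j\<close> annihilates the cohomology.\<close>

lemma annihilates_cohomology:
  assumes I: "ideal I R" and z: "range z \<subseteq> carrier R"
    and cocycle: "\<And>l. length l = Suc n \<Longrightarrow> \<partial> l z \<in> I" and x: "x \<in> Idl (range f)"
  shows "\<exists>w. range w \<subseteq> carrier R \<and> (\<forall>l. length l = n \<longrightarrow> x \<otimes> z l \<ominus> \<partial> l w \<in> I)"
proof -
  \<comment> \<open>\<open>K\<close> consists of the multipliers that turn \<open>z\<close> into a
    coboundary modulo \<open>I\<close>. It is an ideal, so it is enough to find each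
    \<open>f j\<close> in it.\<close>
  define K where "K = {x \<in> carrier R. \<exists>w. range w \<subseteq> carrier R \<and> (\<forall>l. length l = n \<longrightarrow> x \<otimes> z l \<ominus> \<partial> l w \<in> I)}"
  have zc: "z l \<in> carrier R" for l using z by auto
  have I0: "\<zero> \<in> I" using I by (simp add: additive_subgroup.zero_closed ideal.axioms(1))
  have mult: "c \<otimes> x \<in> K" if "x \<in> K" "c \<in> carrier R" for x c
  proof -
    from that obtain w where w: "x \<in> carrier R" "range w \<subseteq> carrier R"
      "\<And>l. length l = n \<Longrightarrow> x \<otimes> z l \<ominus> \<partial> l w \<in> I" by (auto simp: K_def)
    have "c \<otimes> x \<otimes> z l \<ominus> \<partial> l (\<lambda>l. c \<otimes> w l) \<in> I" if l: "length l = n" for l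
    proof -
      have "c \<otimes> x \<otimes> z l \<ominus> \<partial> l (\<lambda>l. c \<otimes> w l) = c \<otimes> (x \<otimes> z l \<ominus> \<partial> l w)"
        unfolding diff_smult[OF w(2) \<open>c \<in> carrier R\<close>]
        using w(1) zc[of l] diff_closed[OF w(2), of l] \<open>c \<in> carrier R\<close> by algebra
      then show ?thesis using ideal.I_l_closed[OF I w(3)[OF l] \<open>c \<in> carrier R\<close>] by simp
    qed
    moreover have "range (\<lambda>l. c \<otimes> w l) \<subseteq> carrier R" using that w by auto
    ultimately show ?thesis using w that by (auto simp: K_def)
  qed
  have minus: "x \<ominus> y \<in> K" if "x \<in> K" "y \<in> K" for x y
  proof -
    from that obtain v where v: "x \<in> carrier R" "range v \<subseteq> carrier R"
      "\<And>l. length l = n \<Longrightarrow> x \<otimes> z l \<ominus> \<partial> l v \<in> I" by (auto simp: K_def)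
    from that obtain w where w: "y \<in> carrier R" "range w \<subseteq> carrier R"
      "\<And>l. length l = n \<Longrightarrow> y \<otimes> z l \<ominus> \<partial> l w \<in> I" by (auto simp: K_def)
    have "(x \<ominus> y) \<otimes> z l \<ominus> \<partial> l (\<lambda>l. v l \<ominus> w l) \<in> I" if l: "length l = n" for l
    proof -
      have "(x \<ominus> y) \<otimes> z l \<ominus> \<partial> l (\<lambda>l. v l \<ominus> w l) = (x \<otimes> z l \<ominus> \<partial> l v) \<ominus> (y \<otimes> z l \<ominus> \<partial> l w)"
        unfolding diff_minus[OF v(2) w(2)]
        using v(1) w(1) zc[of l] diff_closed[OF w(2), of l] diff_closed[OF v(2), of l] by algebra
      then show ?thesis using minus_in_ideal[OF I v(3)[OF l] w(3)[OF l]] by simp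
    qed
    moreover have "range (\<lambda>l. v l \<ominus> w l) \<subseteq> carrier R"
      using v(2) w(2) by (auto intro!: minus_closed)
    ultimately show ?thesis using v w by (auto simp: K_def)
  qed
  have f: "f j \<in> K" for j
  proof -
    have "range (\<lambda>l. z (j # l)) \<subseteq> carrier R" using z by auto
    moreover have "f j \<otimes> z l \<ominus> \<partial> l (\<lambda>l. z (j # l)) \<in> I" if "length l = n" for l
      using cocycle[of "j # l"] that by simp
    ultimately show ?thesis by (auto simp: K_def)
  qed
  have K: "K \<subseteq> carrier R" by (auto simp: K_def)
  have K0: "\<zero> \<in> K" using mult[OF f[of undefined] zero_closed] by simp
  have Kinv: "\<ominus> x \<in> K" if "x \<in> K" for x
    using minus[OF K0 that] K that by (auto simp: a_minus_def)
  have Kadd: "x \<oplus> y \<in> K" if "x \<in> K" "y \<in> K" for x y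
    using minus[OF that(1) Kinv[OF that(2)]] K that by (auto simp: a_minus_def)
  have "ideal K R"
  proof (rule idealI[OF ring_axioms])
    show "subgroup K (add_monoid R)"
      using K K0 Kadd Kinv by (intro subgroup.intro) (auto simp flip: a_inv_def)
    show "c \<otimes> x \<in> K" "x \<otimes> c \<in> K" if "x \<in> K" "c \<in> carrier R" for x c
      using mult[OF that] m_comm[of x c] K that by auto
  qed
  then have "Idl (range f) \<subseteq> K" using f by (intro genideal_minimal) auto
  then show ?thesis using x by (auto simp: K_def)
qed

text \<open>In the long exact sequence of multiplication by \<open>x\<close> on \<open>R/I\<close>,
  with cokernel \<open>R/J\<close>, vanishing in degree \<open>n - 1\<close> over \<open>R/J\<close>
  makes \<open>x\<close> injective on the cohomology of \<open>R/I\<close> in degree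
  \<open>n\<close>. A power of \<open>x\<close> annihilates this cohomology, so it is zero. For
  \<open>n = 0\<close> the preceding degree is \<open>- 1\<close>, where nothing is
  demanded.\<close>

lemma exact_of_nonzerodivisor:
  assumes I: "ideal I R" and x: "x \<in> carrier R"
    and nzd: "\<And>a. a \<in> carrier R \<Longrightarrow> x \<otimes> a \<in> I \<Longrightarrow> a \<in> I"
    and pow: "x [^] (k :: nat) \<in> Idl (range f)"
    and J: "J = {a \<oplus> c \<otimes> x | a c. a \<in> I \<and> c \<in> carrier R}" and J_ideal: "ideal J R"
    and n: "\<And>m. n = Suc m \<Longrightarrow> koszul_exact R f J m"
  shows "koszul_exact R f I n"
  unfolding koszul_exact_def
proof (intro allI impI, elim conjE)
  fix z assume z: "range z \<subseteq> carrier R" and cocycle: "\<forall>l. length l = Suc n \<longrightarrow> \<partial> l z \<in> I"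
  have zc: "z l \<in> carrier R" for l using z by auto
  have Icarr: "a \<in> carrier R" if "a \<in> I" for a using ideal.Icarr[OF I that] .
  \<comment> \<open>One factor \<open>x\<close> is cancelled at a time from a power of
    \<open>x\<close> that makes \<open>z\<close> a coboundary modulo \<open>I\<close>.\<close>
  have "\<exists>w. range w \<subseteq> carrier R \<and> (\<forall>l. length l = n \<longrightarrow> z l \<ominus> \<partial> l w \<in> I)"
    if "\<exists>w. range w \<subseteq> carrier R \<and> (\<forall>l. length l = n \<longrightarrow> x [^] k \<otimes> z l \<ominus> \<partial> l w \<in> I)" for k :: nat
    using that
  proof (induction k)
    case 0
    then show ?case using zc by simp
  next
    case (Suc k)
    then obtain w where w: "range w \<subseteq> carrier R"
      and zw: "\<And>l. length l = n \<Longrightarrow> x [^] Suc k \<otimes> z l \<ominus> \<partial> l w \<in> I" by blast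
    \<comment> \<open>The differential of \<open>w\<close> vanishes modulo \<open>J\<close>, since
      it is congruent to a multiple of \<open>x\<close> modulo \<open>I\<close>. Hence
      \<open>w\<close> is a coboundary plus \<open>x\<close> times some \<open>c\<close> modulo
      \<open>I\<close>, and only the second summand contributes to the differential.\<close>
    have "\<exists>c. range c \<subseteq> carrier R \<and> (\<forall>l. length l = n \<longrightarrow> \<partial> l w \<ominus> x \<otimes> \<partial> l c \<in> I)"
    proof (cases n)
      case 0
      \<comment> \<open>In degree 0 both differentials are taken at \<open>[]\<close> and are zero,
        so any cochain serves as \<open>c\<close>.\<close>
      show ?thesis
        by (rule exI[of _ w]) (use 0 w x I in
            \<open>auto simp: a_minus_def additive_subgroup.zero_closed ideal.axioms(1)\<close>)
    next
      case (Suc m)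
      have "\<partial> l w \<in> J" if l: "length l = Suc m" for l
      proof -
        have *: "x [^] Suc k \<otimes> z l \<ominus> \<partial> l w \<in> I" using zw l Suc by simp
        have "\<partial> l w = (\<ominus> (x [^] Suc k \<otimes> z l \<ominus> \<partial> l w)) \<oplus> (x [^] k \<otimes> z l) \<otimes> x"
          unfolding nat_pow_Suc
          using nat_pow_closed[OF x, of k] x zc[of l] diff_closed[OF w, of l] by algebra
        moreover have "\<ominus> (x [^] Suc k \<otimes> z l \<ominus> \<partial> l w) \<in> I"
          using * I by (simp add: additive_subgroup.a_inv_closed ideal.axioms(1))
        ultimately show ?thesis unfolding J using x zc by blast
      qed
      with n[OF Suc] w obtain v where v: "range v \<subseteq> carrier R"
        and wv: "\<And>l. length l = m \<Longrightarrow> w l \<ominus> \<partial> l v \<in> J"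
        unfolding koszul_exact_def by blast
      \<comment> \<open>Outside the relevant degree the value is zero, so that the chosen function
        has all its values in the carrier.\<close>
      define c where "c l = (if length l = m then SOME c. c \<in> carrier R \<and> (\<exists>a\<in>I. w l \<ominus> \<partial> l v = a \<oplus> c \<otimes> x) else \<zero>)" for l
      have ex: "\<exists>c. c \<in> carrier R \<and> (\<exists>a\<in>I. w l \<ominus> \<partial> l v = a \<oplus> c \<otimes> x)" if "length l = m" for l
        using wv[OF that] unfolding J by blast
      have c: "c l \<in> carrier R \<and> (\<exists>a\<in>I. w l \<ominus> \<partial> l v = a \<oplus> c l \<otimes> x)" if "length l = m" for l
        using someI_ex[OF ex[OF that]] that by (simp add: c_def)
      have cc: "range c \<subseteq> carrier R" using c by (auto simp: c_def)
      have dv: "range (\<lambda>l. \<partial> l v) \<subseteq> carrier R" using v by auto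
      have wc: "w l \<in> carrier R" for l using w by auto
      \<comment> \<open>The sum of the coboundary of \<open>v\<close> and \<open>x\<close> times
        \<open>c\<close> is written as a difference, the form in which additivity of the
        differential is available.\<close>
      have "\<partial> l w \<ominus> \<partial> l (\<lambda>l. \<partial> l v \<ominus> (\<ominus> x) \<otimes> c l) \<in> I" if l: "length l = n" for l
      proof (rule diff_cong_ideal[OF I w])
        show "range (\<lambda>l. \<partial> l v \<ominus> (\<ominus> x) \<otimes> c l) \<subseteq> carrier R" using v cc x by auto
        fix l' :: "'i list" assume "Suc (length l') = length l"
        then have l': "length l' = m" using l Suc by simp
        from c[OF l'] obtain a where a: "a \<in> I" "w l' \<ominus> \<partial> l' v = a \<oplus> c l' \<otimes> x" by auto
        have "w l' \<ominus> (\<partial> l' v \<ominus> (\<ominus> x) \<otimes> c l') = (w l' \<ominus> \<partial> l' v) \<ominus> c l' \<otimes> x"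
          using wc[of l'] diff_closed[OF v, of l'] c[OF l'] x by algebra
        also have "\<dots> = a" unfolding a(2) using Icarr[OF a(1)] c[OF l'] x by algebra
        finally show "w l' \<ominus> (\<partial> l' v \<ominus> (\<ominus> x) \<otimes> c l') \<in> I" using a(1) by simp
      qed
      moreover have "\<partial> l (\<lambda>l. \<partial> l v \<ominus> (\<ominus> x) \<otimes> c l) = x \<otimes> \<partial> l c" for l
      proof -
        have "\<partial> l (\<lambda>l. \<partial> l v \<ominus> (\<ominus> x) \<otimes> c l) = \<partial> l (\<lambda>l. \<partial> l v) \<ominus> \<partial> l (\<lambda>l. (\<ominus> x) \<otimes> c l)"
          by (rule diff_minus[OF dv]) (use cc x in auto)
        also have "\<dots> = \<zero> \<ominus> (\<ominus> x) \<otimes> \<partial> l c"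
          using x by (simp add: diff_diff[OF v] diff_smult[OF cc])
        also have "\<dots> = x \<otimes> \<partial> l c" using x diff_closed[OF cc, of l] by algebra
        finally show ?thesis .
      qed
      ultimately show ?thesis using cc by auto
    qed
    then obtain c where c: "range c \<subseteq> carrier R"
      and wc: "\<And>l. length l = n \<Longrightarrow> \<partial> l w \<ominus> x \<otimes> \<partial> l c \<in> I" by blast
    have "x [^] k \<otimes> z l \<ominus> \<partial> l c \<in> I" if l: "length l = n" for l
    proof (rule nzd)
      show "x [^] k \<otimes> z l \<ominus> \<partial> l c \<in> carrier R" using x zc c by simp
      have "x \<otimes> (x [^] k \<otimes> z l \<ominus> \<partial> l c) = (x [^] Suc k \<otimes> z l \<ominus> \<partial> l w) \<oplus> (\<partial> l w \<ominus> x \<otimes> \<partial> l c)"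
        unfolding nat_pow_Suc using nat_pow_closed[OF x, of k] x zc[of l] diff_closed[OF w, of l] diff_closed[OF c, of l]
        by algebra
      then show "x \<otimes> (x [^] k \<otimes> z l \<ominus> \<partial> l c) \<in> I"
        using add_in_ideal[OF I zw[OF l] wc[OF l]] by simp
    qed
    then show ?case using Suc.IH c by blast
  qed
  from this[OF annihilates_cohomology[OF I z _ pow]] cocycle
  show "\<exists>w. range w \<subseteq> carrier R \<and> (\<forall>l. length l = n \<longrightarrow> z l \<ominus> \<partial> l w \<in> I)" by blast
qed

text \<open>This is the other part of the same long exact sequence: the cohomology of
  \<open>R/J\<close> in degree \<open>n\<close> lies between that of \<open>R/I\<close> in degrees
  \<open>n\<close> and \<open>n + 1\<close>.\<close>

lemma exact_quotient:
  assumes I: "ideal I R" and x: "x \<in> carrier R"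
    and nzd: "\<And>a. a \<in> carrier R \<Longrightarrow> x \<otimes> a \<in> I \<Longrightarrow> a \<in> I"
    and J: "J = {a \<oplus> c \<otimes> x | a c. a \<in> I \<and> c \<in> carrier R}"
    and n: "koszul_exact R f I n" "koszul_exact R f I (Suc n)"
  shows "koszul_exact R f J n"
  unfolding koszul_exact_def
proof (intro allI impI, elim conjE)
  fix z assume z: "range z \<subseteq> carrier R" and cocycle: "\<forall>l. length l = Suc n \<longrightarrow> \<partial> l z \<in> J"
  have zc: "z l \<in> carrier R" for l using z by auto
  have Icarr: "a \<in> carrier R" if "a \<in> I" for a using ideal.Icarr[OF I that] .
  \<comment> \<open>\<open>y\<close> represents the image of \<open>z\<close> under the connecting
    homomorphism: the differential of \<open>z\<close> divided by \<open>x\<close>, modulo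
    \<open>I\<close>.\<close>
  define y where "y l = (if length l = Suc n then SOME c. c \<in> carrier R \<and> (\<exists>a\<in>I. \<partial> l z = a \<oplus> c \<otimes> x) else \<zero>)" for l
  have ex: "\<exists>c. c \<in> carrier R \<and> (\<exists>a\<in>I. \<partial> l z = a \<oplus> c \<otimes> x)" if "length l = Suc n" for l
    using cocycle that unfolding J by blast
  have y0: "y l \<in> carrier R \<and> (\<exists>a\<in>I. \<partial> l z = a \<oplus> y l \<otimes> x)" if "length l = Suc n" for l
    using someI_ex[OF ex[OF that]] that by (simp add: y_def)
  have y: "range y \<subseteq> carrier R" using y0 by (auto simp: y_def)
  have yc: "y l \<in> carrier R" for l using y by auto
  have zy: "\<partial> l z \<ominus> x \<otimes> y l \<in> I" if l: "length l = Suc n" for l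
  proof -
    from y0[OF l] obtain a where a: "a \<in> I" "\<partial> l z = a \<oplus> y l \<otimes> x" by auto
    have "\<partial> l z \<ominus> x \<otimes> y l = a" unfolding a(2) using Icarr[OF a(1)] yc[of l] x by algebra
    then show ?thesis using a by simp
  qed
  \<comment> \<open>Multiplied by \<open>x\<close>, the differential of \<open>y\<close> is
    congruent to the double differential of \<open>z\<close>, which is zero; then \<open>x\<close>
    is cancelled.\<close>
  have "\<partial> l y \<in> I" if l: "length l = Suc (Suc n)" for l
  proof (rule nzd)
    have "\<partial> l (\<lambda>l. \<partial> l z) \<ominus> \<partial> l (\<lambda>l. x \<otimes> y l) \<in> I"
      by (rule diff_cong_ideal[OF I]) (use z yc x l zy in auto)
    then have *: "\<zero> \<ominus> x \<otimes> \<partial> l y \<in> I" by (simp add: diff_diff[OF z] diff_smult[OF y x])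
    have "\<ominus> (\<zero> \<ominus> x \<otimes> \<partial> l y) = x \<otimes> \<partial> l y" using x diff_closed[OF y, of l] by algebra
    then show "x \<otimes> \<partial> l y \<in> I"
      using * I by (metis additive_subgroup.a_inv_closed ideal.axioms(1))
  qed (use y in simp)
  with n(2) y obtain v where v: "range v \<subseteq> carrier R"
    and yv: "\<And>l. length l = Suc n \<Longrightarrow> y l \<ominus> \<partial> l v \<in> I"
    unfolding koszul_exact_def by blast
  have vc: "v l \<in> carrier R" for l using v by auto
  have xv: "range (\<lambda>l. x \<otimes> v l) \<subseteq> carrier R" using vc x by auto
  have zv: "range (\<lambda>l. z l \<ominus> x \<otimes> v l) \<subseteq> carrier R" using zc vc x by auto
  \<comment> \<open>Subtracting \<open>x\<close> times \<open>v\<close> does not change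
    \<open>z\<close> modulo \<open>J\<close>, but it turns a cocycle modulo \<open>J\<close> into a
    cocycle modulo \<open>I\<close>.\<close>
  have "\<partial> l (\<lambda>l. z l \<ominus> x \<otimes> v l) \<in> I" if l: "length l = Suc n" for l
  proof -
    have "\<partial> l (\<lambda>l. z l \<ominus> x \<otimes> v l) = \<partial> l z \<ominus> x \<otimes> \<partial> l v"
      by (simp add: diff_minus[OF z xv] diff_smult[OF v x])
    also have "\<dots> = (\<partial> l z \<ominus> x \<otimes> y l) \<oplus> x \<otimes> (y l \<ominus> \<partial> l v)"
      using diff_closed[OF z, of l] diff_closed[OF v, of l] x yc[of l] by algebra
    also have "\<dots> \<in> I"
      using add_in_ideal[OF I zy[OF l] ideal.I_l_closed[OF I yv[OF l] x]] .
    finally show ?thesis .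
  qed
  with n(1) zv obtain w where w: "range w \<subseteq> carrier R"
    and zw: "\<And>l. length l = n \<Longrightarrow> (z l \<ominus> x \<otimes> v l) \<ominus> \<partial> l w \<in> I"
    unfolding koszul_exact_def by blast
  have "z l \<ominus> \<partial> l w \<in> J" if l: "length l = n" for l
  proof -
    have "z l \<ominus> \<partial> l w = ((z l \<ominus> x \<otimes> v l) \<ominus> \<partial> l w) \<oplus> v l \<otimes> x"
      using zc[of l] vc[of l] x diff_closed[OF w, of l] by algebra
    then show ?thesis using zw[OF l] vc[of l] unfolding J by blast
  qed
  then show "\<exists>w. range w \<subseteq> carrier R \<and> (\<forall>l. length l = n \<longrightarrow> z l \<ominus> \<partial> l w \<in> J)" using w by blast
qed

lemma genideal_take_Suc:
  assumes "set xs \<subseteq> carrier R" "j < length xs"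
  shows "Idl (set (take (Suc j) xs)) = {a \<oplus> c \<otimes> xs ! j | a c. a \<in> Idl (set (take j xs)) \<and> c \<in> carrier R}"
proof -
  have "set (take (Suc j) xs) = insert (xs ! j) (set (take j xs))"
    using assms by (simp add: take_Suc_conv_app_nth)
  moreover have "set (take j xs) \<subseteq> carrier R" using assms set_take_subset by fastforce
  moreover have "xs ! j \<in> carrier R" using assms by auto
  ultimately show ?thesis using genideal_insert[of "set (take j xs)" "xs ! j"] by simp
qed

lemma ideal_take: "set xs \<subseteq> carrier R \<Longrightarrow> ideal (Idl (set (take j xs))) R"
  using set_take_subset by (intro genideal_ideal) fastforce

text \<open>The induction on \<open>j\<close> descends from the whole sequence, where no degree is
  left to be checked; every element that is removed from the ideal adds one degree of
  vanishing.\<close>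

lemma exact_of_regular_sequence:
  assumes reg: "regular_sequence R xs"
    and pow: "\<And>x. x \<in> set xs \<Longrightarrow> \<exists>k::nat. x [^] k \<in> Idl (range f)"
    and j: "j \<le> length xs" and n: "n < length xs - j"
  shows "koszul_exact R f (Idl (set (take j xs))) n"
  using j n
proof (induction j arbitrary: n rule: inc_induct)
  case (step j)
  have xs: "set xs \<subseteq> carrier R" using reg by (simp add: regular_sequence_def)
  have xj: "xs ! j \<in> set xs" using step by simp
  obtain k :: nat where k: "(xs ! j) [^] k \<in> Idl (range f)" using pow[OF xj] by blast
  show ?case
  proof (rule exact_of_nonzerodivisor[OF ideal_take[OF xs] _ _ k genideal_take_Suc[OF xs step.hyps(2)] ideal_take[OF xs]])
    show "xs ! j \<in> carrier R" using xs xj by auto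
    show "a \<in> Idl (set (take j xs))" if "a \<in> carrier R" "xs ! j \<otimes> a \<in> Idl (set (take j xs))" for a
      using reg that step.hyps by (auto simp: regular_sequence_def)
    show "koszul_exact R f (Idl (set (take (Suc j) xs))) m" if "n = Suc m" for m
      using step that by auto
  qed
qed simp

text \<open>The sequence \<open>ys\<close> may be unrelated to the one that caused the vanishing;
  each of its elements costs one degree. This is how an unknown sequence is confronted with the
  known one.\<close>

lemma exact_quotient_regular:
  assumes reg: "regular_sequence R ys"
    and exact: "\<And>n. n < N \<Longrightarrow> koszul_exact R f (Idl {}) n"
    and j: "j \<le> length ys" and n: "n + j < N"
  shows "koszul_exact R f (Idl (set (take j ys))) n"
  using j n
proof (induction j arbitrary: n)
  case 0
  then show ?case using exact by simp
next
  case (Suc j)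
  have ys: "set ys \<subseteq> carrier R" using reg by (simp add: regular_sequence_def)
  have j: "j < length ys" using Suc by simp
  show ?case
  proof (rule exact_quotient[OF ideal_take[OF ys] _ _ genideal_take_Suc[OF ys j]])
    show "ys ! j \<in> carrier R" using ys j by auto
    show "a \<in> Idl (set (take j ys))" if "a \<in> carrier R" "ys ! j \<otimes> a \<in> Idl (set (take j ys))" for a
      using reg that j by (auto simp: regular_sequence_def)
  qed (use Suc in auto)
qed

end


section \<open>Localization of a domain at a prime\<close>

definition extension :: "('a, 'b) ring_scheme \<Rightarrow> 'a set \<Rightarrow> 'a set \<Rightarrow> ('a \<times> 'a) set set" where
  "extension R q I = {fraction R q a s | a s. a \<in> I \<and> s \<in> carrier R - q}"

locale localized_domain = domain R for R :: "('a, 'b) ring_scheme" (structure) +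
  fixes q assumes q: "primeideal q R"
begin

definition L where "L = localization R q"
definition denoms where "denoms = carrier R - q"
abbreviation frac where "frac \<equiv> fraction R q"

lemma denom_closed: "s \<in> denoms \<Longrightarrow> s \<in> carrier R"
  by (simp add: denoms_def)

lemma q_ideal: "ideal q R"
  using q by (simp add: primeideal.axioms(1))

lemma one_denom [simp]: "\<one> \<in> denoms"
  using ideal.one_imp_carrier[OF q_ideal] primeideal.I_notcarr[OF q] by (auto simp: denoms_def)

lemma denom_mult [simp]: "s \<in> denoms \<Longrightarrow> t \<in> denoms \<Longrightarrow> s \<otimes> t \<in> denoms"
  using primeideal.I_prime[OF q, of s t] by (auto simp: denoms_def)

lemma denom_pow: "s \<in> denoms \<Longrightarrow> s [^] (k::nat) \<in> denoms"
  by (induction k) auto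

lemma denom_nonzero: "s \<in> denoms \<Longrightarrow> s \<noteq> \<zero>"
  using additive_subgroup.zero_closed[OF ideal.axioms(1)[OF q_ideal]] by (auto simp: denoms_def)

text \<open>Denominators are nonzero, so in a domain the multiplier \<open>u\<close> cancels and
  cross multiplication remains.\<close>

lemma mem_fraction:
  assumes "a \<in> carrier R" "s \<in> denoms"
  shows "(b, t) \<in> frac a s \<longleftrightarrow> b \<in> carrier R \<and> t \<in> denoms \<and> a \<otimes> t = b \<otimes> s"
proof -
  have "u \<otimes> (a \<otimes> t) = u \<otimes> (b \<otimes> s) \<longleftrightarrow> a \<otimes> t = b \<otimes> s"
    if "u \<in> denoms" "b \<in> carrier R" "t \<in> denoms" for u
    using that assms denom_nonzero[OF that(1)] by (subst m_lcancel) (auto dest: denom_closed)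
  then show ?thesis using one_denom unfolding fraction_def denoms_def[symmetric] by auto
qed

lemma fraction_eq_iff:
  assumes "a \<in> carrier R" "s \<in> denoms" "b \<in> carrier R" "t \<in> denoms"
  shows "frac a s = frac b t \<longleftrightarrow> a \<otimes> t = b \<otimes> s"
proof
  assume "frac a s = frac b t"
  then have "(b, t) \<in> frac a s" using assms by (simp add: mem_fraction)
  then show "a \<otimes> t = b \<otimes> s" using assms by (simp add: mem_fraction)
next
  assume eq: "a \<otimes> t = b \<otimes> s"
  have "a \<otimes> v = c \<otimes> s \<longleftrightarrow> b \<otimes> v = c \<otimes> t" if c: "c \<in> carrier R" "v \<in> denoms" for c v
  proof -
    note cl = assms(1,3) c(1) assms(2,4)[THEN denom_closed] c(2)[THEN denom_closed]
    have "a \<otimes> v = c \<otimes> s \<longleftrightarrow> t \<otimes> (a \<otimes> v) = t \<otimes> (c \<otimes> s)"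
      using cl denom_nonzero[OF assms(4)] by (subst m_lcancel) auto
    also have "t \<otimes> (a \<otimes> v) = (a \<otimes> t) \<otimes> v" using cl by algebra
    also have "\<dots> = s \<otimes> (b \<otimes> v)" unfolding eq using cl by algebra
    also have "t \<otimes> (c \<otimes> s) = s \<otimes> (c \<otimes> t)" using cl by algebra
    also have "s \<otimes> (b \<otimes> v) = s \<otimes> (c \<otimes> t) \<longleftrightarrow> b \<otimes> v = c \<otimes> t"
      using cl denom_nonzero[OF assms(2)] by (subst m_lcancel) auto
    finally show ?thesis .
  qed
  then show "frac a s = frac b t"
    using mem_fraction[OF assms(1,2)] mem_fraction[OF assms(3,4)] by auto
qed

lemma carrier_L: "carrier L = {frac a s | a s. a \<in> carrier R \<and> s \<in> denoms}"
  by (simp add: L_def localization_def denoms_def)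

lemma frac_closed [simp]: "a \<in> carrier R \<Longrightarrow> s \<in> denoms \<Longrightarrow> frac a s \<in> carrier L"
  by (auto simp: carrier_L)

lemma L_cases:
  assumes "x \<in> carrier L"
  obtains a s where "x = frac a s" "a \<in> carrier R" "s \<in> denoms"
  using assms by (auto simp: carrier_L)

lemma mem_fraction_self: "a \<in> carrier R \<Longrightarrow> s \<in> denoms \<Longrightarrow> (a, s) \<in> frac a s"
  by (simp add: mem_fraction)

text \<open>The product of fractions does not depend on representatives, so the union that defines
  it is taken over copies of one set and collapses.\<close>

lemma L_mult:
  assumes "a \<in> carrier R" "s \<in> denoms" "b \<in> carrier R" "t \<in> denoms"
  shows "frac a s \<otimes>\<^bsub>L\<^esub> frac b t = frac (a \<otimes> b) (s \<otimes> t)"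
proof -
  have "frac (a' \<otimes> b') (s' \<otimes> t') = frac (a \<otimes> b) (s \<otimes> t)"
    if m: "(a', s') \<in> frac a s" "(b', t') \<in> frac b t" for a' s' b' t'
  proof -
    from m assms have m: "a' \<in> carrier R" "s' \<in> denoms" "a \<otimes> s' = a' \<otimes> s"
      "b' \<in> carrier R" "t' \<in> denoms" "b \<otimes> t' = b' \<otimes> t" by (auto simp: mem_fraction)
    note cl = assms(1,3) m(1,4) assms(2,4)[THEN denom_closed] m(2,5)[THEN denom_closed]
    have "(a' \<otimes> b') \<otimes> (s \<otimes> t) = (a' \<otimes> s) \<otimes> (b' \<otimes> t)" using cl by algebra
    also have "\<dots> = (a \<otimes> b) \<otimes> (s' \<otimes> t')" unfolding m(3,6)[symmetric] using cl by algebra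
    finally show ?thesis using assms m by (subst fraction_eq_iff) auto
  qed
  then have "\<Union>{frac (a' \<otimes> b') (s' \<otimes> t') | a' s' b' t'. (a', s') \<in> frac a s \<and> (b', t') \<in> frac b t}
      = \<Union>{frac (a \<otimes> b) (s \<otimes> t)}"
    using mem_fraction_self assms by (intro arg_cong[of _ _ "Union"]) blast
  then show ?thesis by (simp add: L_def localization_def)
qed

lemma L_add:
  assumes "a \<in> carrier R" "s \<in> denoms" "b \<in> carrier R" "t \<in> denoms"
  shows "frac a s \<oplus>\<^bsub>L\<^esub> frac b t = frac (a \<otimes> t \<oplus> b \<otimes> s) (s \<otimes> t)"
proof -
  have "frac (a' \<otimes> t' \<oplus> b' \<otimes> s') (s' \<otimes> t') = frac (a \<otimes> t \<oplus> b \<otimes> s) (s \<otimes> t)"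
    if m: "(a', s') \<in> frac a s" "(b', t') \<in> frac b t" for a' s' b' t'
  proof -
    from m assms have m: "a' \<in> carrier R" "s' \<in> denoms" "a \<otimes> s' = a' \<otimes> s"
      "b' \<in> carrier R" "t' \<in> denoms" "b \<otimes> t' = b' \<otimes> t" by (auto simp: mem_fraction)
    note cl = assms(1,3) m(1,4) assms(2,4)[THEN denom_closed] m(2,5)[THEN denom_closed]
    have "(a' \<otimes> t' \<oplus> b' \<otimes> s') \<otimes> (s \<otimes> t) = (a' \<otimes> s) \<otimes> (t' \<otimes> t) \<oplus> (b' \<otimes> t) \<otimes> (s' \<otimes> s)"
      using cl by algebra
    also have "\<dots> = (a \<otimes> t \<oplus> b \<otimes> s) \<otimes> (s' \<otimes> t')" unfolding m(3,6)[symmetric] using cl by algebra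
    finally show ?thesis using assms m by (subst fraction_eq_iff) (auto dest: denom_closed)
  qed
  then have "\<Union>{frac (a' \<otimes> t' \<oplus> b' \<otimes> s') (s' \<otimes> t') | a' s' b' t'. (a', s') \<in> frac a s \<and> (b', t') \<in> frac b t}
      = \<Union>{frac (a \<otimes> t \<oplus> b \<otimes> s) (s \<otimes> t)}"
    using mem_fraction_self assms by (intro arg_cong[of _ _ "Union"]) blast
  then show ?thesis by (simp add: L_def localization_def)
qed

lemma L_one: "\<one>\<^bsub>L\<^esub> = frac \<one> \<one>" and L_zero: "\<zero>\<^bsub>L\<^esub> = frac \<zero> \<one>"
  by (simp_all add: L_def localization_def)

lemma frac_add_same:
  assumes "a \<in> carrier R" "b \<in> carrier R" "s \<in> denoms"
  shows "frac a s \<oplus>\<^bsub>L\<^esub> frac b s = frac (a \<oplus> b) s"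
proof -
  note cl = assms(1,2) denom_closed[OF assms(3)]
  have "(a \<otimes> s \<oplus> b \<otimes> s) \<otimes> s = (a \<oplus> b) \<otimes> (s \<otimes> s)" using cl by algebra
  then show ?thesis using assms cl by (simp add: L_add fraction_eq_iff)
qed

lemma cring_L: "cring L"
proof (rule cringI)
  show "abelian_group L"
  proof (rule abelian_groupI)
    fix x y z assume xyz: "x \<in> carrier L" "y \<in> carrier L" "z \<in> carrier L"
    obtain a s where x: "x = frac a s" "a \<in> carrier R" "s \<in> denoms" using xyz(1) by (rule L_cases)
    obtain b t where y: "y = frac b t" "b \<in> carrier R" "t \<in> denoms" using xyz(2) by (rule L_cases)
    obtain c u where z: "z = frac c u" "c \<in> carrier R" "u \<in> denoms" using xyz(3) by (rule L_cases)
    note cl = x(2) y(2) z(2) x(3)[THEN denom_closed] y(3)[THEN denom_closed] z(3)[THEN denom_closed]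
    note d = x(3) y(3) z(3)
    show "x \<oplus>\<^bsub>L\<^esub> y \<in> carrier L" using cl d by (simp add: x(1) y(1) L_add)
    have "((a \<otimes> t \<oplus> b \<otimes> s) \<otimes> u \<oplus> c \<otimes> (s \<otimes> t)) \<otimes> (s \<otimes> (t \<otimes> u))
        = (a \<otimes> (t \<otimes> u) \<oplus> (b \<otimes> u \<oplus> c \<otimes> t) \<otimes> s) \<otimes> ((s \<otimes> t) \<otimes> u)"
      using cl by algebra
    then show "x \<oplus>\<^bsub>L\<^esub> y \<oplus>\<^bsub>L\<^esub> z = x \<oplus>\<^bsub>L\<^esub> (y \<oplus>\<^bsub>L\<^esub> z)"
      using cl d by (simp add: x(1) y(1) z(1) L_add fraction_eq_iff del: m_assoc)
    have "a \<otimes> t \<oplus> b \<otimes> s = b \<otimes> s \<oplus> a \<otimes> t" "s \<otimes> t = t \<otimes> s" using cl by algebra+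
    then show "x \<oplus>\<^bsub>L\<^esub> y = y \<oplus>\<^bsub>L\<^esub> x"
      using cl d by (simp add: x(1) y(1) L_add)
    show "\<zero>\<^bsub>L\<^esub> \<oplus>\<^bsub>L\<^esub> x = x"
      using cl d by (simp add: x(1) L_zero L_add)
    have "\<ominus> a \<oplus> a = \<zero>" using cl by algebra
    then have "frac (\<ominus> a) s \<oplus>\<^bsub>L\<^esub> x = \<zero>\<^bsub>L\<^esub>"
      using cl d by (simp add: x(1) frac_add_same L_zero fraction_eq_iff)
    then show "\<exists>y\<in>carrier L. y \<oplus>\<^bsub>L\<^esub> x = \<zero>\<^bsub>L\<^esub>"
      by (rule bexI) (use cl d in simp)
  qed (simp add: L_zero)
  show "comm_monoid L"
  proof (rule comm_monoidI)
    fix x y z assume xyz: "x \<in> carrier L" "y \<in> carrier L" "z \<in> carrier L"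
    obtain a s where x: "x = frac a s" "a \<in> carrier R" "s \<in> denoms" using xyz(1) by (rule L_cases)
    obtain b t where y: "y = frac b t" "b \<in> carrier R" "t \<in> denoms" using xyz(2) by (rule L_cases)
    obtain c u where z: "z = frac c u" "c \<in> carrier R" "u \<in> denoms" using xyz(3) by (rule L_cases)
    note cl = x(2) y(2) z(2) x(3)[THEN denom_closed] y(3)[THEN denom_closed] z(3)[THEN denom_closed]
    note d = x(3) y(3) z(3)
    show "x \<otimes>\<^bsub>L\<^esub> y \<in> carrier L" using cl d by (simp add: x(1) y(1) L_mult)
    show "x \<otimes>\<^bsub>L\<^esub> y \<otimes>\<^bsub>L\<^esub> z = x \<otimes>\<^bsub>L\<^esub> (y \<otimes>\<^bsub>L\<^esub> z)"
      using cl d by (simp add: x(1) y(1) z(1) L_mult m_assoc)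
    show "x \<otimes>\<^bsub>L\<^esub> y = y \<otimes>\<^bsub>L\<^esub> x"
      using cl d by (simp add: x(1) y(1) L_mult m_comm)
    show "\<one>\<^bsub>L\<^esub> \<otimes>\<^bsub>L\<^esub> x = x"
      using cl d by (simp add: x(1) L_one L_mult)
  qed (simp add: L_one)
  fix x y z assume xyz: "x \<in> carrier L" "y \<in> carrier L" "z \<in> carrier L"
  obtain a s where x: "x = frac a s" "a \<in> carrier R" "s \<in> denoms" using xyz(1) by (rule L_cases)
  obtain b t where y: "y = frac b t" "b \<in> carrier R" "t \<in> denoms" using xyz(2) by (rule L_cases)
  obtain c u where z: "z = frac c u" "c \<in> carrier R" "u \<in> denoms" using xyz(3) by (rule L_cases)
  note cl = x(2) y(2) z(2) x(3)[THEN denom_closed] y(3)[THEN denom_closed] z(3)[THEN denom_closed]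
  note d = x(3) y(3) z(3)
  have "(a \<otimes> t \<oplus> b \<otimes> s) \<otimes> c \<otimes> ((s \<otimes> u) \<otimes> (t \<otimes> u))
      = (a \<otimes> c \<otimes> (t \<otimes> u) \<oplus> b \<otimes> c \<otimes> (s \<otimes> u)) \<otimes> (s \<otimes> t \<otimes> u)"
    using cl by algebra
  then show "(x \<oplus>\<^bsub>L\<^esub> y) \<otimes>\<^bsub>L\<^esub> z = x \<otimes>\<^bsub>L\<^esub> z \<oplus>\<^bsub>L\<^esub> y \<otimes>\<^bsub>L\<^esub> z"
    using cl d by (simp add: x(1) y(1) z(1) L_mult L_add fraction_eq_iff)
qed

lemma L_pow:
  assumes "a \<in> carrier R" "s \<in> denoms"
  shows "frac a s [^]\<^bsub>L\<^esub> (k::nat) = frac (a [^] k) (s [^] k)"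
proof -
  interpret L: cring L by (rule cring_L)
  show ?thesis using assms by (induction k) (simp_all add: L_one L_mult denom_pow)
qed

lemma L_inv:
  assumes "a \<in> carrier R" "s \<in> denoms"
  shows "\<ominus>\<^bsub>L\<^esub> frac a s = frac (\<ominus> a) s"
proof -
  interpret L: cring L by (rule cring_L)
  have "\<ominus> a \<oplus> a = \<zero>" using assms(1) by algebra
  then have "frac (\<ominus> a) s \<oplus>\<^bsub>L\<^esub> frac a s = \<zero>\<^bsub>L\<^esub>"
    using assms denom_closed[OF assms(2)] by (simp add: frac_add_same L_zero fraction_eq_iff)
  then show ?thesis using assms by (intro L.minus_equality) auto
qed

lemma L_minus:
  assumes "a \<in> carrier R" "s \<in> denoms" "b \<in> carrier R" "t \<in> denoms"
  shows "frac a s \<ominus>\<^bsub>L\<^esub> frac b t = frac (a \<otimes> t \<ominus> b \<otimes> s) (s \<otimes> t)"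
  using assms denom_closed[OF assms(2)] by (simp add: a_minus_def L_inv L_add l_minus)

lemma extension_closed: "I \<subseteq> carrier R \<Longrightarrow> extension R q I \<subseteq> carrier L"
  by (auto simp: extension_def carrier_L denoms_def)

text \<open>A prime inside \<open>q\<close> contains no denominator, so denominators can be
  cancelled from membership. Hence such a prime is recovered from its extension, and strict
  inclusions of primes stay strict.\<close>

lemma mem_extension:
  assumes I: "primeideal I R" "I \<subseteq> q" and "a \<in> carrier R" "s \<in> denoms"
  shows "frac a s \<in> extension R q I \<longleftrightarrow> a \<in> I"
proof
  assume "frac a s \<in> extension R q I"
  then obtain b t where bt: "frac a s = frac b t" "b \<in> I" "t \<in> denoms"
    by (auto simp: extension_def denoms_def)
  have Id: "ideal I R" using I(1) by (simp add: primeideal.axioms(1))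
  have b: "b \<in> carrier R" using ideal.Icarr[OF Id] bt by auto
  have "a \<otimes> t = b \<otimes> s" using bt b assms by (simp add: fraction_eq_iff)
  also have "\<dots> \<in> I" using bt assms by (intro ideal.I_r_closed[OF Id]) (auto dest: denom_closed)
  finally have "a \<in> I \<or> t \<in> I" using primeideal.I_prime[OF I(1), of a t] assms bt denom_closed by auto
  then show "a \<in> I" using bt I by (auto simp: denoms_def)
qed (use assms in \<open>auto simp: extension_def denoms_def\<close>)

lemma primeideal_extension:
  assumes I: "primeideal I R" "I \<subseteq> q"
  shows "primeideal (extension R q I) L"
proof -
  interpret L: cring L by (rule cring_L)
  have Id: "ideal I R" using I(1) by (simp add: primeideal.axioms(1))
  have Ic: "I \<subseteq> carrier R" using ideal.Icarr[OF Id] by auto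
  have I0: "\<zero> \<in> I" using Id by (simp add: additive_subgroup.zero_closed ideal.axioms(1))
  note mem = mem_extension[OF I]
  have E: "extension R q I \<subseteq> carrier L" using extension_closed[OF Ic] .
  have extE: "\<exists>a s. x = frac a s \<and> a \<in> carrier R \<and> s \<in> denoms \<and> a \<in> I" if "x \<in> extension R q I" for x
    using that Ic unfolding extension_def denoms_def by blast
  have add: "x \<oplus>\<^bsub>L\<^esub> y \<in> extension R q I" if "x \<in> extension R q I" "y \<in> extension R q I" for x y
  proof -
    from extE[OF that(1)] obtain a s where x: "x = frac a s" "a \<in> carrier R" "s \<in> denoms" "a \<in> I" by blast
    from extE[OF that(2)] obtain b t where y: "y = frac b t" "b \<in> carrier R" "t \<in> denoms" "b \<in> I" by blast
    have "a \<otimes> t \<oplus> b \<otimes> s \<in> I" using x y Id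
      by (intro add_in_ideal[OF Id] ideal.I_r_closed) (auto dest: denom_closed)
    then show ?thesis using x y denom_closed by (simp add: L_add mem)
  qed
  have inv: "\<ominus>\<^bsub>L\<^esub> x \<in> extension R q I" if "x \<in> extension R q I" for x
  proof -
    from extE[OF that] obtain a s where x: "x = frac a s" "a \<in> carrier R" "s \<in> denoms" "a \<in> I" by blast
    then have "\<ominus> a \<in> I" using Id by (simp add: additive_subgroup.a_inv_closed ideal.axioms(1))
    then show ?thesis using x by (simp add: L_inv mem)
  qed
  have mult: "x \<otimes>\<^bsub>L\<^esub> y \<in> extension R q I" if "x \<in> extension R q I" "y \<in> carrier L" for x y
  proof -
    from extE[OF that(1)] obtain a s where x: "x = frac a s" "a \<in> carrier R" "s \<in> denoms" "a \<in> I" by blast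
    from that(2) obtain b t where y: "y = frac b t" "b \<in> carrier R" "t \<in> denoms" by (rule L_cases)
    show ?thesis using x y by (simp add: L_mult mem ideal.I_r_closed[OF Id])
  qed
  show ?thesis
  proof (rule primeidealI)
    show "ideal (extension R q I) L"
    proof (rule idealI[OF L.ring_axioms])
      have "\<zero>\<^bsub>L\<^esub> \<in> extension R q I" by (simp add: L_zero mem I0)
      then show "subgroup (extension R q I) (add_monoid L)"
        using E add inv[unfolded a_inv_def] by (intro subgroup.intro) auto
      show "x \<otimes>\<^bsub>L\<^esub> y \<in> extension R q I" "y \<otimes>\<^bsub>L\<^esub> x \<in> extension R q I"
        if "x \<in> extension R q I" "y \<in> carrier L" for x y
        using mult[OF that] L.m_comm[of x y] that E by auto
    qed
    show "cring L" by (rule cring_L)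
    have "\<one>\<^bsub>L\<^esub> \<notin> extension R q I"
      using one_denom I(2) by (auto simp: L_one mem denoms_def)
    then show "carrier L \<noteq> extension R q I" by auto
    fix x y assume xy: "x \<in> carrier L" "y \<in> carrier L" "x \<otimes>\<^bsub>L\<^esub> y \<in> extension R q I"
    obtain a s where x: "x = frac a s" "a \<in> carrier R" "s \<in> denoms" using xy(1) by (rule L_cases)
    obtain b t where y: "y = frac b t" "b \<in> carrier R" "t \<in> denoms" using xy(2) by (rule L_cases)
    have "a \<otimes> b \<in> I" using xy x y by (simp add: L_mult mem)
    then show "x \<in> extension R q I \<or> y \<in> extension R q I"
      using primeideal.I_prime[OF I(1)] x y by (simp add: mem)
  qed
qed

lemma krull_dim_localization_ge:
  assumes qs: "prime_chain R qs" "length qs = Suc n" and sub: "\<And>I. I \<in> set qs \<Longrightarrow> I \<subseteq> q"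
  shows "enat n \<le> krull_dim (localization R q)"
proof -
  have prime: "primeideal I R" if "I \<in> set qs" for I using qs that by (simp add: prime_chain_def)
  have mono: "extension R q I \<subset> extension R q J" if "I \<in> set qs" "J \<in> set qs" "I \<subset> J" for I J
  proof -
    from that(3) obtain a where a: "a \<in> J" "a \<notin> I" by blast
    have "a \<in> carrier R" using ideal.Icarr[OF primeideal.axioms(1)[OF prime[OF that(2)]] a(1)] .
    then have "frac a \<one> \<in> extension R q J" "frac a \<one> \<notin> extension R q I"
      using a mem_extension[OF prime sub] that by auto
    moreover have "extension R q I \<subseteq> extension R q J" using that by (auto simp: extension_def)
    ultimately show ?thesis by blast
  qed
  have "sorted_wrt (\<subset>) (map (extension R q) qs)"
    unfolding sorted_wrt_map
    by (rule sorted_wrt_mono_rel[of qs "(\<subset>)"]) (use qs mono in \<open>auto simp: prime_chain_def\<close>)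
  then have "prime_chain (localization R q) (map (extension R q) qs)"
    using primeideal_extension prime sub unfolding prime_chain_def L_def by auto
  then show ?thesis unfolding krull_dim_def
    using qs by (intro Sup_upper) (auto intro!: exI[of _ "map (extension R q) qs"])
qed

text \<open>The contraction \<open>K\<close> of the ideal on the right is an ideal of
  \<open>R\<close> that contains all \<open>f i\<close>, hence all of
  \<open>Idl (range f)\<close>.\<close>

lemma frac_in_genideal:
  assumes f: "range f \<subseteq> carrier R" and a: "a \<in> Idl (range f)" and s: "s \<in> denoms"
  shows "frac a s \<in> Idl\<^bsub>L\<^esub> (range (\<lambda>i. frac (f i) \<one>))"
proof -
  interpret L: cring L by (rule cring_L)
  let ?f = "\<lambda>i. frac (f i) \<one>"
  have fL: "range ?f \<subseteq> carrier L" using f by auto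
  have J: "ideal (Idl\<^bsub>L\<^esub> (range ?f)) L" by (rule L.genideal_ideal[OF fL])
  define K where "K = {a \<in> carrier R. frac a \<one> \<in> Idl\<^bsub>L\<^esub> (range ?f)}"
  have "ideal K R"
  proof (rule idealI[OF ring_axioms])
    have "\<zero>\<^bsub>L\<^esub> \<in> Idl\<^bsub>L\<^esub> (range ?f)" using J by (simp add: additive_subgroup.zero_closed ideal.axioms(1))
    moreover have "frac (a \<oplus> b) \<one> \<in> Idl\<^bsub>L\<^esub> (range ?f)" if "a \<in> K" "b \<in> K" for a b
      using L.add_in_ideal[OF J] that by (auto simp: K_def simp flip: frac_add_same)
    moreover have "frac (\<ominus> a) \<one> \<in> Idl\<^bsub>L\<^esub> (range ?f)" if "a \<in> K" for a
      using additive_subgroup.a_inv_closed[OF ideal.axioms(1)[OF J]] that by (auto simp: K_def simp flip: L_inv)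
    ultimately show "subgroup K (add_monoid R)"
      by (intro subgroup.intro) (auto simp: K_def L_zero simp flip: a_inv_def)
    have m: "frac (a \<otimes> c) \<one> \<in> Idl\<^bsub>L\<^esub> (range ?f)" if "a \<in> K" "c \<in> carrier R" for a c
    proof -
      have "frac (a \<otimes> c) \<one> = frac a \<one> \<otimes>\<^bsub>L\<^esub> frac c \<one>" using that by (simp add: L_mult K_def)
      then show ?thesis using ideal.I_r_closed[OF J] that by (simp add: K_def)
    qed
    then show "a \<otimes> c \<in> K" "c \<otimes> a \<in> K" if "a \<in> K" "c \<in> carrier R" for a c
      using m[OF that] that m_comm[of a c] by (simp_all add: K_def)
  qed
  moreover have "range f \<subseteq> K" using L.genideal_self[OF fL] f by (auto simp: K_def)
  ultimately have "Idl (range f) \<subseteq> K" by (rule genideal_minimal)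
  then have a': "a \<in> carrier R" "frac a \<one> \<in> Idl\<^bsub>L\<^esub> (range ?f)" using a by (auto simp: K_def)
  have "frac a s = frac a \<one> \<otimes>\<^bsub>L\<^esub> frac \<one> s" using a' s denom_closed[OF s] by (simp add: L_mult)
  then show ?thesis using ideal.I_r_closed[OF J a'(2)] s by simp
qed

end


section \<open>Substitutions and ideals generated by variables\<close>

interpretation poly_const: coeff_hom "poly_const :: 'k::field \<Rightarrow> ('d::finite, 'k) poly_ring"
  by unfold_locales (simp_all add: poly_const_def single_add mult_single)

lemma poly_subst_eval: "poly_subst \<sigma> f = poly_eval poly_const \<sigma> f"
  for f :: "('d::finite, 'k::field) poly_ring"
  by (simp add: poly_subst_def poly_eval_def eval_monom_keys)

lemma poly_subst_add: "poly_subst \<sigma> (f + g) = poly_subst \<sigma> f + poly_subst \<sigma> g"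
  for f :: "('d::finite, 'k::field) poly_ring"
  by (simp add: poly_subst_eval poly_const.poly_eval_add)

lemma poly_subst_mult: "poly_subst \<sigma> (f * g) = poly_subst \<sigma> f * poly_subst \<sigma> g"
  for f :: "('d::finite, 'k::field) poly_ring"
  by (simp add: poly_subst_eval poly_const.poly_eval_mult)

lemma poly_subst_one [simp]: "poly_subst \<sigma> 1 = 1"
  for \<sigma> :: "_ \<Rightarrow> ('d::finite, 'k::field) poly_ring"
  by (simp add: poly_subst_eval poly_const.poly_eval_one)

lemma poly_subst_zero [simp]: "poly_subst \<sigma> 0 = 0"
  for \<sigma> :: "_ \<Rightarrow> ('d::finite, 'k::field) poly_ring"
  by (simp add: poly_subst_eval poly_const.poly_eval_zero)

lemma poly_subst_single: "poly_subst \<sigma> (Poly_Mapping.single m c) = poly_const c * eval_monom \<sigma> m"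
  for \<sigma> :: "_ \<Rightarrow> ('d::finite, 'k::field) poly_ring"
  by (simp add: poly_subst_eval poly_const.poly_eval_single)

lemma poly_subst_minus: "poly_subst \<sigma> (f - g) = poly_subst \<sigma> f - poly_subst \<sigma> g"
  for f :: "('d::finite, 'k::field) poly_ring"
  using poly_subst_add[of \<sigma> "f - g" g] by simp

lemma poly_subst_power: "poly_subst \<sigma> (f ^ n) = poly_subst \<sigma> f ^ n"
  for f :: "('d::finite, 'k::field) poly_ring"
  by (induction n) (simp_all add: poly_subst_mult)

lemma poly_subst_sum: "poly_subst \<sigma> (\<Sum>i\<in>A. f i) = (\<Sum>i\<in>A. poly_subst \<sigma> (f i))"
  for f :: "_ \<Rightarrow> ('d::finite, 'k::field) poly_ring"
  by (induction A rule: infinite_finite_induct) (simp_all add: poly_subst_add)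

lemma poly_subst_prod: "poly_subst \<sigma> (\<Prod>i\<in>A. f i) = (\<Prod>i\<in>A. poly_subst \<sigma> (f i))"
  for f :: "_ \<Rightarrow> ('d::finite, 'k::field) poly_ring"
  by (induction A rule: infinite_finite_induct) (simp_all add: poly_subst_mult)

lemma poly_subst_var [simp]: "poly_subst \<sigma> (poly_var v) = \<sigma> v"
  for \<sigma> :: "_ \<Rightarrow> ('d::finite, 'k::field) poly_ring"
  by (simp add: poly_var_def poly_subst_single poly_const.hom_one del: One_nat_def)

lemma poly_subst_const [simp]: "poly_subst \<sigma> (poly_const c) = poly_const c"
  for \<sigma> :: "_ \<Rightarrow> ('d::finite, 'k::field) poly_ring"
  by (simp add: poly_const_def poly_subst_single)

lemma poly_subst_eval_monom:
  "poly_subst \<sigma> (eval_monom \<rho> m) = eval_monom (\<lambda>v. poly_subst \<sigma> (\<rho> v)) m"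
  for \<sigma> :: "_ \<Rightarrow> ('d::finite, 'k::field) poly_ring"
  by (simp add: eval_monom_def poly_subst_prod poly_subst_power)

lemma poly_subst_poly_subst:
  "poly_subst \<rho> (poly_subst \<sigma> f) = poly_subst (\<lambda>v. poly_subst \<rho> (\<sigma> v)) f"
  for f :: "('d::finite, 'k::field) poly_ring"
  by (induction f rule: poly_mapping_induct)
    (simp_all add: poly_subst_single poly_subst_mult poly_subst_eval_monom poly_subst_add)

lemma eval_monom_poly_var: "eval_monom poly_var m = Poly_Mapping.single m 1"
proof -
  have "(\<Sum>v\<in>UNIV. Poly_Mapping.single v (Poly_Mapping.lookup m v)) = m"
    using poly_mapping_sum_single[of m]
    by (subst sum.mono_neutral_right[of _ "Poly_Mapping.keys m"]) (auto simp: in_keys_iff)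
  then show ?thesis
    using eval_monom_vars[of "\<lambda>v. v" m] by (simp add: poly_var_def[abs_def])
qed

lemma poly_subst_poly_var: "poly_subst poly_var f = f"
  for f :: "('d::finite, 'k::field) poly_ring"
  by (induction f rule: poly_mapping_induct)
    (simp_all add: poly_subst_single poly_subst_add eval_monom_poly_var poly_const_def mult_single)

lemma poly_ring_mult_eq_0: "f * g = 0 \<longleftrightarrow> f = 0 \<or> g = 0"
  for f g :: "('d::finite, 'k::field) poly_ring"
  using poly_no_zero_divisors by auto

lemma poly_ring_mult_left_cancel: "f * g = f * h \<longleftrightarrow> f = 0 \<or> g = h"
  for f g h :: "('d::finite, 'k::field) poly_ring"
  using poly_ring_mult_eq_0[of f "g - h"] by (simp add: right_diff_distrib)

lemma poly_ring_power_eq_0: "f ^ n = 0 \<Longrightarrow> f = 0"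
  for f :: "('d::finite, 'k::field) poly_ring"
  by (induction n) (auto simp: poly_ring_mult_eq_0)

lemma lookup_single_mult_add:
  "Poly_Mapping.lookup (Poly_Mapping.single a c * f) (a + m) = c * Poly_Mapping.lookup f m"
  for f :: "('d::finite, 'k::field) poly_ring"
proof (induction f rule: poly_mapping_induct)
  case (single n d)
  show ?case by (simp add: mult_single lookup_single when_def)
qed (simp_all add: distrib_left lookup_add)

lemma lookup_single_mult_nonzero:
  assumes "Poly_Mapping.lookup (Poly_Mapping.single a c * f) m \<noteq> 0"
  obtains n where "m = a + n" "n \<in> Poly_Mapping.keys f"
proof -
  have "m \<in> Poly_Mapping.keys (Poly_Mapping.single a c * f)" using assms by (simp add: in_keys_iff)
  then obtain b n where "m = b + n" "b \<in> Poly_Mapping.keys (Poly_Mapping.single a c)" "n \<in> Poly_Mapping.keys f"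
    using keys_mult[of "Poly_Mapping.single a c" f] by blast
  then show thesis using that by (auto split: if_splits)
qed

lemma poly_var_power: "poly_var v ^ n = Poly_Mapping.single (Poly_Mapping.single v n) 1"
  by (simp add: poly_var_def single_power sum_const_single del: One_nat_def)

lemma poly_var_nonzero [simp]: "poly_var v \<noteq> (0 :: ('d::finite, 'k::field) poly_ring)"
  by (metis poly_var_def keys_single keys_zero insert_not_empty one_neq_zero)


section \<open>Ideals generated by sets of variables\<close>

definition var_ideal :: "('d::finite \<times> 2) set \<Rightarrow> ('d, 'k::field) poly_ring set" where
  "var_ideal W = {f. \<forall>m\<in>Poly_Mapping.keys f. \<exists>v\<in>W. 0 < Poly_Mapping.lookup m v}"

definition kill :: "('d \<times> 2) set \<Rightarrow> ('d::finite, 'k::field) poly_ring \<Rightarrow> ('d, 'k) poly_ring" where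
  "kill W = poly_subst (\<lambda>v. if v \<in> W then 0 else poly_var v)"

lemma lookup_kill:
  fixes f :: "('d::finite, 'k::field) poly_ring"
  shows "Poly_Mapping.lookup (kill W f) m
     = (if \<exists>v\<in>W. 0 < Poly_Mapping.lookup m v then 0 else Poly_Mapping.lookup f m)"
proof (induction f rule: poly_mapping_induct)
  case (single n c)
  have "eval_monom (\<lambda>v. if v \<in> W then 0 else poly_var v) n
      = (if \<exists>v\<in>W. 0 < Poly_Mapping.lookup n v then 0 else Poly_Mapping.single n (1 :: 'k))"
  proof (cases "\<exists>v\<in>W. 0 < Poly_Mapping.lookup n v")
    case True
    then obtain v where v: "v \<in> W" "0 < Poly_Mapping.lookup n v" by blast
    then have "eval_monom (\<lambda>v. if v \<in> W then 0 else poly_var v) n = (0 :: ('d, 'k) poly_ring)"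
      unfolding eval_monom_def by (intro prod_zero bexI[of _ v]) (auto simp: power_0_left)
    then show ?thesis using True by simp
  next
    case False
    then have "eval_monom (\<lambda>v. if v \<in> W then 0 else poly_var v) n = eval_monom poly_var n"
      by (intro eval_monom_cong) (auto simp: in_keys_iff)
    then show ?thesis using False by (simp add: eval_monom_poly_var)
  qed
  then show ?case
    by (auto simp: kill_def poly_subst_single poly_const_def mult_single lookup_single when_def)
qed (auto simp: kill_def poly_subst_add lookup_add)

text \<open>As the kernel of an endomorphism of a domain, \<open>var_ideal W\<close> is a prime
  ideal; all closure properties below come from this description.\<close>

lemma var_ideal_iff: "f \<in> var_ideal W \<longleftrightarrow> kill W f = 0"
  unfolding poly_mapping_eq_iff fun_eq_iff lookup_kill var_ideal_def
  by (simp, metis in_keys_iff gr0I less_irrefl)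

lemma kill_hom:
  "kill W (f + g) = kill W f + kill W g" "kill W (f - g) = kill W f - kill W g"
  "kill W (f * g) = kill W f * kill W g" "kill W 0 = 0" "kill W 1 = 1" "kill W (f ^ n) = kill W f ^ n"
  by (simp_all add: kill_def poly_subst_add poly_subst_mult poly_subst_minus poly_subst_power)

lemma kill_var: "kill W (poly_var v) = (if v \<in> W then 0 else poly_var v)"
  by (simp add: kill_def)

lemma var_ideal_0 [simp]: "0 \<in> var_ideal W"
  by (simp add: var_ideal_iff kill_hom)

lemma var_ideal_add: "f \<in> var_ideal W \<Longrightarrow> g \<in> var_ideal W \<Longrightarrow> f + g \<in> var_ideal W"
  by (simp add: var_ideal_iff kill_hom)

lemma var_ideal_minus: "f \<in> var_ideal W \<Longrightarrow> g \<in> var_ideal W \<Longrightarrow> f - g \<in> var_ideal W"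
  by (simp add: var_ideal_iff kill_hom)

lemma var_ideal_mult: "f \<in> var_ideal W \<Longrightarrow> g * f \<in> var_ideal W"
  by (simp add: var_ideal_iff kill_hom)

lemma var_ideal_prime: "f * g \<in> var_ideal W \<longleftrightarrow> f \<in> var_ideal W \<or> g \<in> var_ideal W"
  by (simp add: var_ideal_iff kill_hom poly_ring_mult_eq_0)

lemma one_notin_var_ideal: "1 \<notin> var_ideal W"
  by (simp add: var_ideal_iff kill_hom)

lemma poly_var_in_var_ideal [simp]: "poly_var v \<in> var_ideal W \<longleftrightarrow> v \<in> W"
  by (simp add: var_ideal_iff kill_var)

lemma var_ideal_mono: "V \<subseteq> W \<Longrightarrow> var_ideal V \<subseteq> var_ideal W"
  unfolding var_ideal_def by blast

text \<open>Passes from monomials to generators: every monomial that occurs is divisible by a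
  variable from \<open>W\<close>, and that variable is split off.\<close>

lemma var_idealE:
  fixes f :: "('d::finite, 'k::field) poly_ring"
  assumes "f \<in> var_ideal W"
  obtains g where "f = (\<Sum>v\<in>W. poly_var v * g v)"
proof -
  define P where "P f \<longleftrightarrow> (\<exists>g. f = (\<Sum>v\<in>W. poly_var v * g v))" for f :: "('d, 'k) poly_ring"
  have add: "P (f + g)" if "P f" "P g" for f g
  proof -
    from that obtain a b where "f = (\<Sum>v\<in>W. poly_var v * a v)" "g = (\<Sum>v\<in>W. poly_var v * b v)"
      unfolding P_def by auto
    then have "f + g = (\<Sum>v\<in>W. poly_var v * (a v + b v))"
      by (simp add: distrib_left sum.distrib)
    then show ?thesis unfolding P_def by (rule exI[of _ "\<lambda>v. a v + b v"])
  qed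
  have zero: "P 0" unfolding P_def by (rule exI[of _ "\<lambda>_. 0"]) simp
  have sum: "P (\<Sum>m\<in>A. h m)" if "\<And>m. m \<in> A \<Longrightarrow> P (h m)" for A :: "(('d \<times> 2) \<Rightarrow>\<^sub>0 nat) set" and h
    using that by (induction A rule: infinite_finite_induct) (auto intro: add zero)
  have "P (Poly_Mapping.single m c)" if v: "v \<in> W" "0 < Poly_Mapping.lookup m v" for m v c
  proof -
    define n where "n = m - Poly_Mapping.single v 1"
    have "m = Poly_Mapping.single v 1 + n"
      using v by (intro poly_mapping_eqI) (auto simp: n_def lookup_add lookup_minus lookup_single when_def)
    then have "Poly_Mapping.single m c = poly_var v * Poly_Mapping.single n c"
      by (simp add: poly_var_def mult_single)
    also have "\<dots> = (\<Sum>u\<in>W. poly_var u * (if u = v then Poly_Mapping.single n c else 0))"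
      using v by (simp add: if_distrib[of "\<lambda>x. _ * x"] cong: if_cong)
    finally show ?thesis unfolding P_def
      by (rule exI[of _ "\<lambda>u. if u = v then Poly_Mapping.single n c else 0"])
  qed
  then have "P (\<Sum>m\<in>Poly_Mapping.keys f. Poly_Mapping.single m (Poly_Mapping.lookup f m))"
    using assms by (intro sum) (auto simp: var_ideal_def)
  then show thesis using that by (auto simp: P_def poly_mapping_sum_single)
qed

lemma var_dvdE:
  assumes "f \<in> var_ideal {v}" obtains g where "f = poly_var v * g"
  using assms by (rule var_idealE) (auto intro: that)


text \<open>With all weights 1 this bounds the total degree, needed for counting; with the indicator
  of one variable it bounds the degree in that variable, needed for division. A bound, unlike a
  degree, makes sense for the zero polynomial.\<close>

definition deg_le :: "('v::finite \<Rightarrow> nat) \<Rightarrow> nat \<Rightarrow> (('v \<Rightarrow>\<^sub>0 nat) \<Rightarrow>\<^sub>0 'k::field) \<Rightarrow> bool" where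
  "deg_le w n f \<longleftrightarrow> (\<forall>m\<in>Poly_Mapping.keys f. (\<Sum>v\<in>UNIV. w v * Poly_Mapping.lookup m v) \<le> n)"

lemma deg_le_0 [simp]: "deg_le w n 0"
  by (simp add: deg_le_def)

lemma deg_le_add: "deg_le w n f \<Longrightarrow> deg_le w n g \<Longrightarrow> deg_le w n (f + g)"
  using Poly_Mapping.keys_add[of f g] by (auto simp: deg_le_def)

lemma deg_le_minus: "deg_le w n f \<Longrightarrow> deg_le w n g \<Longrightarrow> deg_le w n (f - g)"
  using deg_le_add[of w n f "- g"] by (simp add: deg_le_def in_keys_iff)

lemma deg_le_mono: "deg_le w n f \<Longrightarrow> n \<le> k \<Longrightarrow> deg_le w k f"
  by (force simp: deg_le_def)

lemma deg_le_sum: "(\<And>i. i \<in> A \<Longrightarrow> deg_le w n (f i)) \<Longrightarrow> deg_le w n (\<Sum>i\<in>A. f i)"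
  by (induction A rule: infinite_finite_induct) (auto intro: deg_le_add)

lemma deg_le_single:
  "deg_le w n (Poly_Mapping.single m c) \<longleftrightarrow> c = 0 \<or> (\<Sum>v\<in>UNIV. w v * Poly_Mapping.lookup m v) \<le> n"
  by (auto simp: deg_le_def)

lemma deg_le_one [simp]: "deg_le w n 1"
  using deg_le_single[of w n 0 1] by simp

lemma deg_le_mult:
  assumes "deg_le w n f" "deg_le w k g" shows "deg_le w (n + k) (f * g)"
  unfolding deg_le_def
proof
  fix m assume "m \<in> Poly_Mapping.keys (f * g)"
  then obtain a b where ab: "m = a + b" "a \<in> Poly_Mapping.keys f" "b \<in> Poly_Mapping.keys g"
    using keys_mult[of f g] by blast
  have "(\<Sum>v\<in>UNIV. w v * Poly_Mapping.lookup a v) + (\<Sum>v\<in>UNIV. w v * Poly_Mapping.lookup b v) \<le> n + k"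
    using assms ab by (intro add_mono) (auto simp: deg_le_def)
  then show "(\<Sum>v\<in>UNIV. w v * Poly_Mapping.lookup m v) \<le> n + k"
    by (simp add: ab lookup_add distrib_left sum.distrib)
qed

lemma deg_le_power: "deg_le w n f \<Longrightarrow> deg_le w (n * k) (f ^ k)"
  by (induction k) (auto intro: deg_le_mult)

lemma deg_le_prod: "(\<And>i. i \<in> A \<Longrightarrow> deg_le w (n i) (f i)) \<Longrightarrow> deg_le w (\<Sum>i\<in>A. n i) (\<Prod>i\<in>A. f i)"
  by (induction A rule: infinite_finite_induct) (auto intro: deg_le_mult)

lemma deg_le_poly_subst:
  assumes \<sigma>: "\<And>v. deg_le w (w v) (\<sigma> v)" and f: "deg_le w n f"
  shows "deg_le w n (poly_subst \<sigma> f :: ('d::finite, 'k::field) poly_ring)"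
proof -
  have "deg_le w n (poly_const (Poly_Mapping.lookup f m) * eval_monom \<sigma> m)"
    if m: "m \<in> Poly_Mapping.keys f" for m
  proof -
    have "deg_le w (\<Sum>v\<in>UNIV. w v * Poly_Mapping.lookup m v) (eval_monom \<sigma> m)"
      unfolding eval_monom_def by (intro deg_le_prod deg_le_power \<sigma>)
    moreover have "(\<Sum>v\<in>UNIV. w v * Poly_Mapping.lookup m v) \<le> n"
      using f m by (auto simp: deg_le_def)
    ultimately have "deg_le w n (eval_monom \<sigma> m)" by (rule deg_le_mono)
    moreover have "deg_le w 0 (poly_const (Poly_Mapping.lookup f m))"
      by (auto simp: poly_const_def deg_le_single)
    ultimately show ?thesis using deg_le_mult by fastforce
  qed
  then show ?thesis unfolding poly_subst_eval poly_eval_def by (rule deg_le_sum)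
qed

lemma deg_le_var: "deg_le w n (poly_var v) \<longleftrightarrow> w v \<le> n"
proof -
  have "(\<Sum>u\<in>UNIV. w u * Poly_Mapping.lookup (Poly_Mapping.single v (1::nat)) u)
      = (\<Sum>u\<in>UNIV. if u = v then w v else 0)"
    by (intro sum.cong) (auto simp: lookup_single when_def)
  then show ?thesis by (simp add: poly_var_def deg_le_single)
qed


section \<open>The ring of invariants as the ring of fixed points\<close>

abbreviation xv :: "'d \<Rightarrow> ('d::finite, 'k::field) poly_ring" where "xv i \<equiv> poly_var (i, 1)"
abbreviation yv :: "'d \<Rightarrow> ('d::finite, 'k::field) poly_ring" where "yv i \<equiv> poly_var (i, 2)"

text \<open>The group is indexed by the additive group of the field instead of by exponents of
  sigma, so that composition of shifts is addition of indices.\<close>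

definition shift_var :: "'k::field \<Rightarrow> 'd::finite \<times> 2 \<Rightarrow> ('d, 'k) poly_ring" where
  "shift_var a = (\<lambda>(i, j). if j = 1 then xv i + poly_const a * yv i else yv i)"

definition shift :: "'k::field \<Rightarrow> ('d::finite, 'k) poly_ring \<Rightarrow> ('d, 'k) poly_ring" where
  "shift a = poly_subst (shift_var a)"

lemma shift_hom:
  "shift a (f + g) = shift a f + shift a g" "shift a (f - g) = shift a f - shift a g"
  "shift a (f * g) = shift a f * shift a g" "shift a 0 = 0" "shift a 1 = 1"
  "shift a (f ^ n) = shift a f ^ n" "shift a (poly_const c) = poly_const c"
  by (simp_all add: shift_def poly_subst_add poly_subst_mult poly_subst_minus poly_subst_power)

lemma shift_sum: "shift a (\<Sum>i\<in>A. h i) = (\<Sum>i\<in>A. shift a (h i))"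
  and shift_prod: "shift a (\<Prod>i\<in>A. h i) = (\<Prod>i\<in>A. shift a (h i))"
  by (simp_all add: shift_def poly_subst_sum poly_subst_prod)

lemma shift_X [simp]: "shift a (xv i) = xv i + poly_const a * yv i"
  and shift_Y [simp]: "shift a (yv i) = yv i"
  by (simp_all add: shift_def shift_var_def)

lemma shift_shift: "shift a (shift b f) = shift (a + b) f"
  for f :: "('d::finite, 'k::field) poly_ring"
proof -
  have "shift a (shift_var b v) = shift_var (a + b) v" for v :: "'d \<times> 2"
    by (cases v) (simp add: shift_var_def[of b] shift_var_def[of "a + b"] shift_hom
        poly_const.hom_add algebra_simps)
  then show ?thesis unfolding shift_def by (simp add: poly_subst_poly_subst)
qed

lemma shift_0 [simp]: "shift 0 f = f"
  for f :: "('d::finite, 'k::field) poly_ring"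
proof -
  have "shift_var 0 v = (poly_var v :: ('d, 'k) poly_ring)" for v
    using exhaust_2[of "snd v"] by (cases v) (auto simp: shift_var_def poly_const.hom_zero)
  then have "shift_var 0 = (poly_var :: _ \<Rightarrow> ('d, 'k) poly_ring)" by blast
  then show ?thesis by (simp add: shift_def poly_subst_poly_var)
qed

text \<open>Once the \<open>yv i\<close> are set to zero, \<open>xv i\<close> and its shift agree,
  so every shift becomes the identity.\<close>

lemma shift_diff_in_var_ideal: "shift a f - f \<in> var_ideal (range (\<lambda>i. (i, 2)))"
proof -
  let ?W = "range (\<lambda>i. (i, 2)) :: ('a \<times> 2) set"
  have "kill ?W (shift_var a v) = (if v \<in> ?W then 0 else poly_var v)" for v :: "'a \<times> 2"
    using exhaust_2[of "snd v"] by (cases v) (auto simp: shift_var_def kill_hom kill_var)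
  then have "kill ?W (shift a f) = kill ?W f"
    by (simp add: kill_def shift_def poly_subst_poly_subst)
  then show ?thesis by (simp add: var_ideal_iff kill_hom)
qed

definition shift_inv :: "('d::finite, 'k::field) poly_ring set" where
  "shift_inv = {f. \<forall>a. shift a f = f}"

section \<open>The unipotent matrices and their action on polynomials\<close>

definition unip :: "'k::field \<Rightarrow> 'k ^ 2 ^ 2" where
  "unip a = vector [vector [1, a], vector [0, 1]]"

lemma unip_nth [simp]: "unip a $ 1 $ 1 = 1" "unip a $ 1 $ 2 = a" "unip a $ 2 $ 1 = 0" "unip a $ 2 $ 2 = 1"
  by (simp_all add: unip_def)

lemma unip_mult: "unip a ** unip b = unip (a + b)"
  by (simp add: vec_eq_iff forall_2 matrix_matrix_mult_def sum_2)

lemma unip_0: "unip 0 = mat 1"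
  by (simp add: vec_eq_iff forall_2 mat_def)

lemma pullback_unip: "pullback (act_space (\<lambda>_. unip a)) = (shift a :: ('d::finite, 'k::field) poly_ring \<Rightarrow> _)"
proof -
  have "linear_form (\<lambda>w :: 'k ^ 2 ^ 'd. act_space (\<lambda>_. unip a) w $ i $ j) = shift_var a (i, j)" for i j
  proof -
    have ax: "act_space (\<lambda>_. unip a) (axis i' (axis j' 1)) $ i $ j = (if i' = i then unip a $ j $ j' else (0 :: 'k))"
      for i' :: 'd and j' :: 2
    proof -
      have "act_space (\<lambda>_. unip a) (axis i' (axis j' 1)) $ i $ j
          = (\<Sum>l\<in>UNIV. unip a $ j $ l * (if i' = i then (if l = j' then 1 else 0) else 0))"
        unfolding act_space_def matrix_vector_mult_def
        by (auto simp: axis_def intro!: sum.cong)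
      also have "\<dots> = (if i' = i then unip a $ j $ j' else 0)"
        by (auto simp: if_distrib[of "\<lambda>x. _ * x"] cong: if_cong)
      finally show ?thesis .
    qed
    have "linear_form (\<lambda>w :: 'k ^ 2 ^ 'd. act_space (\<lambda>_. unip a) w $ i $ j)
        = (\<Sum>i'\<in>UNIV. if i' = i then (\<Sum>j'\<in>UNIV. poly_const (unip a $ j $ j') * poly_var (i', j')) else 0)"
      unfolding linear_form_def ax by (intro sum.cong) (auto simp: poly_const.hom_zero)
    also have "\<dots> = (\<Sum>j'\<in>UNIV. poly_const (unip a $ j $ j') * poly_var (i, j'))"
      by simp
    also have "\<dots> = shift_var a (i, j)"
      using exhaust_2[of j] by (auto simp: sum_2 shift_var_def poly_const.hom_zero poly_const.hom_one)
    finally show ?thesis .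
  qed
  then have "(\<lambda>(i, j). linear_form (\<lambda>w :: 'k ^ 2 ^ 'd. act_space (\<lambda>_. unip a) w $ i $ j)) = shift_var a"
    by auto
  then show ?thesis unfolding pullback_def shift_def by simp
qed

lemma group_GL2: "group (GL2 :: ('k::field ^ 2 ^ 2) monoid)"
proof (rule groupI)
  fix A :: "'k ^ 2 ^ 2" assume "A \<in> carrier GL2"
  then obtain B where B: "A ** B = mat 1" "B ** A = mat 1" by (auto simp: GL2_def invertible_def)
  then have "B \<in> carrier GL2" by (auto simp: GL2_def invertible_def)
  then show "\<exists>y\<in>carrier GL2. y \<otimes>\<^bsub>GL2\<^esub> A = \<one>\<^bsub>GL2\<^esub>"
    using B by (auto simp: GL2_def)
next
  show "\<one>\<^bsub>GL2\<^esub> \<in> carrier (GL2 :: ('k ^ 2 ^ 2) monoid)"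
    by (auto simp: GL2_def invertible_def intro!: exI[of _ "mat 1"])
qed (auto simp: GL2_def invertible_mult matrix_mul_assoc)

lemma unip_GL2: "unip a \<in> carrier GL2"
  using unip_mult[of a "- a"] unip_mult[of "- a" a] by (auto simp: GL2_def invertible_def unip_0)

lemma unip_inv_GL2: "inv\<^bsub>GL2\<^esub> (unip a) = unip (- a)"
  by (rule group.inv_equality[OF group_GL2])
    (simp_all add: unip_GL2, simp add: GL2_def unip_mult unip_0)

lemma unipotent_gen_unip: "unipotent_gen = unip 1"
  by (simp add: unipotent_gen_def unip_def)

text \<open>The powers of the generator are the \<open>unip (of_nat n)\<close>, and every element of
  the prime field is of the form \<open>of_nat n\<close>.\<close>

lemma carrier_P: "carrier (P_group :: ('p::prime_card mod_ring ^ 2 ^ 2) monoid) = range unip"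
proof -
  have "generate GL2 {unip 1} \<subseteq> range (unip :: 'p mod_ring \<Rightarrow> _)"
  proof
    fix A assume "A \<in> generate GL2 {unip (1 :: 'p mod_ring)}"
    then show "A \<in> range unip"
    proof induction
      case one
      show ?case using unip_0 by (metis GL2_def monoid.simps(2) rangeI)
    next
      case (eng h g)
      then show ?case by (auto simp: GL2_def unip_mult)
    qed (auto simp: unip_inv_GL2)
  qed
  moreover have "unip (of_nat n) \<in> generate GL2 {unip (1 :: 'p mod_ring)}" for n
  proof (induction n)
    case 0
    show ?case using generate.one[of GL2 "{unip (1 :: 'p mod_ring)}"] by (simp add: GL2_def unip_0)
  next
    case (Suc n)
    have "unip (of_nat (Suc n) :: 'p mod_ring) = unip 1 \<otimes>\<^bsub>GL2\<^esub> unip (of_nat n)"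
      by (simp add: GL2_def unip_mult)
    then show ?case using generate.eng[OF generate.incl Suc] by simp
  qed
  then have "range (unip :: 'p mod_ring \<Rightarrow> _) \<subseteq> generate GL2 {unip 1}"
    using surj_of_nat_mod_ring by (metis image_subsetI)
  ultimately show ?thesis by (auto simp: P_group_def unipotent_gen_unip)
qed

lemma act_poly_unip:
  "act_poly (\<lambda>_. unip a) = (shift (- a) :: ('d::finite, 'p::prime_card mod_ring) poly_ring \<Rightarrow> _)"
proof -
  have sub: "subgroup (range unip) (GL2 :: ('p mod_ring ^ 2 ^ 2) monoid)"
    using group.generate_is_subgroup[OF group_GL2, of "{unip (1 :: 'p mod_ring)}"] unip_GL2[of "1 :: 'p mod_ring"]
      carrier_P[where 'p='p] by (simp add: P_group_def unipotent_gen_unip)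
  have P: "P_group = (GL2 :: ('p mod_ring ^ 2 ^ 2) monoid)\<lparr>carrier := range unip\<rparr>"
    using carrier_P[where 'p='p] unfolding P_group_def by simp
  have group_P: "group (P_group :: ('p mod_ring ^ 2 ^ 2) monoid)"
    unfolding P by (rule subgroup.subgroup_is_group[OF sub group_GL2])
  have inv_P: "inv\<^bsub>P_group\<^esub> (unip a) = unip (- a)"
    unfolding P using group.m_inv_consistent[OF group_GL2 sub, of "unip a"] by (simp add: unip_inv_GL2)
  have "inv\<^bsub>G_group\<^esub> (\<lambda>_ :: 'd. unip a) = (\<lambda>_. unip (- a))"
    unfolding G_group_def by (subst inv_product_group) (auto simp: group_P inv_P carrier_P)
  then show ?thesis by (simp add: act_poly_def pullback_unip)
qed

text \<open>The inverse in the action turns \<open>a\<close> into \<open>- a\<close>, which makes no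
  difference once \<open>a\<close> ranges over the whole field.\<close>

lemma carrier_invariant_ring:
  "carrier (invariant_ring diagonal_P) = (shift_inv :: ('d::finite, 'p::prime_card mod_ring) poly_ring set)"
proof -
  have "f \<in> carrier (invariant_ring diagonal_P) \<longleftrightarrow> (\<forall>a. shift (- a) f = f)"
    for f :: "('d, 'p mod_ring) poly_ring"
  proof -
    have D: "diagonal_P = range (\<lambda>a (_ :: 'd). unip (a :: 'p mod_ring))"
      by (auto simp: diagonal_P_def carrier_P)
    have "f \<in> carrier (invariant_ring diagonal_P) \<longleftrightarrow> (\<forall>h\<in>diagonal_P. act_poly h f = f)"
      by (simp add: invariant_ring_def)
    also have "\<dots> \<longleftrightarrow> (\<forall>a. act_poly (\<lambda>_. unip a) f = f)"
      unfolding D by blast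
    finally show ?thesis by (simp add: act_poly_unip)
  qed
  then show ?thesis by (auto simp: shift_inv_def) (metis minus_minus)
qed

lemma shift_inv_closed:
  "f \<in> shift_inv \<Longrightarrow> g \<in> shift_inv \<Longrightarrow> f + g \<in> shift_inv"
  "f \<in> shift_inv \<Longrightarrow> g \<in> shift_inv \<Longrightarrow> f - g \<in> shift_inv"
  "f \<in> shift_inv \<Longrightarrow> g \<in> shift_inv \<Longrightarrow> f * g \<in> shift_inv"
  "0 \<in> shift_inv" "1 \<in> shift_inv" "f \<in> shift_inv \<Longrightarrow> - f \<in> shift_inv"
  "f \<in> shift_inv \<Longrightarrow> f ^ n \<in> shift_inv"
  using shift_hom(2)[of _ 0 f] by (auto simp: shift_inv_def shift_hom)

lemma shift_inv_prod: "(\<And>i. i \<in> A \<Longrightarrow> f i \<in> shift_inv) \<Longrightarrow> (\<Prod>i\<in>A. f i) \<in> shift_inv"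
  by (simp add: shift_inv_def shift_prod)

text \<open>T is a domain, so an exact quotient in T of two invariants is invariant. Divisions can
  therefore be carried out in T.\<close>

lemma shift_inv_cancel:
  assumes "f * g \<in> shift_inv" "f \<in> shift_inv" "f \<noteq> 0" shows "g \<in> shift_inv"
  using assms by (auto simp: shift_inv_def shift_hom poly_ring_mult_left_cancel)

lemma Y_shift_inv [simp]: "yv i \<in> shift_inv"
  by (simp add: shift_inv_def)

text \<open>Both sides are multiples of \<open>yv i\<close>, so \<open>s * xv i + a = yv i * t\<close>, and applying \<open>shift 1 - 1\<close> to
  this gives \<open>s = shift 1 t - t\<close>.\<close>

lemma cocycle_not_boundary:
  assumes inv: "s \<in> shift_inv" "a \<in> shift_inv" and ij: "i \<noteq> j"
    and eq: "(s * xv i + a) * yv j = (s * xv j + b) * yv i"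
  shows "s \<in> var_ideal (range (\<lambda>i. (i, 2)))"
proof -
  have "(s * xv i + a) * yv j \<in> var_ideal {(i, 2)}"
    unfolding eq by (rule var_ideal_mult) simp
  then have "s * xv i + a \<in> var_ideal {(i, 2)}"
    using ij by (simp add: var_ideal_prime)
  then obtain t where t: "s * xv i + a = yv i * t" by (rule var_dvdE)
  have "yv i * s = shift 1 (s * xv i + a) - (s * xv i + a)"
    using inv by (simp add: shift_inv_def shift_hom poly_const.hom_one algebra_simps)
  also have "\<dots> = yv i * (shift 1 t - t)"
    unfolding t by (simp add: shift_hom right_diff_distrib)
  finally have "s = shift 1 t - t" by (simp add: poly_ring_mult_left_cancel)
  then show ?thesis using shift_diff_in_var_ideal by metis
qed


section \<open>Division by the norms\<close>

definition inv_ring :: "('d::finite, 'p::prime_card mod_ring) poly_ring ring" where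
  "inv_ring = invariant_ring diagonal_P"

lemma inv_ring_simps:
  "carrier inv_ring = shift_inv" "x \<otimes>\<^bsub>inv_ring\<^esub> y = x * y" "x \<oplus>\<^bsub>inv_ring\<^esub> y = x + y"
  "\<one>\<^bsub>inv_ring\<^esub> = 1" "\<zero>\<^bsub>inv_ring\<^esub> = 0"
  by (simp_all add: inv_ring_def carrier_invariant_ring) (simp_all add: invariant_ring_def)

lemma domain_inv_ring: "domain inv_ring"
proof (rule domainI)
  show "cring inv_ring"
  proof (rule cringI)
    show "abelian_group inv_ring"
    proof (rule abelian_groupI)
      fix x assume "x \<in> carrier inv_ring"
      then show "\<exists>y\<in>carrier inv_ring. y \<oplus>\<^bsub>inv_ring\<^esub> x = \<zero>\<^bsub>inv_ring\<^esub>"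
        by (intro bexI[of _ "- x"]) (simp_all add: inv_ring_simps shift_inv_closed)
    qed (simp_all add: inv_ring_simps shift_inv_closed)
    show "comm_monoid inv_ring"
      by (rule comm_monoidI) (simp_all add: inv_ring_simps shift_inv_closed)
  qed (simp add: inv_ring_simps distrib_right)
qed (simp_all add: inv_ring_simps poly_ring_mult_eq_0)

interpretation inv_ring: domain "inv_ring :: ('d::finite, 'p::prime_card mod_ring) poly_ring ring"
  rewrites "carrier inv_ring = shift_inv" and "\<And>x y. x \<otimes>\<^bsub>inv_ring\<^esub> y = x * y"
    and "\<And>x y. x \<oplus>\<^bsub>inv_ring\<^esub> y = x + y"
    and "\<one>\<^bsub>inv_ring\<^esub> = 1" and "\<zero>\<^bsub>inv_ring\<^esub> = 0"
  by (simp_all add: domain_inv_ring inv_ring_simps)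

lemma inv_ring_a_inv: "x \<in> shift_inv \<Longrightarrow> \<ominus>\<^bsub>inv_ring\<^esub> x = - x"
  by (rule inv_ring.minus_equality) (simp_all add: shift_inv_closed)

lemma inv_ring_a_minus: "x \<in> shift_inv \<Longrightarrow> y \<in> shift_inv \<Longrightarrow> x \<ominus>\<^bsub>inv_ring\<^esub> y = x - y"
  by (simp add: a_minus_def inv_ring_simps inv_ring_a_inv)

lemma inv_ring_pow: "x [^]\<^bsub>inv_ring\<^esub> (n::nat) = x ^ n"
  by (induction n) (simp_all add: inv_ring_simps mult.commute)

lemma inv_ring_idealI:
  assumes "I \<subseteq> shift_inv" "0 \<in> I" "\<And>x y. x \<in> I \<Longrightarrow> y \<in> I \<Longrightarrow> x + y \<in> I"
    and mult: "\<And>x y. x \<in> shift_inv \<Longrightarrow> y \<in> I \<Longrightarrow> x * y \<in> I"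
  shows "ideal I inv_ring"
proof (rule idealI[OF inv_ring.ring_axioms])
  have "\<ominus>\<^bsub>inv_ring\<^esub> x \<in> I" if "x \<in> I" for x
    using mult[OF shift_inv_closed(6)[OF shift_inv_closed(5)] that] that assms(1)
    by (simp add: inv_ring_a_inv subset_iff)
  then show "subgroup I (add_monoid inv_ring)"
    unfolding a_inv_def using assms(1-3) by (intro subgroup.intro) (auto simp: inv_ring_simps)
  show "a \<otimes>\<^bsub>inv_ring\<^esub> x \<in> I" "x \<otimes>\<^bsub>inv_ring\<^esub> a \<in> I" if "a \<in> I" "x \<in> carrier inv_ring" for a x
    using mult[of x a] that by (simp_all add: inv_ring_simps mult.commute)
qed

lemma inv_ring_ideal:
  assumes "ideal I inv_ring"
  shows "I \<subseteq> shift_inv" "0 \<in> I" "x \<in> I \<Longrightarrow> y \<in> I \<Longrightarrow> x + y \<in> I"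
    "x \<in> shift_inv \<Longrightarrow> y \<in> I \<Longrightarrow> x * y \<in> I" "x \<in> I \<Longrightarrow> y \<in> I \<Longrightarrow> x - y \<in> I"
proof -
  show sub: "I \<subseteq> shift_inv" using ideal.Icarr[OF assms] by (auto simp: inv_ring_simps)
  show "0 \<in> I" "x \<in> I \<Longrightarrow> y \<in> I \<Longrightarrow> x + y \<in> I"
    using additive_subgroup.zero_closed[OF ideal.axioms(1)[OF assms]]
      additive_subgroup.a_closed[OF ideal.axioms(1)[OF assms], of x y] by (simp_all add: inv_ring_simps)
  show "x \<in> shift_inv \<Longrightarrow> y \<in> I \<Longrightarrow> x * y \<in> I"
    using ideal.I_l_closed[OF assms, of y x] by (simp add: inv_ring_simps)
  show "x - y \<in> I" if "x \<in> I" "y \<in> I"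
    using inv_ring.minus_in_ideal[OF assms that] sub that by (simp add: inv_ring_a_minus subset_iff)
qed

lemma inv_ring_ideal_sum:
  assumes "ideal I inv_ring" shows "(\<And>i. i \<in> A \<Longrightarrow> h i \<in> I) \<Longrightarrow> (\<Sum>i\<in>A. h i) \<in> I"
  by (induction A rule: infinite_finite_induct) (auto intro: inv_ring_ideal[OF assms])

section \<open>Frobenius and the norms\<close>

lemma char_poly_ring: "CHAR(('d::finite, 'p::prime_card mod_ring) poly_ring) = CARD('p)"
proof (rule CHAR_eqI)
  have s: "(of_nat n :: ('d, 'p mod_ring) poly_ring) = Poly_Mapping.single 0 (of_nat n)" for n
    by simp
  have "of_nat CARD('p) = (0 :: 'p mod_ring)"
    using of_nat_CHAR[where 'a = "'p mod_ring"] by simp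
  then show "of_nat CARD('p) = (0 :: ('d, 'p mod_ring) poly_ring)" by (metis s single_zero)
  show "CARD('p) dvd n" if "of_nat n = (0 :: ('d, 'p mod_ring) poly_ring)" for n
  proof -
    have "Poly_Mapping.lookup (of_nat n :: ('d, 'p mod_ring) poly_ring) 0 = of_nat n"
      by (simp add: lookup_of_nat)
    then have "of_nat n = (0 :: 'p mod_ring)" using that by simp
    then show ?thesis by (rule of_nat_0_mod_ring_dvd)
  qed
qed

lemma frobenius_add: "(f + g) ^ CARD('p) = f ^ CARD('p) + g ^ CARD('p)"
  for f g :: "('d::finite, 'p::prime_card mod_ring) poly_ring"
  by (rule freshmans_dream) (simp_all add: char_poly_ring prime_card)

lemma frobenius_sum: "(\<Sum>i\<in>A. h i) ^ CARD('p) = (\<Sum>i\<in>A. h i ^ CARD('p))"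
  for h :: "'i \<Rightarrow> ('d::finite, 'p::prime_card mod_ring) poly_ring"
  by (rule freshmans_dream_sum) (simp_all add: char_poly_ring prime_card)

lemma p_ge_2: "2 \<le> CARD('p::prime_card)"
  using prime_card[where 'a = 'p] by (rule prime_ge_2_nat)

text \<open>The orbit product of all \<open>xv i + poly_const a * yv i\<close> in expanded form. It
  is monic of degree p in \<open>xv i\<close>, and its only other term is linear in
  \<open>xv i\<close>.\<close>

definition normx :: "'d \<Rightarrow> ('d::finite, 'p::prime_card mod_ring) poly_ring" where
  "normx i = xv i ^ CARD('p) - xv i * yv i ^ (CARD('p) - 1)"

text \<open>By Frobenius and \<open>a ^ p = a\<close> the p-th power of \<open>xv i\<close> changes
  by \<open>a\<close> times \<open>yv i ^ p\<close>, and so does the other term.\<close>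

lemma normx_shift_inv [simp]: "(normx i :: ('d::finite, 'p::prime_card mod_ring) poly_ring) \<in> shift_inv"
proof -
  have "shift a (normx i) = (normx i :: ('d, 'p mod_ring) poly_ring)" for a
  proof -
    have "poly_const a ^ n = (poly_const (a ^ n) :: ('d, 'p mod_ring) poly_ring)" for n
      by (induction n) (simp_all add: poly_const.hom_one poly_const.hom_mult)
    then have "poly_const a ^ CARD('p) = (poly_const (a ^ CARD('p)) :: ('d, 'p mod_ring) poly_ring)" .
    also have "a ^ CARD('p) = a"
      using finite_field_power_card_eq_same[of a] by simp
    finally have a: "poly_const a ^ CARD('p) = (poly_const a :: ('d, 'p mod_ring) poly_ring)" .
    have y: "yv i ^ CARD('p) = yv i * (yv i ^ (CARD('p) - 1) :: ('d, 'p mod_ring) poly_ring)"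
      by (simp flip: power_Suc)
    show ?thesis
      by (simp add: normx_def shift_hom frobenius_add power_mult_distrib a) (simp add: y algebra_simps)
  qed
  then show ?thesis by (simp add: shift_inv_def)
qed

section \<open>Division with remainder by a norm\<close>

definition xdeg_le :: "'d::finite \<Rightarrow> nat \<Rightarrow> ('d, 'k::field) poly_ring \<Rightarrow> bool" where
  "xdeg_le i = deg_le (\<lambda>v. if v = (i, 1) then 1 else 0)"

lemma xdeg_le_iff:
  fixes f :: "('d::finite, 'k::field) poly_ring"
  shows "xdeg_le i n f \<longleftrightarrow> (\<forall>m\<in>Poly_Mapping.keys f. Poly_Mapping.lookup m (i, 1) \<le> n)"
proof -
  have "(\<Sum>v\<in>UNIV. (if v = (i, 1) then 1 else 0) * Poly_Mapping.lookup m v) = Poly_Mapping.lookup m (i, 1)"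
    for m :: "('d \<times> 2) \<Rightarrow>\<^sub>0 nat"
    by (subst sum.remove[of _ "(i, 1)"]) auto
  then show ?thesis by (simp add: xdeg_le_def deg_le_def)
qed

text \<open>The shift adds to a variable a multiple of some \<open>yv j\<close>, which has degree 0
  in \<open>xv i\<close>.\<close>

lemma xdeg_le_shift:
  assumes "xdeg_le i n f" shows "xdeg_le i n (shift a f)"
  unfolding xdeg_le_def shift_def
proof (rule deg_le_poly_subst[OF _ assms[unfolded xdeg_le_def]])
  let ?w = "\<lambda>v :: 'a \<times> 2. if v = (i, 1) then 1 else (0::nat)"
  fix v :: "'a \<times> 2"
  have "deg_le ?w (0 + 0) (poly_const a * yv j)" for j
    by (rule deg_le_mult) (auto simp: poly_const_def deg_le_single deg_le_var)
  then have c: "deg_le ?w n (poly_const a * yv j)" for j n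
    by (rule deg_le_mono) simp
  show "deg_le ?w (?w v) (shift_var a v)"
    using exhaust_2[of "snd v"]
    by (cases v) (auto simp: shift_var_def deg_le_var intro!: deg_le_add c)
qed

lemma normx_mult:
  fixes q :: "('d::finite, 'p::prime_card mod_ring) poly_ring"
  shows "normx i * q = Poly_Mapping.single (Poly_Mapping.single (i, 1) CARD('p)) 1 * q
     - Poly_Mapping.single (Poly_Mapping.single (i, 1) 1 + Poly_Mapping.single (i, 2) (CARD('p) - 1)) 1 * q"
  by (simp add: normx_def poly_var_power left_diff_distrib)
    (simp add: poly_var_def mult_single)

text \<open>The norm is monic of degree p in \<open>xv i\<close>, so a nonzero multiple of it has
  degree at least p. The monomial \<open>m\<close> of top degree in \<open>q\<close> witnesses
  this.\<close>

lemma division_unique: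
  fixes q :: "('d::finite, 'p::prime_card mod_ring) poly_ring"
  assumes "xdeg_le i (CARD('p) - 1) (normx i * q)"
  shows "q = 0"
proof (rule ccontr)
  assume "q \<noteq> 0"
  then have "Poly_Mapping.keys q \<noteq> {}" by simp
  define M where "M = Max ((\<lambda>m. Poly_Mapping.lookup m (i, 1)) ` Poly_Mapping.keys q)"
  have "M \<in> (\<lambda>m. Poly_Mapping.lookup m (i, 1)) ` Poly_Mapping.keys q"
    unfolding M_def using \<open>Poly_Mapping.keys q \<noteq> {}\<close> by (intro Max_in) auto
  then obtain m where m: "m \<in> Poly_Mapping.keys q" "Poly_Mapping.lookup m (i, 1) = M" by auto
  have max: "Poly_Mapping.lookup n (i, 1) \<le> M" if "n \<in> Poly_Mapping.keys q" for n
    unfolding M_def using that by (intro Max_ge) auto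
  let ?e = "Poly_Mapping.single (i, 1) CARD('p) :: ('d \<times> 2) \<Rightarrow>\<^sub>0 nat"
  let ?f = "Poly_Mapping.single (i, 1) 1 + Poly_Mapping.single (i, 2) (CARD('p) - 1) :: ('d \<times> 2) \<Rightarrow>\<^sub>0 nat"
  \<comment> \<open>The other term of the norm produces only degrees up to \<open>M + 1\<close> in
    \<open>xv i\<close>. This is below \<open>p + M\<close> because p is at least 2, so no
    cancellation can occur.\<close>
  have "Poly_Mapping.lookup (Poly_Mapping.single ?f 1 * q) (?e + m) = 0"
  proof (rule ccontr)
    assume "Poly_Mapping.lookup (Poly_Mapping.single ?f 1 * q) (?e + m) \<noteq> 0"
    then obtain n where n: "?e + m = ?f + n" "n \<in> Poly_Mapping.keys q"
      by (rule lookup_single_mult_nonzero)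
    have "Poly_Mapping.lookup (?e + m) (i, 1) = Poly_Mapping.lookup (?f + n) (i, 1)" using n by simp
    then have "CARD('p) + M = 1 + Poly_Mapping.lookup n (i, 1)"
      using m by (simp add: lookup_add lookup_single)
    then show False using max[OF n(2)] p_ge_2[where 'p='p] by linarith
  qed
  then have "Poly_Mapping.lookup (normx i * q) (?e + m) = Poly_Mapping.lookup q m"
    unfolding normx_mult by (simp only: lookup_minus lookup_single_mult_add) simp
  then have "?e + m \<in> Poly_Mapping.keys (normx i * q)" using m by (simp add: in_keys_iff)
  then have "Poly_Mapping.lookup (?e + m) (i, 1) \<le> CARD('p) - 1"
    using assms by (simp add: xdeg_le_iff)
  then show False using p_ge_2[where 'p='p] by (simp add: lookup_add)
qed

text \<open>Modulo the norm, \<open>xv i ^ p\<close> may be replaced by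
  \<open>xv i * yv i ^ (p - 1)\<close>, which lowers the exponent of \<open>xv i\<close> by
  \<open>p - 1 > 0\<close>.\<close>

lemma division_exists:
  fixes f :: "('d::finite, 'p::prime_card mod_ring) poly_ring"
  shows "\<exists>q r. f = normx i * q + r \<and> xdeg_le i (CARD('p) - 1) r"
proof (induction f rule: poly_mapping_induct)
  case (single m c)
  show ?case
  proof (induction "Poly_Mapping.lookup m (i, 1)" arbitrary: m rule: less_induct)
    case less
    show ?case
    proof (cases "Poly_Mapping.lookup m (i, 1) < CARD('p)")
      case True
      then have "xdeg_le i (CARD('p) - 1) (Poly_Mapping.single m c)"
        by (auto simp: xdeg_le_iff)
      then show ?thesis by (intro exI[of _ 0] exI[of _ "Poly_Mapping.single m c"]) simp
    next
      case False
      define m' where "m' = m - Poly_Mapping.single (i, 1) CARD('p)"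
      have m: "m = Poly_Mapping.single (i, 1) CARD('p) + m'"
        using False by (intro poly_mapping_eqI)
          (auto simp: m'_def lookup_add lookup_minus lookup_single when_def)
      define n where "n = Poly_Mapping.single (i, 1) 1 + Poly_Mapping.single (i, 2) (CARD('p) - 1) + m'"
      have "Poly_Mapping.lookup n (i, 1) < Poly_Mapping.lookup m (i, 1)"
        using p_ge_2[where 'p='p] by (simp add: m n_def lookup_add lookup_single)
      from less[OF this] obtain q r where qr: "Poly_Mapping.single n c = normx i * q + r"
        "xdeg_le i (CARD('p) - 1) r" by blast
      have "Poly_Mapping.single m c = normx i * Poly_Mapping.single m' c + Poly_Mapping.single n c"
        by (simp add: normx_mult mult_single m n_def)
      also have "\<dots> = normx i * (Poly_Mapping.single m' c + q) + r"
        unfolding qr(1) by (simp add: distrib_left)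
      finally show ?thesis using qr(2) by blast
    qed
  qed
next
  case (add f g)
  then obtain q r q' r' where "f = normx i * q + r" "xdeg_le i (CARD('p) - 1) r"
    "g = normx i * q' + r'" "xdeg_le i (CARD('p) - 1) r'" by blast
  then show ?case
    by (intro exI[of _ "q + q'"] exI[of _ "r + r'"])
      (simp add: algebra_simps xdeg_le_def deg_le_add)
qed

definition remainder :: "'d \<Rightarrow> ('d::finite, 'p::prime_card mod_ring) poly_ring \<Rightarrow> ('d, 'p mod_ring) poly_ring" where
  "remainder i f = (SOME r. xdeg_le i (CARD('p) - 1) r \<and> (\<exists>q. f = normx i * q + r))"

lemma remainder:
  fixes f :: "('d::finite, 'p::prime_card mod_ring) poly_ring"
  shows "xdeg_le i (CARD('p) - 1) (remainder i f)" and "\<exists>q. f = normx i * q + remainder i f"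
proof -
  have "\<exists>r. xdeg_le i (CARD('p) - 1) r \<and> (\<exists>q. f = normx i * q + r)"
    using division_exists[of f i] by blast
  from someI_ex[OF this]
  show "xdeg_le i (CARD('p) - 1) (remainder i f)" and "\<exists>q. f = normx i * q + remainder i f"
    unfolding remainder_def by blast+
qed

lemma remainder_eqI:
  fixes f :: "('d::finite, 'p::prime_card mod_ring) poly_ring"
  assumes "f = normx i * q + r" "xdeg_le i (CARD('p) - 1) r"
  shows "remainder i f = r"
proof -
  obtain q' where q': "f = normx i * q' + remainder i f" using remainder by blast
  then have eq: "normx i * (q' - q) = r - remainder i f" using assms by (simp add: algebra_simps)
  have "xdeg_le i (CARD('p) - 1) (r - remainder i f)"
    using assms(2) remainder(1) unfolding xdeg_le_def by (rule deg_le_minus)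
  then have "q' - q = 0" unfolding eq[symmetric] by (rule division_unique)
  then show ?thesis using eq by simp
qed

lemma remainder_normx_mult: "remainder i (normx i * f) = 0"
  by (rule remainder_eqI[of _ _ f]) (simp_all add: xdeg_le_def)

lemma remainder_id:
  fixes f :: "('d::finite, 'p::prime_card mod_ring) poly_ring"
  shows "xdeg_le i (CARD('p) - 1) f \<Longrightarrow> remainder i f = f"
  by (rule remainder_eqI[of _ _ 0]) simp_all

lemma remainder_0: "remainder i 0 = 0"
  by (rule remainder_id) (simp add: xdeg_le_def)

lemma remainder_add: "remainder i (f + g) = remainder i f + remainder i g"
proof -
  obtain q q' where q: "f = normx i * q + remainder i f" "g = normx i * q' + remainder i g"
    using remainder by metis
  show ?thesis
  proof (rule remainder_eqI[of _ _ "q + q'"])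
    show "f + g = normx i * (q + q') + (remainder i f + remainder i g)"
      by (subst q(1), subst q(2)) (simp add: algebra_simps)
  qed (use remainder(1) in \<open>auto simp: xdeg_le_def intro: deg_le_add\<close>)
qed

text \<open>Polynomials free of \<open>xv i\<close> are scalars for division by
  \<open>normx i\<close>. This applies to all \<open>yv j\<close> and to the norms with other
  indices.\<close>

lemma remainder_mult:
  assumes "xdeg_le i 0 h" shows "remainder i (h * f) = h * remainder i f"
proof -
  obtain q where q: "f = normx i * q + remainder i f" using remainder by metis
  show ?thesis
  proof (rule remainder_eqI[of _ _ "h * q"])
    show "h * f = normx i * (h * q) + h * remainder i f"
      by (subst q) (simp add: algebra_simps)
    show "xdeg_le i (CARD('b) - 1) (h * remainder i f)"
      using deg_le_mult[OF assms[unfolded xdeg_le_def] remainder(1)[of i f, unfolded xdeg_le_def]]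
      by (simp add: xdeg_le_def)
  qed
qed

lemma xdeg_le_yv [simp]: "xdeg_le i n (yv j)"
  by (simp add: xdeg_le_def deg_le_var)

lemma xdeg_le_normx:
  assumes ij: "i \<noteq> j"
  shows "xdeg_le i 0 (normx j :: ('d::finite, 'p::prime_card mod_ring) poly_ring)"
proof -
  have x: "xdeg_le i 0 (xv j :: ('d, 'p mod_ring) poly_ring)" using ij by (simp add: xdeg_le_def deg_le_var)
  have y: "xdeg_le i 0 (yv j :: ('d, 'p mod_ring) poly_ring)" by simp
  have pow: "xdeg_le i 0 (f ^ n)" if "xdeg_le i 0 f" for f :: "('d, 'p mod_ring) poly_ring" and n
    using deg_le_power[OF that[unfolded xdeg_le_def], of n] by (simp add: xdeg_le_def)
  have mult: "xdeg_le i 0 (f * g)" if "xdeg_le i 0 f" "xdeg_le i 0 g" for f g :: "('d, 'p mod_ring) poly_ring"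
    using deg_le_mult[OF that[unfolded xdeg_le_def]] by (simp add: xdeg_le_def)
  have "xdeg_le i 0 (xv j ^ CARD('p) :: ('d, 'p mod_ring) poly_ring)"
    "xdeg_le i 0 (xv j * yv j ^ (CARD('p) - 1) :: ('d, 'p mod_ring) poly_ring)"
    by (intro pow mult x y)+
  then show ?thesis unfolding normx_def xdeg_le_def by (rule deg_le_minus)
qed

lemma normx_nonzero [simp]: "normx i \<noteq> 0"
proof
  assume "normx i = (0 :: ('a, 'b mod_ring) poly_ring)"
  then have "xdeg_le i (CARD('b) - 1) (normx i * (1 :: ('a, 'b mod_ring) poly_ring))"
    by (simp add: xdeg_le_def)
  then have "(1 :: ('a, 'b mod_ring) poly_ring) = 0" by (rule division_unique)
  then show False by simp
qed

text \<open>A shift fixes the norm and preserves the bound on the degree, so it carries one division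
  of \<open>f\<close> to another; uniqueness then makes the remainder invariant. The quotient
  follows by cancelling the norm.\<close>

lemma remainder_shift_inv:
  fixes f :: "('d::finite, 'p::prime_card mod_ring) poly_ring"
  assumes "f \<in> shift_inv"
  shows "remainder i f \<in> shift_inv" and "\<exists>q\<in>shift_inv. f = normx i * q + remainder i f"
proof -
  obtain q where q: "f = normx i * q + remainder i f" using remainder by metis
  have N: "shift a (normx i) = (normx i :: ('d, 'p mod_ring) poly_ring)" for a
    using normx_shift_inv[of i, where 'p='p] by (simp add: shift_inv_def)
  have "remainder i f = shift a (remainder i f)" for a
  proof (rule remainder_eqI)
    have "f = shift a f" using assms by (simp add: shift_inv_def)
    also have "\<dots> = shift a (normx i * q + remainder i f)" using q by simp
    finally show "f = normx i * shift a q + shift a (remainder i f)" by (simp add: shift_hom N)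
  qed (intro xdeg_le_shift remainder)
  then show r: "remainder i f \<in> shift_inv" unfolding shift_inv_def by simp
  have "normx i * q = f - remainder i f" using q by (simp add: algebra_simps)
  then have "normx i * q \<in> shift_inv" using assms r shift_inv_closed by simp
  then have "q \<in> shift_inv" by (rule shift_inv_cancel) simp_all
  then show "\<exists>q\<in>shift_inv. f = normx i * q + remainder i f" using q by blast
qed


section \<open>A regular sequence of length \<open>d + 2\<close>\<close>

text \<open>Expanding \<open>s\<^sup>p = (\<Prod>a. shift a s)\<close> gives a sum over all maps \<open>\<phi>\<close> from the group to the index
  set; collecting the maps with the same product of the \<open>f (\<phi> a)\<close> makes the coefficients invariant.\<close>

lemma power_in_genideal:
  fixes f :: "'i::finite \<Rightarrow> ('d::finite, 'p::prime_card mod_ring) poly_ring"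
  assumes f: "\<And>i. f i \<in> shift_inv" and s: "s \<in> shift_inv" "s = (\<Sum>i\<in>UNIV. f i * t i)"
  shows "s ^ CARD('p) \<in> Idl\<^bsub>inv_ring\<^esub> (range f)"
proof -
  have I: "ideal (Idl\<^bsub>inv_ring\<^esub> (range f)) inv_ring"
    using f by (intro inv_ring.genideal_ideal) auto
  have fI: "f i \<in> Idl\<^bsub>inv_ring\<^esub> (range f)" for i
    using inv_ring.genideal_self[of "range f"] f by auto
  define F where "F = (UNIV :: ('p mod_ring \<Rightarrow> 'i) set)"
  define y where "y \<phi> = (\<Prod>a\<in>UNIV. f (\<phi> a))" for \<phi> :: "'p mod_ring \<Rightarrow> 'i"
  define u where "u \<phi> = (\<Prod>a\<in>UNIV. shift a (t (\<phi> a)))" for \<phi> :: "'p mod_ring \<Rightarrow> 'i"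
  have fin: "finite F" by (simp add: F_def)
  \<comment> \<open>All shifts fix \<open>s\<close>, and the group has p elements, so the p-th power
    is the norm of \<open>s\<close>.\<close>
  have "s ^ CARD('p) = (\<Prod>a\<in>(UNIV :: 'p mod_ring set). shift a s)"
    using s(1) by (simp add: shift_inv_def)
  also have "\<dots> = (\<Prod>a\<in>(UNIV :: 'p mod_ring set). \<Sum>i\<in>UNIV. f i * shift a (t i))"
    using f by (simp add: s(2) shift_sum shift_hom shift_inv_def)
  also have "\<dots> = (\<Sum>\<phi>\<in>F. y \<phi> * u \<phi>)"
    by (subst prod_sum_PiE) (simp_all add: PiE_UNIV_domain F_def y_def u_def prod.distrib)
  also have "\<dots> = (\<Sum>z\<in>y ` F. \<Sum>\<phi> | \<phi> \<in> F \<and> y \<phi> = z. y \<phi> * u \<phi>)"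
    by (rule sum.image_gen[OF fin])
  also have "\<dots> = (\<Sum>z\<in>y ` F. z * (\<Sum>\<phi> | \<phi> \<in> F \<and> y \<phi> = z. u \<phi>))"
    by (simp add: sum_distrib_left)
  also have "\<dots> \<in> Idl\<^bsub>inv_ring\<^esub> (range f)"
  proof (rule inv_ring_ideal_sum[OF I])
    fix z assume "z \<in> y ` F"
    then obtain \<phi> where z: "z = y \<phi>" by auto
    \<comment> \<open>One factor, here the one at the group element 0, already places
      \<open>z\<close> in the ideal.\<close>
    have "z = (\<Prod>a\<in>UNIV - {0}. f (\<phi> a)) * f (\<phi> 0)"
      unfolding z y_def by (subst prod.remove[of _ 0]) (auto simp: mult.commute)
    then have zI: "z \<in> Idl\<^bsub>inv_ring\<^esub> (range f)"
      using f fI by (auto intro!: inv_ring_ideal(4)[OF I] shift_inv_prod)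
    have "(\<Sum>\<phi> | \<phi> \<in> F \<and> y \<phi> = z. u \<phi>) \<in> shift_inv"
      unfolding shift_inv_def
    proof (intro CollectI allI)
      fix b :: "'p mod_ring"
      have "shift b (\<Sum>\<phi> | \<phi> \<in> F \<and> y \<phi> = z. u \<phi>)
          = (\<Sum>\<phi> | \<phi> \<in> F \<and> y \<phi> = z. \<Prod>a\<in>UNIV. shift (b + a) (t (\<phi> a)))"
        by (simp add: u_def shift_sum shift_prod shift_shift)
      also have "\<dots> = (\<Sum>\<phi> | \<phi> \<in> F \<and> y \<phi> = z. u \<phi>)"
      \<comment> \<open>Translating the argument of a map by \<open>b\<close> permutes the factors
        of its \<open>y\<close>, so the maps with value \<open>z\<close> are permuted among
        themselves, while the product of shifted coefficients becomes \<open>u\<close> of the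
        translated map.\<close>
      proof (rule sum.reindex_bij_witness[of _ "\<lambda>\<psi> a. \<psi> (b + a)" "\<lambda>\<phi> a. \<phi> (a - b)"])
        fix \<phi> assume "\<phi> \<in> {\<phi> \<in> F. y \<phi> = z}"
        moreover have "y (\<lambda>a. \<phi> (a - b)) = y \<phi>" "y (\<lambda>a. \<phi> (b + a)) = y \<phi>"
          unfolding y_def
          by (rule prod.reindex_bij_witness[of _ "\<lambda>a. a + b" "\<lambda>a. a - b"]; simp)
            (rule prod.reindex_bij_witness[of _ "\<lambda>a. a - b" "\<lambda>a. b + a"]; simp)
        ultimately show "(\<lambda>a. \<phi> (a - b)) \<in> {\<phi> \<in> F. y \<phi> = z}"
          and "(\<lambda>a. \<phi> (b + a)) \<in> {\<phi> \<in> F. y \<phi> = z}" by (auto simp: F_def)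
        show "u (\<lambda>a. \<phi> (a - b)) = (\<Prod>a\<in>UNIV. shift (b + a) (t (\<phi> a)))"
          unfolding u_def
          by (rule prod.reindex_bij_witness[of _ "\<lambda>a. b + a" "\<lambda>a. a - b"]) simp_all
      qed simp_all
      finally show "shift b (\<Sum>\<phi> | \<phi> \<in> F \<and> y \<phi> = z. u \<phi>) = (\<Sum>\<phi> | \<phi> \<in> F \<and> y \<phi> = z. u \<phi>)" .
    qed
    then show "z * (\<Sum>\<phi> | \<phi> \<in> F \<and> y \<phi> = z. u \<phi>) \<in> Idl\<^bsub>inv_ring\<^esub> (range f)"
      using inv_ring_ideal(4)[OF I _ zI] by (subst mult.commute) blast
  qed
  finally show ?thesis .
qed

definition remainders :: "'d list \<Rightarrow> ('d::finite, 'p::prime_card mod_ring) poly_ring \<Rightarrow> ('d, 'p mod_ring) poly_ring" where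
  "remainders is = fold remainder is"

lemma remainders_simps [simp]: "remainders [] f = f" "remainders (i # is) f = remainders is (remainder i f)"
  "remainders (is @ js) f = remainders js (remainders is f)"
  by (simp_all add: remainders_def)

lemma remainders_0 [simp]: "remainders is 0 = 0"
  by (induction "is") (simp_all add: remainder_0)

lemma remainders_add: "remainders is (f + g) = remainders is f + remainders is g"
  by (induction "is" arbitrary: f g) (simp_all add: remainder_add)

lemma remainders_minus: "remainders is (f - g) = remainders is f - remainders is g"
  using remainders_add[of "is" "f - g" g] by simp

lemma remainders_mult: "(\<And>i. i \<in> set is \<Longrightarrow> xdeg_le i 0 h) \<Longrightarrow> remainders is (h * f) = h * remainders is f"
  by (induction "is" arbitrary: f) (simp_all add: remainder_mult)

lemma remainders_yv: "remainders is (yv j * f) = yv j * remainders is f"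
  by (rule remainders_mult) simp

lemma remainders_shift_inv: "f \<in> shift_inv \<Longrightarrow> remainders is f \<in> shift_inv"
  by (induction "is" arbitrary: f) (simp_all add: remainder_shift_inv)

text \<open>Divisions by norms other than \<open>normx j\<close> pull it out as a scalar, so it is
  still a factor when the division by \<open>normx j\<close> is reached.\<close>

lemma remainders_normx: "j \<in> set is \<Longrightarrow> remainders is (normx j * f) = 0"
proof (induction "is" arbitrary: f)
  case (Cons i "is")
  then show ?case
    by (cases "i = j") (simp_all add: remainder_normx_mult remainder_mult xdeg_le_normx)
qed simp

lemma diff_remainders_in_genideal:
  fixes f :: "('d::finite, 'p::prime_card mod_ring) poly_ring"
  assumes "f \<in> shift_inv"
  shows "f - remainders is f \<in> Idl\<^bsub>inv_ring\<^esub> (normx ` set is)"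
proof -
  have carr: "normx ` set is \<subseteq> (shift_inv :: ('d, 'p mod_ring) poly_ring set)" by auto
  have I: "ideal (Idl\<^bsub>inv_ring\<^esub> (normx ` set is)) (inv_ring :: ('d, 'p mod_ring) poly_ring ring)"
    by (rule inv_ring.genideal_ideal[OF carr])
  define J where "J = Idl\<^bsub>inv_ring\<^esub> (normx ` set is :: ('d, 'p mod_ring) poly_ring set)"
  note I = I[folded J_def]
  have "f - remainders js f \<in> J" if "set js \<subseteq> set is" "f \<in> shift_inv"
    for js and f :: "('d, 'p mod_ring) poly_ring"
    using that
  proof (induction js arbitrary: f)
    case (Cons j js)
    obtain q where q: "q \<in> shift_inv" "f = normx j * q + remainder j f"
      using remainder_shift_inv(2)[OF Cons.prems(2)] by blast
    have "normx j \<in> J"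
      using inv_ring.genideal_self[OF carr] Cons.prems(1) by (auto simp: J_def)
    then have "q * normx j \<in> J"
      using inv_ring_ideal(4)[OF I] q(1) by blast
    moreover have "remainder j f - remainders js (remainder j f) \<in> J"
      using Cons by (simp add: remainder_shift_inv)
    ultimately have "q * normx j + (remainder j f - remainders js (remainder j f)) \<in> J"
      by (rule inv_ring_ideal(3)[OF I])
    moreover have "f - remainders (j # js) f = q * normx j + (remainder j f - remainders js (remainder j f))"
      using q(2) by (simp add: algebra_simps)
    ultimately show ?case by (simp only:)
  qed (simp add: inv_ring_ideal(2)[OF I])
  then show ?thesis using assms unfolding J_def by blast
qed

text \<open>Membership in an ideal of S thereby becomes an equation in T, where the domain property
  and divisibility by variables are available.\<close>

lemma genideal_normx:
  "Idl\<^bsub>inv_ring\<^esub> (normx ` set is) = {f \<in> shift_inv. remainders is f = (0 :: ('d::finite, 'p::prime_card mod_ring) poly_ring)}"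
proof (rule antisym)
  let ?K = "{f \<in> shift_inv. remainders is f = (0 :: ('d, 'p mod_ring) poly_ring)}"
  show "?K \<subseteq> Idl\<^bsub>inv_ring\<^esub> (normx ` set is)" 
  proof
    fix f :: "('d, 'p mod_ring) poly_ring" assume "f \<in> ?K"
    then show "f \<in> Idl\<^bsub>inv_ring\<^esub> (normx ` set is)"
      using diff_remainders_in_genideal[of f "is"] by simp
  qed
  \<comment> \<open>Quantifying over all multiples by elements of T makes closure under
    multiplication immediate.\<close>
  define K where "K = {g \<in> shift_inv. \<forall>f. remainders is (f * g) = (0 :: ('d, 'p mod_ring) poly_ring)}"
  have "ideal K inv_ring"
  proof (rule inv_ring_idealI)
    show "x * y \<in> K" if "x \<in> shift_inv" "y \<in> K" for x y
      using that by (auto simp: K_def shift_inv_closed simp flip: mult.assoc)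
  qed (auto simp: K_def shift_inv_closed distrib_left remainders_add)
  moreover have "normx ` set is \<subseteq> K"
    using remainders_normx by (auto simp: K_def mult.commute)
  ultimately have "Idl\<^bsub>inv_ring\<^esub> (normx ` set is) \<subseteq> K" by (rule inv_ring.genideal_minimal)
  moreover have "K \<subseteq> ?K" by (auto simp: K_def) (metis mult_1)
  ultimately show "Idl\<^bsub>inv_ring\<^esub> (normx ` set is) \<subseteq> ?K" by blast
qed

lemma nth_notin_set_take: "distinct xs \<Longrightarrow> k < length xs \<Longrightarrow> xs ! k \<notin> set (take k xs)"
  by (auto simp: in_set_conv_nth nth_eq_iff_index_eq)

text \<open>Modulo \<open>normx ` UNIV\<close> the ring embeds into the polynomials that have degree less than \<open>p\<close> in each
  \<open>xv i\<close>, a free module over the polynomials in the \<open>yv i\<close>.\<close>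

lemma regular_sequence_normx_yv:
  assumes ij: "i \<noteq> j" and is_: "distinct is" "set is = UNIV"
  shows "regular_sequence (inv_ring :: ('d::finite, 'p::prime_card mod_ring) poly_ring ring)
           (map normx is @ [yv i, yv j])"
    (is "regular_sequence _ ?xs")
proof -
  let ?R = "inv_ring :: ('d, 'p mod_ring) poly_ring ring"
  let ?n = "length is"
  have carr: "set ?xs \<subseteq> shift_inv" by auto
  have N: "Idl\<^bsub>?R\<^esub> (normx ` set js) = {f \<in> shift_inv. remainders js f = 0}" for js
    by (rule genideal_normx)
  have "a \<in> Idl\<^bsub>?R\<^esub> (set (take k ?xs))"
    if k: "k < length ?xs" and a: "a \<in> shift_inv" and xa: "?xs ! k * a \<in> Idl\<^bsub>?R\<^esub> (set (take k ?xs))" for k a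
  proof -
    consider "k < ?n" | "k = ?n" | "k = Suc ?n" using k by force
    then show ?thesis
    proof cases
      case 1
      have take: "set (take k ?xs) = normx ` set (take k is)" using 1 by (simp add: take_map)
      \<comment> \<open>Since the indices are distinct, the next norm is a scalar for the earlier
        divisions and can be cancelled in T.\<close>
      have "is ! k \<notin> set (take k is)"
        by (rule nth_notin_set_take[OF is_(1) 1])
      then have "remainders (take k is) (normx (is ! k) * a) = normx (is ! k) * remainders (take k is) a"
        by (intro remainders_mult xdeg_le_normx) auto
      then show ?thesis
        using xa a 1 unfolding take N by (simp add: nth_append poly_ring_mult_eq_0)
    next
      case 2
      then have take: "set (take k ?xs) = normx ` set is" by simp
      show ?thesis using xa a 2 unfolding take N by (simp add: nth_append remainders_yv poly_ring_mult_eq_0)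
    next
      case 3
      then have take: "set (take k ?xs) = insert (yv i) (normx ` set is)" by auto
      have Idl: "Idl\<^bsub>?R\<^esub> (insert (yv i) (normx ` set is))
          = {u + c * yv i | u c. u \<in> Idl\<^bsub>?R\<^esub> (normx ` set is) \<and> c \<in> shift_inv}"
        by (rule inv_ring.genideal_insert) auto
      from xa 3 obtain u c where u: "u \<in> shift_inv" "remainders is u = 0" "c \<in> shift_inv"
        and eq: "yv j * a = u + yv i * c"
        unfolding take Idl N by (auto simp: nth_append mult.commute)
      let ?r = "remainders is"
      have eq': "yv j * ?r a = yv i * ?r c"
        using arg_cong[OF eq, of ?r] u by (simp add: remainders_add remainders_yv)
      \<comment> \<open>In T the variable \<open>yv i\<close> generates a prime ideal not containing
        \<open>yv j\<close>, so it divides the remainder of \<open>a\<close>; the quotient is again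
        invariant.\<close>
      then have "yv j * ?r a \<in> var_ideal {(i, 2)}"
        by (metis mult.commute poly_var_in_var_ideal singletonI var_ideal_mult)
      then have "?r a \<in> var_ideal {(i, 2)}" using ij by (simp add: var_ideal_prime)
      then obtain g where g: "?r a = yv i * g" by (rule var_dvdE)
      have "yv i * g \<in> shift_inv" using remainders_shift_inv[OF a] g by metis
      then have g_inv: "g \<in> shift_inv" by (rule shift_inv_cancel) auto
      have a_eq: "a = (a - ?r a) + g * yv i" using g by (simp add: mult.commute)
      have "a - ?r a \<in> Idl\<^bsub>?R\<^esub> (normx ` set is)" by (rule diff_remainders_in_genideal[OF a])
      then show ?thesis unfolding take Idl using g_inv a_eq by blast
    qed
  qed
  moreover have "Idl\<^bsub>?R\<^esub> (set ?xs) \<noteq> shift_inv"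
  proof -
    \<comment> \<open>The invariants without constant term contain the whole sequence but not
      1.\<close>
    have "ideal (shift_inv \<inter> var_ideal UNIV) ?R"
      by (rule inv_ring_idealI) (auto simp: shift_inv_closed var_ideal_add var_ideal_mult)
    moreover have "normx l \<in> var_ideal UNIV" for l
      using p_ge_2[where 'p='p] unfolding normx_def
      by (intro var_ideal_minus) (auto simp: var_ideal_iff kill_hom kill_var power_0_left)
    ultimately have "Idl\<^bsub>?R\<^esub> (set ?xs) \<subseteq> shift_inv \<inter> var_ideal UNIV"
      by (intro inv_ring.genideal_minimal) auto
    then show ?thesis using one_notin_var_ideal shift_inv_closed(5) by blast
  qed
  ultimately show ?thesis
    using carr by (auto simp: regular_sequence_def inv_ring_simps)
qed


section \<open>Upper bounds for the depth\<close>

context localized_domain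
begin

text \<open>Lets the cocycle condition for the minors be checked in S and then used in the
  localization.\<close>

lemma koszul_diff_frac:
  assumes f: "range f \<subseteq> carrier R"
  shows "range w \<subseteq> carrier R \<Longrightarrow>
    koszul_diff L (\<lambda>i. frac (f i) \<one>) l (\<lambda>l. frac (w l) \<one>) = frac (koszul_diff R f l w) \<one>"
proof (induction l arbitrary: w)
  case (Cons j l)
  interpret koszul R f by unfold_locales (use f in auto)
  have r: "range (\<lambda>l'. w (j # l')) \<subseteq> carrier R" using Cons.prems by auto
  have "w l \<in> carrier R" "koszul_diff R f l (\<lambda>l'. w (j # l')) \<in> carrier R"
    using Cons.prems diff_closed[OF r] by auto
  then show ?case using Cons.IH[OF r] by (simp add: L_mult L_minus)
qed (simp add: L_zero)

lemma genideal_empty_L: "Idl\<^bsub>L\<^esub> {} = {\<zero>\<^bsub>L\<^esub>}"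
proof -
  interpret L: cring L by (rule cring_L)
  have "Idl\<^bsub>L\<^esub> {} \<subseteq> {\<zero>\<^bsub>L\<^esub>}" by (rule L.genideal_minimal[OF L.zeroideal]) simp
  moreover have "\<zero>\<^bsub>L\<^esub> \<in> Idl\<^bsub>L\<^esub> {}"
    by (intro additive_subgroup.zero_closed ideal.axioms(1) L.genideal_ideal) simp
  ultimately show ?thesis by blast
qed

end

section \<open>The cocycle of minors, and parameters for the irrelevant ideal\<close>

definition y_vars :: "('d \<times> 2) set" where
  "y_vars = range (\<lambda>i. (i, 2))"

definition minor :: "'d \<Rightarrow> 'd \<Rightarrow> ('d::finite, 'k::field) poly_ring" where
  "minor i j = xv i * yv j - xv j * yv i"

lemma minor_shift_inv [simp]: "minor i j \<in> shift_inv"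
  by (simp add: minor_def shift_inv_def shift_hom algebra_simps)

text \<open>The left side is, up to sign, the expansion of a determinant with rows y, x, y.\<close>

lemma minor_relation: "yv i * minor j l - (yv j * minor i l - yv l * minor i j) = 0"
  by (simp add: minor_def algebra_simps)

lemma primeideal_var_ideal: "primeideal (shift_inv \<inter> var_ideal W) inv_ring"
proof (rule primeidealI)
  show "ideal (shift_inv \<inter> var_ideal W) inv_ring"
    by (rule inv_ring_idealI) (auto simp: shift_inv_closed var_ideal_add var_ideal_mult)
  show "cring inv_ring" by (rule inv_ring.cring_axioms)
  show "carrier inv_ring \<noteq> shift_inv \<inter> var_ideal W"
    using one_notin_var_ideal shift_inv_closed(5) by (auto simp: inv_ring_simps)
qed (auto simp: inv_ring_simps var_ideal_prime)

lemma irrelevant_ideal_inv_ring: "irrelevant_ideal inv_ring = shift_inv \<inter> var_ideal UNIV"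
proof -
  have "0 < total_degree m \<longleftrightarrow> (\<exists>v. 0 < Poly_Mapping.lookup m v)" for m :: "'v \<Rightarrow>\<^sub>0 nat"
  proof -
    have "total_degree m = 0 \<longleftrightarrow> (\<forall>v. Poly_Mapping.lookup m v = 0)"
      by (auto simp: total_degree_def in_keys_iff)
    then show ?thesis by auto
  qed
  then show ?thesis by (auto simp: irrelevant_ideal_def inv_ring_simps var_ideal_def)
qed

text \<open>A homogeneous system of parameters of S, indexed by the variables: the norm in place of
  each \<open>xv i\<close>, which is not invariant itself.\<close>

definition param :: "'d \<times> 2 \<Rightarrow> ('d::finite, 'p::prime_card mod_ring) poly_ring" where
  "param v = (if snd v = 1 then normx (fst v) else yv (fst v))"

lemma param_shift_inv [simp]: "param v \<in> shift_inv"
  by (simp add: param_def)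

lemma sum_vars: "(\<Sum>v\<in>UNIV. h v) = (\<Sum>i\<in>UNIV. h (i, 1) + h (i, 2))"
  for h :: "'d::finite \<times> 2 \<Rightarrow> 'a::comm_monoid_add"
proof -
  have "(\<Sum>v\<in>UNIV. h v) = (\<Sum>i\<in>UNIV. \<Sum>j\<in>UNIV. h (i, j))"
    unfolding UNIV_Times_UNIV[symmetric] by (simp add: sum.cartesian_product)
  then show ?thesis by (simp add: sum_2)
qed

lemma ex_distinct: "2 \<le> CARD('d::finite) \<Longrightarrow> \<exists>i j :: 'd. i \<noteq> j"
  using card_le_Suc0_iff_eq[of "UNIV :: 'd set"] by fastforce

text \<open>One p-th power, by Frobenius, replaces the variables by their p-th powers, which lie in
  the ideal of T generated by the parameters. A second one makes the coefficients invariant.\<close>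

lemma irrelevant_power_in_genideal:
  fixes x :: "('d::finite, 'p::prime_card mod_ring) poly_ring"
  assumes "x \<in> irrelevant_ideal inv_ring"
  shows "x ^ (CARD('p) * CARD('p)) \<in> Idl\<^bsub>inv_ring\<^esub> (range param)"
proof -
  have x: "x \<in> shift_inv" "x \<in> var_ideal UNIV" using assms by (auto simp: irrelevant_ideal_inv_ring)
  from x(2) obtain g where g: "x = (\<Sum>v\<in>UNIV. poly_var v * g v)" by (rule var_idealE)
  define h where "h v = g v ^ CARD('p)" for v
  \<comment> \<open>Substituting \<open>xv i ^ p = normx i + xv i * yv i ^ (p - 1)\<close> leaves
    \<open>h (i, 1)\<close> as the coefficient of the norm and a multiple of \<open>yv i\<close>;
    one factor \<open>yv i\<close> is split off from that multiple and from
    \<open>yv i ^ p\<close>.\<close>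
  define t where "t v = (if snd v = 1 then h v else yv (fst v) ^ (CARD('p) - 1) * h v
      + xv (fst v) * yv (fst v) ^ (CARD('p) - 2) * h (fst v, 1))" for v
  have p: "CARD('p) - 1 = Suc (CARD('p) - 2)" "CARD('p) = Suc (CARD('p) - 1)"
    using p_ge_2[where 'p='p] by simp_all
  have "xv i ^ CARD('p) * h (i, 1) + yv i ^ CARD('p) * h (i, 2) = param (i, 1) * t (i, 1) + param (i, 2) * t (i, 2)" for i
  proof -
    have "yv i ^ CARD('p) = yv i * (yv i ^ (CARD('p) - 1) :: ('d, 'p mod_ring) poly_ring)"
      by (simp flip: power_Suc)
    moreover have "yv i ^ (CARD('p) - 1) = yv i * (yv i ^ (CARD('p) - 2) :: ('d, 'p mod_ring) poly_ring)"
      by (metis p(1) power_Suc)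
    ultimately show ?thesis
      by (simp add: param_def t_def normx_def algebra_simps)
  qed
  then have "x ^ CARD('p) = (\<Sum>v\<in>UNIV. param v * t v)"
    by (simp add: g frobenius_sum frobenius_add power_mult_distrib sum_vars h_def)
  moreover have "x ^ CARD('p) \<in> shift_inv" by (rule shift_inv_closed(7)[OF x(1)])
  ultimately have "(x ^ CARD('p)) ^ CARD('p) \<in> Idl\<^bsub>inv_ring\<^esub> (range param)"
    by (intro power_in_genideal[of param _ t]) simp_all
  then show ?thesis by (simp add: power_mult)
qed

lemma remainders_id:
  fixes f :: "('d::finite, 'p::prime_card mod_ring) poly_ring"
  shows "(\<And>i. i \<in> set is \<Longrightarrow> xdeg_le i (CARD('p) - 1) f) \<Longrightarrow> remainders is f = f"
  by (induction "is") (simp_all add: remainder_id)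

text \<open>A minor has degree at most 1 in every \<open>xv l\<close>, and 1 is at most
  \<open>p - 1\<close>.\<close>

lemma remainders_minor: "remainders is (minor i j) = (minor i j :: ('d::finite, 'p::prime_card mod_ring) poly_ring)"
proof (rule remainders_id)
  fix l
  have "xdeg_le l (1 + 0) (xv a * yv b :: ('d, 'p mod_ring) poly_ring)" for a b
    unfolding xdeg_le_def by (rule deg_le_mult) (simp_all add: deg_le_var)
  then have "xdeg_le l (1 + 0) (minor i j :: ('d, 'p mod_ring) poly_ring)"
    unfolding minor_def xdeg_le_def by (intro deg_le_minus)
  then show "xdeg_le l (CARD('p) - 1) (minor i j :: ('d, 'p mod_ring) poly_ring)"
    unfolding xdeg_le_def using p_ge_2[where 'p='p] by (elim deg_le_mono) linarith
qed

text \<open>Length at least \<open>d + 3\<close> gives vanishing in all degrees up to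
  \<open>d + 2\<close>. Dividing out the d norms, which begin a known regular sequence, leaves
  vanishing in degree 2, where the minors live.\<close>

lemma regular_sequence_length_le:
  fixes xs :: "('d::finite, 'p::prime_card mod_ring) poly_ring list"
  assumes reg: "regular_sequence inv_ring xs" and xs: "set xs \<subseteq> irrelevant_ideal inv_ring"
    and d: "2 \<le> CARD('d)"
  shows "length xs \<le> CARD('d) + 2"
proof (rule ccontr)
  assume len: "\<not> length xs \<le> CARD('d) + 2"
  let ?R = "inv_ring :: ('d, 'p mod_ring) poly_ring ring"
  obtain i j :: 'd where ij: "i \<noteq> j" using ex_distinct[OF d] by blast
  obtain "is" :: "'d list" where is_: "set is = UNIV" "distinct is"
    using finite_distinct_list[of "UNIV :: 'd set"] by auto
  have len_is: "length is = CARD('d)" using is_ distinct_card by force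
  interpret K: koszul ?R param by unfold_locales (simp add: inv_ring_simps)
  define I where "I = Idl\<^bsub>?R\<^esub> (range normx)"
  have I: "ideal I ?R" unfolding I_def by (rule inv_ring.genideal_ideal) auto
  have "koszul_exact ?R param (Idl\<^bsub>?R\<^esub> {}) n" if "n < length xs" for n
  proof -
    have "\<exists>k::nat. x [^]\<^bsub>?R\<^esub> k \<in> Idl\<^bsub>?R\<^esub> (range param)" if "x \<in> set xs" for x
      using irrelevant_power_in_genideal xs that by (intro exI[of _ "CARD('p) * CARD('p)"]) (auto simp: inv_ring_pow)
    from K.exact_of_regular_sequence[OF reg this, of 0 n] show ?thesis using that by simp
  qed
  from K.exact_quotient_regular[OF regular_sequence_normx_yv[OF ij is_(2,1)] this, where n = 2 and j = "CARD('d)"]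
  have exact: "koszul_exact ?R param I 2"
    using len by (simp add: len_is is_ I_def)
  \<comment> \<open>The Koszul generators now include the norms, so the minors are extended by zero
    to pairs of indices that involve a norm.\<close>
  define z where "z l = (case l of [u, v] \<Rightarrow> if snd u = 2 \<and> snd v = 2 then minor (fst u) (fst v) else 0
      | _ \<Rightarrow> (0 :: ('d, 'p mod_ring) poly_ring))"
    for l :: "('d \<times> 2) list"
  have z_inv: "z l \<in> shift_inv" for l by (auto simp: z_def shift_inv_closed split: list.splits)
  have N: "normx l * f \<in> I" if "f \<in> shift_inv" for l f
  proof -
    have "normx l \<in> I" unfolding I_def using inv_ring.genideal_self[of "range (normx :: 'd \<Rightarrow> ('d, 'p mod_ring) poly_ring)"]
      by (simp add: image_subset_iff)
    then show ?thesis using inv_ring_ideal(4)[OF I that] by (metis mult.commute)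
  qed
  have "koszul_diff ?R param l z \<in> I" if "length l = 3" for l
  proof -
    from that obtain a b c where l: "l = [a, b, c]" by (auto simp: length_Suc_conv numeral_3_eq_3)
    have eq: "koszul_diff ?R param l z = param a * z [b, c] - (param b * z [a, c] - param c * z [a, b])"
      by (simp add: l inv_ring_simps inv_ring_a_minus z_inv shift_inv_closed)
    show ?thesis
    proof (cases "snd a = 2 \<and> snd b = 2 \<and> snd c = 2")
      case True
      then have "koszul_diff ?R param l z = 0"
        unfolding eq by (simp add: z_def param_def minor_relation)
      then show ?thesis using inv_ring_ideal(2)[OF I] by simp
    next
      case False
      \<comment> \<open>Either the factor in front is a norm and the term lies in \<open>I\<close>,
        or a norm occurs among the arguments of \<open>z\<close> and the term is zero.\<close>
      have terms: "param u * z [v, w] \<in> I" if "\<not> (snd u = 2 \<and> snd v = 2 \<and> snd w = 2)" for u v w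
      proof (cases "snd u = 1")
        case True
        then show ?thesis using N z_inv by (simp add: param_def)
      next
        case False
        then have "z [v, w] = 0" using that exhaust_2[of "snd u"] by (auto simp: z_def)
        then show ?thesis using inv_ring_ideal(2)[OF I] by simp
      qed
      then show ?thesis using False unfolding eq by (intro inv_ring_ideal(5)[OF I] terms) auto
    qed
  qed
  then have "range z \<subseteq> carrier ?R \<and> (\<forall>l. length l = Suc 2 \<longrightarrow> koszul_diff ?R param l z \<in> I)"
    using z_inv by (auto simp: inv_ring_simps)
  from exact[unfolded koszul_exact_def, THEN spec, THEN mp, OF this]
  obtain w where w: "range w \<subseteq> carrier ?R"
    and zw: "\<And>l. length l = 2 \<Longrightarrow> z l \<ominus>\<^bsub>?R\<^esub> koszul_diff ?R param l w \<in> I" by blast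
  have w_inv: "w l \<in> shift_inv" for l using w by (auto simp: inv_ring_simps)
  \<comment> \<open>Taking remainders turns the congruence modulo the norms into an equation in T;
    it leaves the minor unchanged and keeps the coefficients invariant.\<close>
  define a where "a = remainders is (w [(i, 2)])"
  define b where "b = remainders is (w [(j, 2)])"
  have "minor i j - (yv i * w [(j, 2)] - yv j * w [(i, 2)]) \<in> I"
    using zw[of "[(i, 2), (j, 2)]"] w_inv
    by (simp add: inv_ring_simps inv_ring_a_minus shift_inv_closed z_def param_def)
  then have "remainders is (minor i j - (yv i * w [(j, 2)] - yv j * w [(i, 2)])) = 0"
    using genideal_normx[of "is", where 'p = 'p] by (simp add: is_ I_def)
  then have "minor i j = yv i * b - yv j * a"
    by (simp add: remainders_minus remainders_yv remainders_minor a_def b_def)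
  \<comment> \<open>This is the shape of \<open>cocycle_not_boundary\<close> with multiplier 1,
    which would put 1 into the ideal of the \<open>yv\<close>.\<close>
  then have "(1 * xv i + a) * yv j = (1 * xv j + b) * yv i"
    by (simp add: minor_def algebra_simps)
  moreover have "a \<in> shift_inv" unfolding a_def by (rule remainders_shift_inv[OF w_inv])
  ultimately have "(1 :: ('d, 'p mod_ring) poly_ring) \<in> var_ideal (range (\<lambda>i. (i, 2)))"
    using cocycle_not_boundary[OF shift_inv_closed(5) _ ij, of a b] by blast
  then show False using one_notin_var_ideal by blast
qed

text \<open>Elements of the maximal ideal have p-th powers in the ideal generated by the
  \<open>yv\<close>. Three of them in a regular sequence would therefore make the minors a
  coboundary over the localization, and clearing denominators would put a denominator into
  \<open>q\<close>.\<close>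

lemma local_regular_sequence_length_le:
  fixes xs
  defines "R \<equiv> (inv_ring :: ('d::finite, 'p::prime_card mod_ring) poly_ring ring)"
    and "q \<equiv> shift_inv \<inter> var_ideal y_vars"
  assumes reg: "regular_sequence (localization R q) xs" and xs: "set xs \<subseteq> localization_max_ideal R q"
    and d: "2 \<le> CARD('d)"
  shows "length xs \<le> 2"
proof (rule ccontr)
  assume len: "\<not> length xs \<le> 2"
  obtain i j :: 'd where ij: "i \<noteq> j" using ex_distinct[OF d] by blast
  interpret D: localized_domain R q
    unfolding R_def q_def localized_domain_def localized_domain_axioms_def
    by (simp add: domain_inv_ring primeideal_var_ideal)
  let ?L = "D.L"
  let ?y = "\<lambda>i :: 'd. D.frac (yv i) 1"
  have simps: "carrier R = shift_inv" "\<And>x y. x \<otimes>\<^bsub>R\<^esub> y = x * y" "\<And>x y. x \<oplus>\<^bsub>R\<^esub> y = x + y"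
    "\<one>\<^bsub>R\<^esub> = 1" "\<zero>\<^bsub>R\<^esub> = 0" by (simp_all add: R_def inv_ring_simps)
  have Rpow: "y [^]\<^bsub>R\<^esub> n = y ^ n" for y and n :: nat by (simp add: R_def inv_ring_pow)
  have Rminus: "x \<ominus>\<^bsub>R\<^esub> y = x - y" if "x \<in> shift_inv" "y \<in> shift_inv" for x y
    using that by (simp add: R_def inv_ring_a_minus)
  have one: "\<one>\<^bsub>R\<^esub> = 1" and carr: "carrier R = shift_inv" by (simp_all add: simps)
  interpret L: cring ?L by (rule D.cring_L)
  interpret K: koszul ?L ?y
    by unfold_locales (use D.frac_closed[of _ 1] D.one_denom in \<open>auto simp: simps\<close>)
  have y: "range (yv :: 'd \<Rightarrow> ('d, 'p mod_ring) poly_ring) \<subseteq> carrier R" by (auto simp: simps)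
  have pow: "\<exists>k::nat. x [^]\<^bsub>?L\<^esub> k \<in> Idl\<^bsub>?L\<^esub> (range ?y)" if "x \<in> set xs" for x
  proof -
    from that xs obtain a s where x: "x = D.frac a s" "a \<in> q" "s \<in> D.denoms"
      unfolding localization_max_ideal_def D.denoms_def by blast
    then have a: "a \<in> shift_inv" "a \<in> var_ideal y_vars" by (auto simp: q_def)
    from a(2) obtain g where "a = (\<Sum>v\<in>y_vars. poly_var v * g v)" by (rule var_idealE)
    then have "a = (\<Sum>i\<in>UNIV. yv i * g (i, 2))"
      by (simp add: y_vars_def sum.reindex inj_on_def)
    then have "a ^ CARD('p) \<in> Idl\<^bsub>R\<^esub> (range yv)"
      unfolding R_def using a by (intro power_in_genideal[of yv _ "\<lambda>i. g (i, 2)"]) simp_all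
    from D.frac_in_genideal[OF y this D.denom_pow[OF x(3)], of "CARD('p)"]
    have "x [^]\<^bsub>?L\<^esub> CARD('p) \<in> Idl\<^bsub>?L\<^esub> (range ?y)"
      using a x by (simp add: D.L_pow carr one Rpow)
    then show ?thesis by blast
  qed
  have exact: "koszul_exact ?L ?y {\<zero>\<^bsub>?L\<^esub>} 2"
    using K.exact_of_regular_sequence[OF reg[folded D.L_def] pow, of 0 2] len by (simp add: D.genideal_empty_L)
  define z where "z l = (case l of [u, v] \<Rightarrow> minor u v | _ \<Rightarrow> (0 :: ('d, 'p mod_ring) poly_ring))" for l :: "'d list"
  have z_inv: "z l \<in> shift_inv" for l by (auto simp: z_def shift_inv_closed split: list.splits)
  have z: "range z \<subseteq> carrier R" using z_inv by (auto simp: simps)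
  have zL: "range (\<lambda>l. D.frac (z l) 1) \<subseteq> carrier ?L"
    using z_inv D.frac_closed[of _ 1] D.one_denom by (auto simp: simps)
  have "koszul_diff R yv l z = 0" if "length l = 3" for l
  proof -
    from that obtain a b c where l: "l = [a, b, c]" by (auto simp: length_Suc_conv numeral_3_eq_3)
    have "koszul_diff R yv l z = yv a * z [b, c] - (yv b * z [a, c] - yv c * z [a, b])"
      unfolding R_def by (simp add: l inv_ring_simps inv_ring_a_minus z_inv shift_inv_closed)
    then show ?thesis by (simp add: z_def minor_relation)
  qed
  then have "koszul_diff ?L ?y l (\<lambda>l. D.frac (z l) 1) \<in> {\<zero>\<^bsub>?L\<^esub>}" if "length l = Suc 2" for l
    using D.koszul_diff_frac[OF y z, of l] that D.L_zero by (simp add: simps)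
  with exact zL obtain w where w: "range w \<subseteq> carrier ?L"
    and zw: "\<And>l. length l = 2 \<Longrightarrow> D.frac (z l) 1 \<ominus>\<^bsub>?L\<^esub> koszul_diff ?L ?y l w \<in> {\<zero>\<^bsub>?L\<^esub>}"
    unfolding koszul_exact_def by metis
  \<comment> \<open>One pair of indices is enough for the contradiction, so only two values of
    \<open>w\<close> receive explicit fractions.\<close>
  have "w [i] \<in> carrier ?L" "w [j] \<in> carrier ?L" using w by auto
  then obtain b s c t where wi: "w [i] = D.frac b s" "b \<in> carrier R" "s \<in> D.denoms"
    and wj: "w [j] = D.frac c t" "c \<in> carrier R" "t \<in> D.denoms"
    by (metis D.L_cases)
  have inv: "b \<in> shift_inv" "c \<in> shift_inv" "s \<in> shift_inv" "t \<in> shift_inv"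
    using wi wj D.denom_closed by (auto simp: carr)
  have eq: "D.frac (minor i j) \<one>\<^bsub>R\<^esub> \<ominus>\<^bsub>?L\<^esub> (D.frac (yv i) \<one>\<^bsub>R\<^esub> \<otimes>\<^bsub>?L\<^esub> D.frac c t \<ominus>\<^bsub>?L\<^esub>
      (D.frac (yv j) \<one>\<^bsub>R\<^esub> \<otimes>\<^bsub>?L\<^esub> D.frac b s \<ominus>\<^bsub>?L\<^esub> D.frac \<zero>\<^bsub>R\<^esub> \<one>\<^bsub>R\<^esub>)) = D.frac \<zero>\<^bsub>R\<^esub> \<one>\<^bsub>R\<^esub>"
    using zw[of "[i, j]"] by (simp add: z_def wi(1) wj(1) D.L_zero one)
  have den: "s * t \<in> D.denoms" "t * s \<in> D.denoms" "1 \<in> D.denoms"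
    using D.denom_mult[OF wi(3) wj(3)] D.denom_mult[OF wj(3) wi(3)] D.one_denom by (simp_all add: simps)
  have mult: "D.frac (yv l) 1 \<otimes>\<^bsub>?L\<^esub> D.frac e u = D.frac (yv l * e) u"
    if "e \<in> shift_inv" "u \<in> D.denoms" for l e u
    using D.L_mult[of "yv l" 1 e u] that den by (simp add: simps)
  have minus: "D.frac e u \<ominus>\<^bsub>?L\<^esub> D.frac e' u' = D.frac (e * u' - e' * u) (u * u')"
    if "e \<in> shift_inv" "u \<in> D.denoms" "e' \<in> shift_inv" "u' \<in> D.denoms" for e u e' u'
    using D.L_minus[of e u e' u'] that D.denom_closed[of u] D.denom_closed[of u']
    by (simp add: simps shift_inv_closed Rminus)
  have "D.frac (minor i j * (t * s) - (yv i * c * s - yv j * b * t)) (t * s) = D.frac 0 1"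
    using eq wi(3) wj(3) inv den by (simp add: one mult minus simps(5) shift_inv_closed)
  then have "minor i j * (t * s) - (yv i * c * s - yv j * b * t) = 0"
    using D.fraction_eq_iff[of "minor i j * (t * s) - (yv i * c * s - yv j * b * t)" "t * s" 0 1] den inv
    by (simp add: simps shift_inv_closed)
  \<comment> \<open>The common denominator \<open>s * t\<close> takes the part of the invariant
    multiplier in \<open>cocycle_not_boundary\<close>.\<close>
  then have "(s * t * xv i + b * t) * yv j = (s * t * xv j + c * s) * yv i"
    by (simp add: minor_def algebra_simps)
  then have "s * t \<in> var_ideal y_vars" unfolding y_vars_def
    by (intro cocycle_not_boundary[OF _ _ ij, where a = "b * t" and b = "c * s"] shift_inv_closed inv)
  then have "s * t \<in> q" using inv by (simp add: q_def shift_inv_closed)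
  moreover have "s * t \<in> D.denoms" using D.denom_mult[OF wi(3) wj(3)] by (simp add: simps)
  ultimately show False by (simp add: D.denoms_def)
qed


section \<open>Dimension\<close>

text \<open>Separates the contracted primes: \<open>xv i\<close> is not in S, but its norm detects
  whether it lies in \<open>W\<close>. Killing \<open>yv i\<close> alone leaves the nonzero power
  \<open>xv i ^ p\<close>.\<close>

lemma param_in_var_ideal_iff:
  "(param v :: ('d::finite, 'p::prime_card mod_ring) poly_ring) \<in> var_ideal W \<longleftrightarrow> v \<in> W"
proof (cases "snd v = 1")
  case True
  then obtain i where v: "v = (i, 1)" by (cases v) auto
  have "kill W (normx i) = (if (i, 1) \<in> W then 0 else if (i, 2) \<in> W then xv i ^ CARD('p)
      else (normx i :: ('d, 'p mod_ring) poly_ring))"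
    using p_ge_2[where 'p='p] by (simp add: normx_def kill_hom kill_var power_0_left)
  then show ?thesis
    using poly_ring_power_eq_0[of "xv i :: ('d, 'p mod_ring) poly_ring" "CARD('p)"]
    by (auto simp: v param_def var_ideal_iff)
next
  case False
  then have "snd v = 2" using exhaust_2[of "snd v"] by auto
  then show ?thesis by (cases v) (simp add: param_def)
qed

text \<open>Contracting a flag of coordinate ideals keeps the inclusions strict, because the
  parameter of each newly added variable is invariant.\<close>

lemma prime_chain_var_ideals:
  fixes vs :: "('d::finite \<times> 2) list"
  assumes vs: "distinct vs"
  defines "Q \<equiv> \<lambda>k. shift_inv \<inter> var_ideal (set (take k vs)) :: ('d, 'p::prime_card mod_ring) poly_ring set"
  shows "prime_chain inv_ring (map Q [0..<Suc (length vs)])"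
proof -
  have "Q k \<subset> Q l" if "k < l" "l \<le> length vs" for k l
  proof
    have "set (take k vs) \<subseteq> set (take l vs)"
      using that by (intro set_take_subset_set_take) simp
    then show "Q k \<subseteq> Q l" unfolding Q_def using var_ideal_mono by blast
    have "vs ! k \<notin> set (take k vs)"
      using nth_notin_set_take[OF vs, of k] that by simp
    moreover have "vs ! k \<in> set (take l vs)"
      using that by (auto simp: in_set_conv_nth intro!: exI[of _ k])
    ultimately have "param (vs ! k) \<notin> Q k" "param (vs ! k) \<in> Q l"
      by (simp_all add: Q_def param_in_var_ideal_iff)
    then show "Q k \<noteq> Q l" by blast
  qed
  then have "sorted_wrt (\<subset>) (map Q [0..<Suc (length vs)])"
    unfolding sorted_wrt_map
    by (intro sorted_wrt_mono_rel[OF _ sorted_wrt_upt]) (simp add: less_Suc_eq_le del: upt_Suc)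
  then show ?thesis by (auto simp: prime_chain_def Q_def primeideal_var_ideal)
qed

section \<open>Counting polynomials and bounding chains of primes\<close>

lemma finite_deg_le:
  defines "B \<equiv> \<lambda>M. {f :: ('d::finite, 'p::prime_card mod_ring) poly_ring. deg_le (\<lambda>_. 1) M f}"
  shows "finite (B M)" and "card (B M) \<le> CARD('p) ^ (Suc M ^ CARD('d \<times> 2))"
proof -
  \<comment> \<open>The simplex of monomials of total degree at most \<open>M\<close> is enlarged to
    a cube, which has the same order of growth in \<open>M\<close>.\<close>
  define E where "E = {m :: ('d \<times> 2) \<Rightarrow>\<^sub>0 nat. \<forall>v. Poly_Mapping.lookup m v \<le> M}"
  have inj: "inj_on Poly_Mapping.lookup E" by (simp add: inj_on_def poly_mapping.lookup_inject)
  have sub: "Poly_Mapping.lookup ` E \<subseteq> UNIV \<rightarrow>\<^sub>E {..M}" by (auto simp: E_def)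
  have fin: "finite (UNIV \<rightarrow>\<^sub>E {..M} :: ('d \<times> 2 \<Rightarrow> nat) set)" by (intro finite_PiE) auto
  have E: "finite E" using inj_on_finite[OF inj sub fin] .
  have cardE: "card E \<le> Suc M ^ CARD('d \<times> 2)"
    using card_inj_on_le[OF inj sub fin] by (simp add: card_funcsetE)
  have keys: "Poly_Mapping.keys f \<subseteq> E" if "f \<in> B M" for f
  proof
    fix m assume m: "m \<in> Poly_Mapping.keys f"
    have "Poly_Mapping.lookup m v \<le> M" for v
    proof -
      have "Poly_Mapping.lookup m v \<le> (\<Sum>v\<in>UNIV. Poly_Mapping.lookup m v)"
        by (intro member_le_sum) auto
      also have "\<dots> \<le> M" using that m by (auto simp: B_def deg_le_def)
      finally show ?thesis .
    qed
    then show "m \<in> E" by (simp add: E_def)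
  qed
  define F where "F f = restrict (Poly_Mapping.lookup f) E" for f :: "('d, 'p mod_ring) poly_ring"
  have injF: "inj_on F (B M)"
  proof (rule inj_onI, rule poly_mapping_eqI)
    fix f g m assume fg: "f \<in> B M" "g \<in> B M" "F f = F g"
    show "Poly_Mapping.lookup f m = Poly_Mapping.lookup g m"
    proof (cases "m \<in> E")
      case True
      then show ?thesis using fun_cong[OF fg(3), of m] by (simp add: F_def)
    next
      case False
      then show ?thesis using keys[OF fg(1)] keys[OF fg(2)] by (metis in_keys_iff subset_iff)
    qed
  qed
  have subF: "F ` B M \<subseteq> E \<rightarrow>\<^sub>E UNIV" by (auto simp: F_def)
  have finF: "finite (E \<rightarrow>\<^sub>E (UNIV :: 'p mod_ring set))" using E by (intro finite_PiE) auto
  show "finite (B M)" using inj_on_finite[OF injF subF finF] .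
  have "card (B M) \<le> CARD('p) ^ card E"
    using card_inj_on_le[OF injF subF finF] E by (simp add: card_funcsetE)
  also have "\<dots> \<le> CARD('p) ^ (Suc M ^ CARD('d \<times> 2))"
    using cardE p_ge_2[where 'p='p] by (intro power_increasing) auto
  finally show "card (B M) \<le> CARD('p) ^ (Suc M ^ CARD('d \<times> 2))" .
qed

text \<open>In Horner form two values differ, modulo \<open>x\<close>, by the difference of the
  heads, so coefficients can be compared from the front of the list.\<close>

primrec horner_list :: "'a::comm_ring_1 \<Rightarrow> 'a list \<Rightarrow> 'a" where
  "horner_list x [] = 0"
| "horner_list x (w # ws) = w + x * horner_list x ws"

lemma ex_deg_le: "\<exists>n. deg_le w n f"
proof -
  have "deg_le w (\<Sum>m\<in>Poly_Mapping.keys f. \<Sum>v\<in>UNIV. w v * Poly_Mapping.lookup m v) f"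
    unfolding deg_le_def by (auto intro!: member_le_sum)
  then show ?thesis by blast
qed

text \<open>Let \<open>x\<close> lie in the second prime but not in the first. Distinct polynomials in \<open>x\<close> of degree less
  than \<open>m\<close> with coefficients that are incongruent modulo the second prime are incongruent modulo the
  first one. So every step of a chain raises the order of growth by one.\<close>

lemma many_incongruent_elements:
  fixes qs :: "('d::finite, 'p::prime_card mod_ring) poly_ring set list"
  assumes "prime_chain inv_ring (q # qs)"
  shows "\<exists>C. \<forall>m. \<exists>W. finite W \<and> W \<subseteq> shift_inv \<and> (\<forall>w\<in>W. deg_le (\<lambda>_. 1) (C * m) w) \<and>
    (\<forall>v\<in>W. \<forall>w\<in>W. v - w \<in> q \<longrightarrow> v = w) \<and> 2 ^ (m ^ length qs) \<le> card W"
  using assms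
proof (induction qs arbitrary: q)
  case Nil
  then have q: "primeideal q inv_ring" by (simp add: prime_chain_def)
  then have id: "ideal q inv_ring" by (simp add: primeideal.axioms(1))
  have one: "1 \<notin> q"
    using ideal.one_imp_carrier[OF id] primeideal.I_notcarr[OF q] by (auto simp: inv_ring_simps)
  moreover have "- 1 \<notin> q"
    using inv_ring_ideal(4)[OF id shift_inv_closed(6)[OF shift_inv_closed(5)], of "- 1"] one by auto
  \<comment> \<open>For a single prime \<open>m ^ 0 = 1\<close>, so the two elements 0 and 1, which
    have degree 0, are enough.\<close>
  ultimately show ?case
    by (intro exI[of _ 0] allI exI[of _ "{0, 1}"]) (auto simp: shift_inv_closed)
next
  case (Cons q' qs)
  then have q: "primeideal q inv_ring" "primeideal q' inv_ring" "q \<subset> q'" and chain: "prime_chain inv_ring (q' # qs)"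
    by (auto simp: prime_chain_def)
  then have id: "ideal q inv_ring" "ideal q' inv_ring" by (simp_all add: primeideal.axioms(1))
  from q(3) obtain x where x: "x \<in> q'" "x \<notin> q" by blast
  then have x_inv: "x \<in> shift_inv" using inv_ring_ideal(1)[OF id(2)] by blast
  obtain e where e: "deg_le (\<lambda>_. 1) e x" using ex_deg_le by blast
  obtain C where C: "\<And>m. \<exists>W. finite W \<and> W \<subseteq> shift_inv \<and> (\<forall>w\<in>W. deg_le (\<lambda>_. 1) (C * m) w) \<and>
    (\<forall>v\<in>W. \<forall>w\<in>W. v - w \<in> q' \<longrightarrow> v = w) \<and> 2 ^ (m ^ length qs) \<le> card W"
    using Cons.IH[OF chain] by blast
  have "\<exists>W. finite W \<and> W \<subseteq> shift_inv \<and> (\<forall>w\<in>W. deg_le (\<lambda>_. 1) ((C + e) * m) w) \<and>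
    (\<forall>v\<in>W. \<forall>w\<in>W. v - w \<in> q \<longrightarrow> v = w) \<and> 2 ^ (m ^ length (q' # qs)) \<le> card W" for m
  proof -
    obtain W where W: "finite W" "W \<subseteq> shift_inv" "\<forall>w\<in>W. deg_le (\<lambda>_. 1) (C * m) w"
      "\<forall>v\<in>W. \<forall>w\<in>W. v - w \<in> q' \<longrightarrow> v = w" "2 ^ (m ^ length qs) \<le> card W"
      using C[of m] by (elim exE conjE) (rule that)
    define T where "T = {ws. set ws \<subseteq> W \<and> length ws = m}"
    have inv: "horner_list x ws \<in> shift_inv" if "set ws \<subseteq> W" for ws
      using that W(2) x_inv by (induction ws) (auto simp: shift_inv_closed)
    have deg: "deg_le (\<lambda>_. 1) (C * m + e * length ws) (horner_list x ws)" if "set ws \<subseteq> W" for ws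
      using that
    proof (induction ws)
      case (Cons w ws)
      have "deg_le (\<lambda>_. 1) (e + (C * m + e * length ws)) (x * horner_list x ws)"
        using e Cons by (intro deg_le_mult) auto
      then have "deg_le (\<lambda>_. 1) (C * m + e * length (w # ws)) (x * horner_list x ws)"
        by (rule deg_le_mono) simp
      moreover have "deg_le (\<lambda>_. 1) (C * m + e * length (w # ws)) w"
        by (rule deg_le_mono[where n = "C * m"]) (use W(3) Cons.prems in simp_all)
      ultimately show ?case by (simp add: deg_le_add)
    qed simp
    have cancel: "vs = ws"
      if "length vs = length ws" "set vs \<subseteq> W" "set ws \<subseteq> W" "horner_list x vs - horner_list x ws \<in> q" for vs ws
      using that
    proof (induction vs ws rule: list_induct2)
      case (Cons v vs w ws)
      let ?h = "horner_list x vs - horner_list x ws"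
      have h_inv: "?h \<in> shift_inv" using Cons.prems by (intro shift_inv_closed(2) inv) auto
      have eq: "(v - w) + x * ?h \<in> q" using Cons.prems(3) by (simp add: algebra_simps)
      have xh: "x * ?h \<in> q'" using inv_ring_ideal(4)[OF id(2) h_inv x(1)] by (simp add: mult.commute)
      \<comment> \<open>The larger prime contains both \<open>q\<close> and \<open>x\<close>, so
        modulo it only the difference of the constant terms survives.\<close>
      have "((v - w) + x * ?h) - x * ?h \<in> q'"
        using eq q(3) xh by (intro inv_ring_ideal(5)[OF id(2)]) auto
      then have "v = w" using W(4) Cons.prems by simp
      \<comment> \<open>With equal constant terms the rest is a multiple of \<open>x\<close>, and
        \<open>x\<close> can be cancelled modulo the smaller prime, which does not contain
        it.\<close>
      then have "x * ?h \<in> q" using eq by simp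
      then have "?h \<in> q"
        using primeideal.I_prime[OF q(1), of x ?h] x x_inv h_inv by (simp add: inv_ring_simps)
      then show ?case using Cons.IH Cons.prems \<open>v = w\<close> by simp
    qed simp
    have inj: "inj_on (horner_list x) T"
      using inv_ring_ideal(2)[OF id(1)] by (auto simp: inj_on_def T_def intro!: cancel)
    \<comment> \<open>Choosing \<open>m\<close> coefficients independently raises the count to its
      \<open>m\<close>-th power, which multiplies the exponent \<open>m ^ length qs\<close> by
      \<open>m\<close>.\<close>
    have "2 ^ (m ^ length (q' # qs)) = ((2 :: nat) ^ (m ^ length qs)) ^ m"
      by (simp add: mult.commute[of m] flip: power_mult)
    also have "\<dots> \<le> card W ^ m" using W(5) by (rule power_mono) simp
    also have "\<dots> = card (horner_list x ` T)"
      using card_image[OF inj] by (simp add: T_def card_lists_length_eq[OF W(1)])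
    finally have "2 ^ (m ^ length (q' # qs)) \<le> card (horner_list x ` T)" .
    moreover have "finite (horner_list x ` T)"
      unfolding T_def by (intro finite_imageI finite_lists_length_eq W(1))
    moreover have "deg_le (\<lambda>_. 1) ((C + e) * m) w" if "w \<in> horner_list x ` T" for w
      using that deg by (auto simp: T_def distrib_right)
    moreover have "horner_list x ` T \<subseteq> shift_inv" using inv by (auto simp: T_def)
    moreover have "v = w" if vw: "v \<in> horner_list x ` T" "w \<in> horner_list x ` T" "v - w \<in> q" for v w
    proof -
      from vw(1,2) obtain vs ws where "v = horner_list x vs" "w = horner_list x ws" "vs \<in> T" "ws \<in> T"
        by blast
      then show ?thesis using cancel[of vs ws] vw(3) by (simp add: T_def)
    qed
    ultimately show ?thesis by (intro exI[of _ "horner_list x ` T"] conjI ballI impI)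
  qed
  then show ?case by blast
qed

lemma prime_chain_length_le:
  fixes qs :: "('d::finite, 'p::prime_card mod_ring) poly_ring set list"
  assumes "prime_chain inv_ring qs" "length qs = Suc n"
  shows "n \<le> CARD('d \<times> 2)"
proof (rule ccontr)
  assume n: "\<not> n \<le> CARD('d \<times> 2)"
  let ?D = "CARD('d \<times> 2)" and ?p = "CARD('p)"
  obtain q qs' where qs: "qs = q # qs'" "length qs' = n" using assms(2) by (cases qs) auto
  obtain C where C: "\<And>m. \<exists>W :: ('d, 'p mod_ring) poly_ring set. finite W \<and> W \<subseteq> shift_inv \<and>
      (\<forall>w\<in>W. deg_le (\<lambda>_. 1) (C * m) w) \<and> (\<forall>v\<in>W. \<forall>w\<in>W. v - w \<in> q \<longrightarrow> v = w) \<and> 2 ^ (m ^ n) \<le> card W"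
    using many_incongruent_elements[of q qs'] assms(1) qs by blast
  \<comment> \<open>Comparing the two counts bounds \<open>m ^ n\<close> by
    \<open>p * (C + 1) ^ D * m ^ D\<close>, where \<open>D\<close> is the number of variables. This
    \<open>m\<close> exceeds \<open>p * (C + 1) ^ D\<close>, which is impossible for
    \<open>n > D\<close>. It is also positive, so that \<open>C * m + 1\<close> is at most
    \<open>(C + 1) * m\<close>.\<close>
  define m where "m = Suc (?p * Suc C ^ ?D)"
  obtain W :: "('d, 'p mod_ring) poly_ring set" where W: "\<forall>w\<in>W. deg_le (\<lambda>_. 1) (C * m) w" "2 ^ (m ^ n) \<le> card W"
    using C[of m] by blast
  note W(2)
  also have "card W \<le> card {f :: ('d, 'p mod_ring) poly_ring. deg_le (\<lambda>_. 1) (C * m) f}"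
    using W(1) by (intro card_mono finite_deg_le(1)) auto
  also have "\<dots> \<le> ?p ^ (Suc (C * m) ^ ?D)" by (rule finite_deg_le(2))
  also have "\<dots> \<le> (2 ^ ?p) ^ (Suc (C * m) ^ ?D)"
    using less_exp[of ?p] by (intro power_mono) auto
  also have "\<dots> = 2 ^ (?p * Suc (C * m) ^ ?D)" by (simp add: power_mult)
  finally have "m ^ n \<le> ?p * Suc (C * m) ^ ?D" by simp
  also have "\<dots> \<le> ?p * (Suc C * m) ^ ?D"
    by (intro mult_left_mono power_mono) (auto simp: m_def)
  also have "\<dots> = (?p * Suc C ^ ?D) * m ^ ?D" by (simp only: power_mult_distrib mult.assoc)
  also have "\<dots> < m * m ^ ?D" by (simp add: m_def)
  also have "\<dots> = m ^ Suc ?D" by simp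
  also have "\<dots> \<le> m ^ n" using n by (intro power_increasing) (auto simp: m_def)
  finally show False by simp
qed

lemma krull_dim_inv_ring:
  "krull_dim (inv_ring :: ('d::finite, 'p::prime_card mod_ring) poly_ring ring) = enat (CARD('d \<times> 2))"
  unfolding krull_dim_def
proof (intro antisym Sup_least Sup_upper; safe)
  fix n and qs :: "('d, 'p mod_ring) poly_ring set list"
  assume "prime_chain inv_ring qs" "length qs = Suc n"
  then show "enat n \<le> enat (CARD('d \<times> 2))" using prime_chain_length_le by simp
next
  obtain vs :: "('d \<times> 2) list" where vs: "set vs = UNIV" "distinct vs"
    using finite_distinct_list[of "UNIV :: ('d \<times> 2) set"] by auto
  have "length vs = CARD('d \<times> 2)" using vs distinct_card by force
  then show "\<exists>n. enat (CARD('d \<times> 2)) = enat n \<and>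
      (\<exists>qs. prime_chain (inv_ring :: ('d, 'p mod_ring) poly_ring ring) qs \<and> length qs = Suc n)"
    using prime_chain_var_ideals[OF vs(2)]
    by (intro exI[of _ "CARD('d \<times> 2)"] conjI refl exI) auto
qed

lemma krull_dim_localization_y_vars:
  assumes d: "3 \<le> CARD('d::finite)"
  shows "3 \<le> krull_dim (localization inv_ring
    (shift_inv \<inter> var_ideal y_vars :: ('d, 'p::prime_card mod_ring) poly_ring set))"
proof -
  let ?q = "shift_inv \<inter> var_ideal y_vars :: ('d, 'p mod_ring) poly_ring set"
  obtain "is" :: "'d list" where is_: "set is = UNIV" "distinct is"
    using finite_distinct_list[of "UNIV :: 'd set"] by auto
  have len: "length is = CARD('d)" using is_ distinct_card by force
  \<comment> \<open>Three of the \<open>yv\<close> are available because \<open>d\<close> is at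
    least 3; the ideals of their initial segments contract to four primes inside
    \<open>?q\<close>.\<close>
  define vs where "vs = map (\<lambda>i. (i, 2 :: 2)) (take 3 is)"
  have vs: "distinct vs" "length vs = 3" "set vs \<subseteq> y_vars"
    using is_ d len by (auto simp: vs_def distinct_map inj_on_def y_vars_def)
  interpret localized_domain "inv_ring :: ('d, 'p mod_ring) poly_ring ring" ?q
    unfolding localized_domain_def localized_domain_axioms_def
    by (simp add: domain_inv_ring primeideal_var_ideal)
  have "shift_inv \<inter> var_ideal (set (take k vs)) \<subseteq> ?q" for k
    using var_ideal_mono[OF subset_trans[OF set_take_subset vs(3)]] by blast
  then have "enat 3 \<le> krull_dim (localization inv_ring ?q)"
    by (intro krull_dim_localization_ge[OF prime_chain_var_ideals[OF vs(1)]]) (auto simp: vs(2))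
  then show ?thesis by (simp add: numeral_eq_enat)
qed

theorem mainTheorem2:
  fixes d :: nat
    and S :: "('d::finite, 'p::prime_card mod_ring) poly_ring ring"
  assumes "d = CARD('d)" and "d \<ge> 3"
    and "S = invariant_ring diagonal_P"
  shows "\<not> cohen_macaulay S
       \<and> \<not> serre_condition 3 S
       \<and> depth S (irrelevant_ideal S) = enat (d + 2)
       \<and> krull_dim S = enat (2 * d)
       \<and> cm_defect S (irrelevant_ideal S) = enat (2 * d - (d + 2))
       \<and> 2 * d - (d + 2) = d - 2"
proof -
  have S: "S = inv_ring" using assms(3) by (simp add: inv_ring_def)
  \<comment> \<open>At this one prime the depth is at most 2 and the dimension at least 3, which
    refutes both the Serre condition and the Cohen-Macaulay property.\<close>
  define q where "q = (shift_inv \<inter> var_ideal y_vars :: ('d, 'p mod_ring) poly_ring set)"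
  have q: "primeideal q S" unfolding S q_def by (rule primeideal_var_ideal)
  have dim_q: "3 \<le> krull_dim (localization S q)"
    unfolding S q_def by (rule krull_dim_localization_y_vars) (use assms in simp)
  have "local_depth S q \<le> enat 2"
    unfolding local_depth_def depth_def
  proof (intro Sup_least, clarify)
    fix xs assume "regular_sequence (localization S q) xs" "set xs \<subseteq> localization_max_ideal S q"
    then have "length xs \<le> 2"
      unfolding S q_def by (rule local_regular_sequence_length_le) (use assms in simp)
    then show "enat (length xs) \<le> enat 2" by simp
  qed
  also have "\<dots> < 3" by (simp add: numeral_eq_enat)
  finally have depth_q: "local_depth S q < 3" .
  have serre: "\<not> serre_condition 3 S"
  proof
    assume "serre_condition 3 S"
    then have "min (enat 3) (krull_dim (localization S q)) \<le> local_depth S q"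
      using q by (simp add: serre_condition_def)
    then show False using dim_q depth_q by (simp add: numeral_eq_enat min_def split: if_splits)
  qed
  have cm: "\<not> cohen_macaulay S"
    using q dim_q depth_q by (auto simp: cohen_macaulay_def)
  have dim: "krull_dim S = enat (2 * d)"
    using assms(1) by (simp add: S krull_dim_inv_ring)
  have depth: "depth S (irrelevant_ideal S) = enat (d + 2)"
    unfolding depth_def
  proof (intro antisym Sup_least Sup_upper; safe)
    fix xs assume "regular_sequence S xs" "set xs \<subseteq> irrelevant_ideal S"
    then have "length xs \<le> CARD('d) + 2"
      unfolding S by (rule regular_sequence_length_le) (use assms in simp)
    then show "enat (length xs) \<le> enat (d + 2)" using assms(1) by simp
  next
    obtain "is" :: "'d list" where is_: "set is = UNIV" "distinct is"
      using finite_distinct_list[of "UNIV :: 'd set"] by auto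
    have len: "length is = d" using is_ distinct_card assms(1) by force
    have "2 \<le> CARD('d)" using assms by simp
    from ex_distinct[OF this] obtain i j :: 'd where ij: "i \<noteq> j" by blast
    let ?xs = "map normx is @ [yv i, yv j] :: ('d, 'p mod_ring) poly_ring list"
    have "regular_sequence S ?xs" unfolding S by (rule regular_sequence_normx_yv[OF ij is_(2,1)])
    moreover have "normx l \<in> (var_ideal UNIV :: ('d, 'p mod_ring) poly_ring set)" for l
      using param_in_var_ideal_iff[of "(l, 1)" UNIV, where 'p = 'p] by (simp add: param_def)
    then have "set ?xs \<subseteq> irrelevant_ideal S"
      by (auto simp: S irrelevant_ideal_inv_ring)
    moreover have "length ?xs = d + 2" using len by simp
    ultimately show "\<exists>xs. enat (d + 2) = enat (length xs) \<and> regular_sequence S xs \<and> set xs \<subseteq> irrelevant_ideal S"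
      by metis
  qed
  have "cm_defect S (irrelevant_ideal S) = enat (2 * d - (d + 2))"
    by (simp add: cm_defect_def dim depth)
  then show ?thesis using serre cm dim depth by simp
qed

end
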